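(* Let $\mathcal{B}$ be Bring's curve $\{\sum_{i=1}^5 x_i=\sum_{i=1}^5x_i^2=\sum_{i=1}^5x_i^3=0\}\subset\mathbb{P}^4$ over $\mathbb{C}$, with $S_5$ acting by permuting coordinates. Then there are isomorphisms of elliptic curves over $\mathbb{C}$ $$\mathcal{B}/\langle(12)(34),(345)\rangle\cong\mathcal{B}/\langle(12)(34),(13)(24)\rangle,$$ both having $j$-invariant $-\dfrac{5\times29^3}{2^5}$, and $$\mathcal{B}/\langle(12)\rangle\cong\mathcal{B}/\langle(1324)\rangle,$$ both having $j$-invariant $-\dfrac{25}{2}$.
   Context: Isomorphisms are as smooth projective curves of genus one. The $j$-invariant is normalised so that $j=1728$ for $y^2=x^3-x$. *)

theory Defs
  imports
    "HOL-Analysis.Analysis"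
    "HOL-Algebra.Bij"
    "HOL-Algebra.Generated_Groups"
    "HOL-Combinatorics.Cycles"
begin

section \<open>Spaces with functions\<close>

text \<open>
  Complex algebraic varieties are treated as spaces with functions: a topological space together
  with, for every open set \<open>U\<close>, the regular functions \<open>U \<rightarrow> \<complex>\<close>. Functions are total in HOL;
  every instance below only looks at the values of \<open>f\<close> on \<open>U\<close>.
\<close>

record 'a fun_space =
  sp_top :: "'a topology"
  sp_reg :: "'a set \<Rightarrow> ('a \<Rightarrow> complex) \<Rightarrow> bool"

definition sp_morphism :: "'a fun_space \<Rightarrow> 'b fun_space \<Rightarrow> ('a \<Rightarrow> 'b) \<Rightarrow> bool" where
  "sp_morphism X Y \<phi> \<longleftrightarrow>
     continuous_map (sp_top X) (sp_top Y) \<phi> \<and>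
     (\<forall>U f. openin (sp_top Y) U \<longrightarrow> sp_reg Y U f \<longrightarrow>
        sp_reg X {x \<in> topspace (sp_top X). \<phi> x \<in> U} (f \<circ> \<phi>))"

definition sp_isomorphic :: "'a fun_space \<Rightarrow> 'b fun_space \<Rightarrow> bool" (infix "\<cong>\<^sub>v" 50) where
  "X \<cong>\<^sub>v Y \<longleftrightarrow>
     (\<exists>\<phi> \<psi>. sp_morphism X Y \<phi> \<and> sp_morphism Y X \<psi> \<and>
        (\<forall>x \<in> topspace (sp_top X). \<psi> (\<phi> x) = x) \<and>
        (\<forall>y \<in> topspace (sp_top Y). \<phi> (\<psi> y) = y))"

section \<open>Projective varieties\<close>

text \<open>
  A homogeneous polynomial of degree \<open>d\<close>, viewed as a function; an exponent vector is a function
  \<open>m :: 'n \<Rightarrow> nat\<close>.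
\<close>

definition hom_poly :: "nat \<Rightarrow> (complex ^ 'n \<Rightarrow> complex) \<Rightarrow> bool" where
  "hom_poly d F \<longleftrightarrow>
     (\<exists>c :: ('n \<Rightarrow> nat) \<Rightarrow> complex.
        F = (\<lambda>x. \<Sum>m \<in> {m. (\<Sum>i\<in>UNIV. m i) = d}. c m * (\<Prod>i\<in>UNIV. (x $ i) ^ m i)))"

text \<open>\<open>P(\<complex>\<^sup>n)\<close> is the set of lines through the origin.\<close>

definition proj_space :: "(complex ^ 'n) set set" where
  "proj_space = {vec.span {x} | x. x \<noteq> 0}"

definition nonvanishing_locus :: "(complex ^ 'n \<Rightarrow> complex) \<Rightarrow> (complex ^ 'n) set set" where
  "nonvanishing_locus F = {L \<in> proj_space. \<forall>x \<in> L - {0}. F x \<noteq> 0}"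

text \<open>
  The sets \<open>nonvanishing_locus F\<close> are closed under binary intersection (multiply the polynomials),
  so the open sets are their unions, i.e. the closed sets are the common zero loci of families of
  homogeneous polynomials.
\<close>

definition zariski :: "(complex ^ 'n) set topology" where
  "zariski = topology_generated_by {nonvanishing_locus F | F d. hom_poly d F}"

text \<open>The variety structure on a Zariski closed subset \<open>V\<close> of projective space.\<close>

definition proj_variety :: "(complex ^ 'n) set set \<Rightarrow> (complex ^ 'n) set fun_space" where
  "proj_variety V =
     \<lparr>sp_top = subtopology zariski V,
      sp_reg = (\<lambda>U f. \<forall>p \<in> U. \<exists>W. openin (subtopology zariski V) W \<and> p \<in> W \<and> W \<subseteq> U \<and>
        (\<exists>d F G. hom_poly d F \<and> hom_poly d G \<and>
           (\<forall>L \<in> W. \<forall>x \<in> L - {0}. G x \<noteq> 0 \<and> f L = F x / G x)))\<rparr>"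

section \<open>Quotients by groups of automorphisms\<close>

definition orbit_of :: "('a \<Rightarrow> 'a) set \<Rightarrow> 'a \<Rightarrow> 'a set" where
  "orbit_of H x = {h x | h. h \<in> H}"

definition quotient_top :: "'a topology \<Rightarrow> ('a \<Rightarrow> 'b) \<Rightarrow> 'b topology" where
  "quotient_top T q =
     topology (\<lambda>U. U \<subseteq> q ` topspace T \<and> openin T {x \<in> topspace T. q x \<in> U})"

lemma openin_quotient_top:
  "openin (quotient_top T q) U \<longleftrightarrow>
     U \<subseteq> q ` topspace T \<and> openin T {x \<in> topspace T. q x \<in> U}"
proof -
  have "istopology (\<lambda>U. U \<subseteq> q ` topspace T \<and> openin T {x \<in> topspace T. q x \<in> U})"
    unfolding istopology_def
  proof (intro conjI allI impI)
    fix A B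
    assume a: "A \<subseteq> q ` topspace T \<and> openin T {x \<in> topspace T. q x \<in> A}"
      and b: "B \<subseteq> q ` topspace T \<and> openin T {x \<in> topspace T. q x \<in> B}"
    show "A \<inter> B \<subseteq> q ` topspace T" using a by blast
    have "{x \<in> topspace T. q x \<in> A \<inter> B} =
        {x \<in> topspace T. q x \<in> A} \<inter> {x \<in> topspace T. q x \<in> B}" by blast
    then show "openin T {x \<in> topspace T. q x \<in> A \<inter> B}"
      using a b by (simp add: openin_Int)
  next
    fix K
    assume k: "\<forall>A\<in>K. A \<subseteq> q ` topspace T \<and> openin T {x \<in> topspace T. q x \<in> A}"
    show "\<Union>K \<subseteq> q ` topspace T" using k by blast
    have "{x \<in> topspace T. q x \<in> \<Union>K} = (\<Union>A\<in>K. {x \<in> topspace T. q x \<in> A})" by blast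
    then show "openin T {x \<in> topspace T. q x \<in> \<Union>K}"
      using k by auto
  qed
  then show ?thesis
    unfolding quotient_top_def by (simp add: topology_inverse')
qed

text \<open>
  The quotient variety \<open>X / H\<close>: the orbit space with the quotient topology, whose regular functions
  are those that pull back to (automatically invariant) regular functions on \<open>X\<close>.
\<close>

definition sp_quotient :: "'a fun_space \<Rightarrow> ('a \<Rightarrow> 'a) set \<Rightarrow> 'a set fun_space" where
  "sp_quotient X H =
     \<lparr>sp_top = quotient_top (sp_top X) (orbit_of H),
      sp_reg = (\<lambda>U f.
        sp_reg X {x \<in> topspace (sp_top X). orbit_of H x \<in> U} (f \<circ> orbit_of H))\<rparr>"

section \<open>Elliptic curves and their \<open>j\<close>-invariant\<close>

text \<open>\<open>y\<^sup>2 z = x\<^sup>3 + a x z\<^sup>2 + b z\<^sup>3\<close>, where \<open>(x, y, z) = (v $ 1, v $ 2, v $ 3)\<close>.\<close>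

definition weierstrass_curve :: "complex \<Rightarrow> complex \<Rightarrow> (complex ^ 3) set fun_space" where
  "weierstrass_curve a b = proj_variety {L \<in> proj_space. \<forall>v \<in> L.
     (v $ 2)^2 * v $ 3 = (v $ 1)^3 + a * v $ 1 * (v $ 3)^2 + b * (v $ 3)^3}"

definition weierstrass_j :: "complex \<Rightarrow> complex \<Rightarrow> complex" where
  "weierstrass_j a b = 1728 * (4 * a^3) / (4 * a^3 + 27 * b^2)"

text \<open>
  \<open>X\<close> is an elliptic curve with \<open>j\<close>-invariant \<open>j\<close>, i.e. isomorphic to a smooth Weierstrass cubic
  with that \<open>j\<close>-invariant. The value does not depend on the choice of the cubic.
\<close>

definition elliptic_with_j :: "'a fun_space \<Rightarrow> complex \<Rightarrow> bool" where
  "elliptic_with_j X j \<longleftrightarrow>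
     (\<exists>a b. 4 * a^3 + 27 * b^2 \<noteq> 0 \<and> X \<cong>\<^sub>v weierstrass_curve a b \<and> weierstrass_j a b = j)"

section \<open>Bring's curve\<close>

text \<open>
  Coordinates are indexed by the five-element type \<open>5\<close>, whose elements are \<open>1, 2, 3, 4, 5\<close>
  with \<open>5 = 0\<close>.
\<close>

definition bring_curve :: "(complex ^ 5) set fun_space" where
  "bring_curve = proj_variety {L \<in> proj_space. \<forall>x \<in> L.
     (\<Sum>i\<in>UNIV. x $ i) = 0 \<and> (\<Sum>i\<in>UNIV. (x $ i)^2) = 0 \<and> (\<Sum>i\<in>UNIV. (x $ i)^3) = 0}"

text \<open>The left action: the \<open>i\<close>-th coordinate is moved to position \<open>\<sigma> i\<close>.\<close>

definition perm_coords :: "('n \<Rightarrow> 'n) \<Rightarrow> complex ^ 'n \<Rightarrow> complex ^ 'n" where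
  "perm_coords \<sigma> x = (\<chi> i. x $ (inv_into UNIV \<sigma> i))"

definition perm_line :: "('n \<Rightarrow> 'n) \<Rightarrow> (complex ^ 'n) set \<Rightarrow> (complex ^ 'n) set" where
  "perm_line \<sigma> L = perm_coords \<sigma> ` L"

text \<open>The quotient of Bring's curve by the subgroup of \<open>S\<^sub>5\<close> generated by \<open>S\<close>.\<close>

definition bring_quotient :: "(5 \<Rightarrow> 5) set \<Rightarrow> (complex ^ 5) set set fun_space" where
  "bring_quotient S = sp_quotient bring_curve (perm_line ` generate (BijGroup (UNIV :: 5 set)) S)"

end

theory Submission
  imports Defs "HOL-Algebra.Multiplicative_Group"
begin

text \<open>
  Each of the four quotients is identified with an explicit Weierstrass cubic by an explicit map
  \<open>\<Phi> = (X, Y, Z)\<close> given by three forms of one degree \<open>e\<close>. The first and the second pair of subgroups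
  each lead to one and the same cubic, so the two isomorphisms follow by transitivity and the
  \<open>j\<close>-invariants by arithmetic.

  The reason why such a \<open>\<Phi>\<close> induces an isomorphism (locale \<open>cone_quotient\<close>) is algebraic: it suffices
  that \<open>\<Phi>\<close> maps onto the cubic, changes by a scalar under the group, and that every invariant form on
  the cone over Bring's curve whose degree is \<open>e k\<close>, for \<open>k\<close> in the multiples of some fixed \<open>M\<close>, is a
  polynomial in \<open>X, Y, Z\<close>. Averaging a local representation \<open>F / G\<close> of an invariant function over the
  group, after multiplying by a form which vanishes outside its domain of validity and at the other
  points of the orbit, represents it with invariant numerator and denominator
  (\<open>local_invariant_fraction\<close>); these are polynomials in \<open>\<Phi>\<close>. This one construction yields the
  separation of orbits, the quotient topology and the descent of regular functions, with no appeal
  to normality or to dimension theory.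

  The algebra rests on two descriptions of the curve. Let \<open>t = x\<^sub>5\<close> and let \<open>c, d, e\<close> be the three linear
  forms in \<open>x\<^sub>1, \<dots>, x\<^sub>4\<close> on which the Klein four-group acts by its nontrivial characters. The equations
  become \<open>c\<^sup>2 + d\<^sup>2 + e\<^sup>2 = -5 t\<^sup>2\<close> and \<open>c d e = -5 t\<^sup>3\<close> (\<open>bring_cone_chi\<close>), so the Klein quotient is the
  cubic \<open>5 C D E + (C + D + E)\<^sup>3 = 0\<close> in \<open>C = c\<^sup>2, D = d\<^sup>2, E = e\<^sup>2\<close>, and for the cyclic group of order
  four one may take \<open>\<Phi>\<close> to be linear in \<open>(d e, c t, d\<^sup>2 - e\<^sup>2)\<close>. On the other hand, eliminating
  \<open>x\<^sub>1, x\<^sub>2\<close> leaves the complete homogeneous cubic \<open>h\<^sub>3(x\<^sub>3, x\<^sub>4, x\<^sub>5) = 0\<close> (\<open>bring_cone_h3\<close>), which is the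
  quotient by the transposition; and with \<open>s = x\<^sub>3 + x\<^sub>4 + x\<^sub>5\<close>, \<open>\<delta> = x\<^sub>1 - x\<^sub>2\<close> and the Vandermonde product
  \<open>\<Delta>\<close> of \<open>x\<^sub>3, x\<^sub>4, x\<^sub>5\<close>, the quotient by the group of order six is given by \<open>(s\<^sup>2 \<delta>, \<Delta>, \<delta>\<^sup>3)\<close>. In every
  case the invariants are found by averaging monomials in coordinates that diagonalise the group
  or, for the nonabelian group, its cyclic subgroup of order three (\<open>descends_by_averaging\<close>).
\<close>

section \<open>Homogeneous polynomial functions\<close>

lemma finite_exponents: "finite {m :: 'n::finite \<Rightarrow> nat. (\<Sum>i\<in>UNIV. m i) = d}"
proof (rule finite_subset)
  show "{m :: 'n \<Rightarrow> nat. (\<Sum>i\<in>UNIV. m i) = d} \<subseteq> UNIV \<rightarrow>\<^sub>E {..d}"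
  proof
    fix m :: "'n \<Rightarrow> nat" assume m: "m \<in> {m. (\<Sum>i\<in>UNIV. m i) = d}"
    have "m i \<le> d" for i using m member_le_sum[of i UNIV m] by simp
    then show "m \<in> UNIV \<rightarrow>\<^sub>E {..d}" by (auto simp: PiE_def)
  qed
  show "finite (UNIV \<rightarrow>\<^sub>E {..d} :: ('n \<Rightarrow> nat) set)"
    by (intro finite_PiE) auto
qed

lemma hom_poly_zero: "hom_poly d (\<lambda>x. 0)"
  unfolding hom_poly_def by (rule exI[of _ "\<lambda>_. 0"]) simp

lemma hom_poly_add:
  assumes "hom_poly d F" "hom_poly d G"
  shows "hom_poly d (\<lambda>x. F x + G x)"
proof -
  from assms obtain c c' where
    "F = (\<lambda>x. \<Sum>m \<in> {m. (\<Sum>i\<in>UNIV. m i) = d}. c m * (\<Prod>i\<in>UNIV. (x $ i) ^ m i))"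
    "G = (\<lambda>x. \<Sum>m \<in> {m. (\<Sum>i\<in>UNIV. m i) = d}. c' m * (\<Prod>i\<in>UNIV. (x $ i) ^ m i))"
    unfolding hom_poly_def by blast
  then show ?thesis unfolding hom_poly_def
    by (intro exI[of _ "\<lambda>m. c m + c' m"]) (simp add: sum.distrib ring_distribs)
qed

lemma hom_poly_cmult:
  assumes "hom_poly d F"
  shows "hom_poly d (\<lambda>x. a * F x)"
proof -
  from assms obtain c where
    "F = (\<lambda>x. \<Sum>m \<in> {m. (\<Sum>i\<in>UNIV. m i) = d}. c m * (\<Prod>i\<in>UNIV. (x $ i) ^ m i))"
    unfolding hom_poly_def by blast
  then show ?thesis unfolding hom_poly_def
    by (intro exI[of _ "\<lambda>m. a * c m"]) (simp add: sum_distrib_left mult.assoc)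
qed

lemma hom_poly_minus: "hom_poly d F \<Longrightarrow> hom_poly d (\<lambda>x. - F x)"
  using hom_poly_cmult[of d F "-1"] by simp

lemma hom_poly_diff: "hom_poly d F \<Longrightarrow> hom_poly d G \<Longrightarrow> hom_poly d (\<lambda>x. F x - G x)"
  using hom_poly_add[OF _ hom_poly_minus, of d F G] by simp

lemma hom_poly_sum: "(\<And>i. i \<in> I \<Longrightarrow> hom_poly d (F i)) \<Longrightarrow> hom_poly d (\<lambda>x. \<Sum>i\<in>I. F i x)"
  by (induction I rule: infinite_finite_induct) (auto intro: hom_poly_zero hom_poly_add)

lemma hom_poly_monomial:
  fixes m :: "'n::finite \<Rightarrow> nat"
  assumes "(\<Sum>i\<in>UNIV. m i) = d"
  shows "hom_poly d (\<lambda>x. \<Prod>i\<in>UNIV. (x $ i) ^ m i)"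
  unfolding hom_poly_def
proof (intro exI ext)
  fix x :: "complex ^ 'n"
  let ?M = "{m :: 'n \<Rightarrow> nat. (\<Sum>i\<in>UNIV. m i) = d}"
  have "(\<Sum>m' \<in> ?M. (if m' = m then 1 else 0) * (\<Prod>i\<in>UNIV. (x $ i) ^ m' i))
      = (\<Sum>m' \<in> ?M. if m' = m then (\<Prod>i\<in>UNIV. (x $ i) ^ m' i) else 0)"
    by (intro sum.cong) auto
  also have "\<dots> = (\<Prod>i\<in>UNIV. (x $ i) ^ m i)"
    using assms by (subst sum.delta[OF finite_exponents]) simp
  finally show "(\<Prod>i\<in>UNIV. (x $ i) ^ m i)
      = (\<Sum>m' \<in> ?M. (if m' = m then 1 else 0) * (\<Prod>i\<in>UNIV. (x $ i) ^ m' i))" by (rule sym)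
qed

lemma hom_poly_const: "hom_poly 0 (\<lambda>x. a)"
  using hom_poly_cmult[OF hom_poly_monomial[of "\<lambda>_. 0" 0], of a] by simp

lemma hom_poly_coord: "hom_poly 1 (\<lambda>x. x $ i)"
proof -
  have "(\<Prod>j\<in>UNIV. (x $ j) ^ (if j = i then 1 else 0)) = x $ i" for x :: "complex ^ 'a"
    by (subst prod.remove[of _ i]) auto
  then show ?thesis
    using hom_poly_monomial[of "\<lambda>j. if j = i then 1 else 0" 1] by simp
qed

lemma hom_poly_mult:
  assumes "hom_poly d F" "hom_poly e G"
  shows "hom_poly (d + e) (\<lambda>x. F x * G x)"
proof -
  from assms obtain c c' where
    F: "F = (\<lambda>x. \<Sum>m \<in> {m. (\<Sum>i\<in>UNIV. m i) = d}. c m * (\<Prod>i\<in>UNIV. (x $ i) ^ m i))" and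
    G: "G = (\<lambda>x. \<Sum>m \<in> {m. (\<Sum>i\<in>UNIV. m i) = e}. c' m * (\<Prod>i\<in>UNIV. (x $ i) ^ m i))"
    unfolding hom_poly_def by blast
  have "(\<lambda>x. F x * G x) =
     (\<lambda>x. \<Sum>m\<in>{m. (\<Sum>i\<in>UNIV. m i) = d}. \<Sum>m'\<in>{m. (\<Sum>i\<in>UNIV. m i) = e}.
        (c m * c' m') * (\<Prod>i\<in>UNIV. (x $ i) ^ (m i + m' i)))" (is "_ = ?R")
    unfolding F G sum_product by (simp add: power_add prod.distrib mult_ac)
  moreover have "hom_poly (d + e) ?R"
    by (intro hom_poly_sum hom_poly_cmult hom_poly_monomial) (simp add: sum.distrib)
  ultimately show ?thesis by simp
qed

lemma hom_poly_mult_eq: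
  "hom_poly d F \<Longrightarrow> hom_poly e G \<Longrightarrow> k = d + e \<Longrightarrow> hom_poly k (\<lambda>x. F x * G x)"
  using hom_poly_mult by blast

lemma hom_poly_power: "hom_poly d F \<Longrightarrow> hom_poly (d * n) (\<lambda>x. F x ^ n)"
  by (induction n) (auto intro: hom_poly_const hom_poly_mult)

lemma hom_poly_prod:
  "(\<And>i. i \<in> I \<Longrightarrow> hom_poly (d i) (F i)) \<Longrightarrow> hom_poly (\<Sum>i\<in>I. d i) (\<lambda>x. \<Prod>i\<in>I. F i x)"
  by (induction I rule: infinite_finite_induct) (auto intro: hom_poly_const hom_poly_mult)

lemma hom_poly_compose:
  assumes F: "hom_poly d F" and A: "\<And>i. hom_poly e (\<lambda>x. A x $ i)"
  shows "hom_poly (e * d) (\<lambda>x. F (A x))"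
proof -
  from F obtain c where
    F: "F = (\<lambda>x. \<Sum>m \<in> {m. (\<Sum>i\<in>UNIV. m i) = d}. c m * (\<Prod>i\<in>UNIV. (x $ i) ^ m i))"
    unfolding hom_poly_def by blast
  have "hom_poly (\<Sum>i\<in>UNIV. e * m i) (\<lambda>x. \<Prod>i\<in>UNIV. (A x $ i) ^ m i)" for m
    by (intro hom_poly_prod hom_poly_power A)
  then show ?thesis
    unfolding F by (intro hom_poly_sum hom_poly_cmult) (auto simp: sum_distrib_left)
qed

lemma hom_poly_scale:
  assumes "hom_poly d F"
  shows "F (a *s x) = a ^ d * F x"
proof -
  from assms obtain c where
    F: "F = (\<lambda>x. \<Sum>m \<in> {m. (\<Sum>i\<in>UNIV. m i) = d}. c m * (\<Prod>i\<in>UNIV. (x $ i) ^ m i))"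
    unfolding hom_poly_def by blast
  show ?thesis unfolding F sum_distrib_left
    by (intro sum.cong) (auto simp: power_mult_distrib prod.distrib power_sum)
qed

lemma hom_poly_perm:
  assumes "hom_poly d F"
  shows "hom_poly d (\<lambda>x. F (perm_coords g x))"
proof -
  have "hom_poly (1 * d) (\<lambda>x. F (perm_coords g x))"
    by (rule hom_poly_compose[OF assms]) (unfold perm_coords_def vec_lambda_beta, rule hom_poly_coord)
  then show ?thesis by simp
qed

subsection \<open>Functions on a cone that descend along a map\<close>

text \<open>
  Membership in the subring generated by the components of \<open>\<Phi>\<close>, taken on \<open>K\<close> only and with its
  grading by the degree in those components.
\<close>

definition descends ::
    "(complex ^ 'n) set \<Rightarrow> (complex ^ 'n \<Rightarrow> complex ^ 'm) \<Rightarrow> nat \<Rightarrow> (complex ^ 'n \<Rightarrow> complex) \<Rightarrow> bool"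
  where "descends K \<Phi> k f \<longleftrightarrow> (\<exists>P. hom_poly k P \<and> (\<forall>x\<in>K. f x = P (\<Phi> x)))"

lemma descends_cong: "descends K \<Phi> k f \<Longrightarrow> (\<And>x. x \<in> K \<Longrightarrow> g x = f x) \<Longrightarrow> descends K \<Phi> k g"
  unfolding descends_def by auto

lemma descends_zero: "descends K \<Phi> k (\<lambda>x. 0)"
  unfolding descends_def using hom_poly_zero by blast

lemma descends_coord: "descends K \<Phi> 1 (\<lambda>x. \<Phi> x $ i)"
  unfolding descends_def using hom_poly_coord by blast

lemma descends_add: "descends K \<Phi> k f \<Longrightarrow> descends K \<Phi> k g \<Longrightarrow> descends K \<Phi> k (\<lambda>x. f x + g x)"
  unfolding descends_def using hom_poly_add by fastforce

lemma descends_cmult: "descends K \<Phi> k f \<Longrightarrow> descends K \<Phi> k (\<lambda>x. a * f x)"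
  unfolding descends_def using hom_poly_cmult by fastforce

lemma descends_diff: "descends K \<Phi> k f \<Longrightarrow> descends K \<Phi> k g \<Longrightarrow> descends K \<Phi> k (\<lambda>x. f x - g x)"
  unfolding descends_def using hom_poly_diff by fastforce

lemma descends_mult:
  "descends K \<Phi> k f \<Longrightarrow> descends K \<Phi> l g \<Longrightarrow> n = k + l \<Longrightarrow> descends K \<Phi> n (\<lambda>x. f x * g x)"
  unfolding descends_def using hom_poly_mult by fastforce

lemma descends_power: "descends K \<Phi> k f \<Longrightarrow> l = k * n \<Longrightarrow> descends K \<Phi> l (\<lambda>x. f x ^ n)"
  unfolding descends_def using hom_poly_power by fastforce

lemma descends_sum:
  "(\<And>i. i \<in> I \<Longrightarrow> descends K \<Phi> k (f i)) \<Longrightarrow> descends K \<Phi> k (\<lambda>x. \<Sum>i\<in>I. f i x)"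
  by (induction I rule: infinite_finite_induct) (auto intro: descends_zero descends_add)

lemma prod_4: "(\<Prod>i\<in>UNIV. f i) = f 1 * f 2 * f 3 * f (4::4)"
  unfolding UNIV_4 by (simp add: mult_ac)

text \<open>
  An invariant form is the average of its own translates. Expanding it in linear coordinates \<open>Y\<close> on
  the cone reduces descent to averages of monomials, for which a diagonal action is transparent. The
  translates are indexed by an arbitrary set, which saves checking that they are distinct.
\<close>

lemma descends_by_averaging:
  fixes Y :: "complex ^ 'n \<Rightarrow> complex ^ 4" and T :: "complex ^ 4 \<Rightarrow> complex ^ 'n"
    and act :: "'j \<Rightarrow> complex ^ 'n \<Rightarrow> complex ^ 'n"
  assumes F: "hom_poly d F"
    and T: "\<And>i. hom_poly 1 (\<lambda>y. T y $ i)" and TY: "\<And>x. x \<in> K \<Longrightarrow> T (Y x) = x"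
    and J: "finite J" "J \<noteq> {}"
    and inv: "\<And>g x. g \<in> J \<Longrightarrow> x \<in> K \<Longrightarrow> act g x \<in> K \<and> F (act g x) = F x"
    and mono: "\<And>i j k l. i + j + k + l = d \<Longrightarrow> descends K \<Phi> n (\<lambda>x. \<Sum>g\<in>J.
       (Y (act g x) $ 1) ^ i * (Y (act g x) $ 2) ^ j * (Y (act g x) $ 3) ^ k * (Y (act g x) $ 4) ^ l)"
  shows "descends K \<Phi> n F"
proof -
  have "hom_poly d (\<lambda>y. F (T y))" using hom_poly_compose[OF F T] by simp
  then obtain c where "(\<lambda>y. F (T y)) =
      (\<lambda>y. \<Sum>m \<in> {m. (\<Sum>i\<in>UNIV. m i) = d}. c m * (\<Prod>i\<in>UNIV. (y $ i) ^ m i))"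
    unfolding hom_poly_def by blast
  then have c: "F (T y) = (\<Sum>m \<in> {m. (\<Sum>i\<in>UNIV. m i) = d}. c m * (\<Prod>i\<in>UNIV. (y $ i) ^ m i))"
    for y by (rule fun_cong)
  let ?mon = "\<lambda>m y. \<Prod>i\<in>UNIV. ((y::complex^4) $ i) ^ m i"
  have "descends K \<Phi> n (\<lambda>x. 1 / of_nat (card J) *
      (\<Sum>m \<in> {m. (\<Sum>i\<in>UNIV. m i) = d}. c m * (\<Sum>g\<in>J. ?mon m (Y (act g x)))))"
    unfolding prod_4 by (intro descends_cmult descends_sum mono) (auto simp: sum_4)
  moreover have "F x = 1 / of_nat (card J) *
      (\<Sum>m \<in> {m. (\<Sum>i\<in>UNIV. m i) = d}. c m * (\<Sum>g\<in>J. ?mon m (Y (act g x))))" if "x \<in> K" for x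
  proof -
    have "of_nat (card J) * F x = (\<Sum>g\<in>J. F (T (Y (act g x))))"
      using that inv by (simp add: TY)
    also have "\<dots> = (\<Sum>m \<in> {m. (\<Sum>i\<in>UNIV. m i) = d}. c m * (\<Sum>g\<in>J. ?mon m (Y (act g x))))"
      unfolding c sum_distrib_left by (rule sum.swap)
    finally show ?thesis using J by (simp add: field_simps)
  qed
  ultimately show ?thesis by (rule descends_cong)
qed

section \<open>Lines and the Zariski topology\<close>

lemma in_line: "y \<in> vec.span {x} \<longleftrightarrow> (\<exists>k. y = k *s x)"
  by (auto simp: vec.span_singleton)

lemma line_eqI:
  assumes "y \<in> vec.span {x}" "y \<noteq> 0"
  shows "vec.span {y} = vec.span {x}"
proof -
  obtain k where k: "y = k *s x" using assms(1) in_line by blast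
  with assms(2) have "k \<noteq> 0" by auto
  have "x = (1 / k) *s y" using k \<open>k \<noteq> 0\<close> by simp
  then have "x \<in> vec.span {y}" using in_line by blast
  with assms(1) show ?thesis
    by (intro antisym vec.span_minimal) (auto simp: vec.subspace_span)
qed

lemma line_scale: "k \<noteq> 0 \<Longrightarrow> vec.span {k *s x} = vec.span {x :: complex ^ 'n}"
  by (cases "x = 0") (auto simp: in_line intro!: line_eqI)

lemma line_in_proj_space: "x \<noteq> 0 \<Longrightarrow> vec.span {x} \<in> proj_space"
  unfolding proj_space_def by blast

lemma proj_space_line: "L \<in> proj_space \<Longrightarrow> x \<in> L \<Longrightarrow> x \<noteq> 0 \<Longrightarrow> L = vec.span {x}"
  unfolding proj_space_def using line_eqI by blast

lemma proj_spaceE: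
  assumes "L \<in> proj_space"
  obtains x where "x \<noteq> 0" "L = vec.span {x}"
  using assms unfolding proj_space_def by blast

lemma nonvanishing_line:
  assumes "hom_poly d F" "x \<noteq> 0"
  shows "vec.span {x} \<in> nonvanishing_locus F \<longleftrightarrow> F x \<noteq> 0"
proof -
  have F: "F y \<noteq> 0" if y: "y \<in> vec.span {x} - {0}" and Fx: "F x \<noteq> 0" for y
  proof -
    obtain k where k: "y = k *s x" using y in_line by blast
    with y have "k \<noteq> 0" by auto
    with Fx show ?thesis by (simp add: k hom_poly_scale[OF assms(1)])
  qed
  have "x \<in> vec.span {x} - {0}" using assms(2) by (simp add: vec.span_base)
  with F show ?thesis
    unfolding nonvanishing_locus_def using line_in_proj_space[OF assms(2)] by blast
qed

lemma nonvanishing_Int: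
  "nonvanishing_locus (\<lambda>x. F x * G x) = nonvanishing_locus F \<inter> nonvanishing_locus G"
  unfolding nonvanishing_locus_def by auto

text \<open>
  The nonvanishing loci form a basis rather than only a subbasis, since products of forms are forms.
\<close>

lemma openin_zariski:
  "openin zariski U \<longleftrightarrow>
    (\<forall>L\<in>U. \<exists>d F. hom_poly d F \<and> L \<in> nonvanishing_locus F \<and> nonvanishing_locus F \<subseteq> U)"
  (is "?l \<longleftrightarrow> ?r U")
proof
  assume ?l
  then have "generate_topology_on {nonvanishing_locus F | F d. hom_poly d F} U"
    unfolding zariski_def openin_topology_generated_by_iff .
  then show "?r U"
  proof induction
    case Empty
    show ?case by simp
  next
    case (Int a b)
    show ?case
    proof
      fix L assume L: "L \<in> a \<inter> b"
      obtain d F where F: "hom_poly d F" "L \<in> nonvanishing_locus F" "nonvanishing_locus F \<subseteq> a"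
        using Int.IH(1) L by blast
      obtain e G where G: "hom_poly e G" "L \<in> nonvanishing_locus G" "nonvanishing_locus G \<subseteq> b"
        using Int.IH(2) L by blast
      show "\<exists>d F. hom_poly d F \<and> L \<in> nonvanishing_locus F \<and> nonvanishing_locus F \<subseteq> a \<inter> b"
        using hom_poly_mult[OF F(1) G(1)] nonvanishing_Int[of F G] F(2,3) G(2,3)
        by (intro exI[of _ "d + e"] exI[of _ "\<lambda>x. F x * G x"]) auto
    qed
  next
    case (UN K)
    show ?case
    proof
      fix L assume "L \<in> \<Union>K"
      then obtain k where k: "k \<in> K" "L \<in> k" by blast
      with UN.IH[OF k(1)] obtain d F
        where "hom_poly d F" "L \<in> nonvanishing_locus F" "nonvanishing_locus F \<subseteq> k" by blast
      with k show "\<exists>d F. hom_poly d F \<and> L \<in> nonvanishing_locus F \<and> nonvanishing_locus F \<subseteq> \<Union>K"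
        by blast
    qed
  next
    case (Basis s)
    then show ?case by blast
  qed
next
  assume r: "?r U"
  have "U = \<Union>{nonvanishing_locus F | F d. hom_poly d F \<and> nonvanishing_locus F \<subseteq> U}"
    using r by blast
  moreover have "openin zariski \<dots>"
    unfolding zariski_def by (intro openin_Union) (auto intro!: topology_generated_by_Basis)
  ultimately show ?l by simp
qed

lemma openin_nonvanishing: "hom_poly d F \<Longrightarrow> openin zariski (nonvanishing_locus F)"
  unfolding openin_zariski by blast

lemma topspace_zariski: "topspace zariski = proj_space"
proof -
  have "topspace zariski = \<Union>{nonvanishing_locus F | F d. hom_poly d F}"
    unfolding zariski_def by (rule topology_generated_by_topspace)
  also have "\<dots> = proj_space"
  proof
    have "nonvanishing_locus (\<lambda>x. 1) = proj_space" by (auto simp: nonvanishing_locus_def)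
    then show "proj_space \<subseteq> \<Union>{nonvanishing_locus F | F d. hom_poly d F}"
      using hom_poly_const[of 1] by blast
  qed (auto simp: nonvanishing_locus_def)
  finally show ?thesis .
qed

text \<open>
  Two distinct lines are separated by a \<open>2\<times>2\<close> minor, which is a linear form in one of the arguments.
\<close>

lemma t1_space_zariski: "t1_space zariski"
  unfolding t1_space_def topspace_zariski
proof (intro ballI impI)
  fix L M :: "(complex ^ 'n) set"
  assume LM: "L \<in> proj_space" "M \<in> proj_space" "L \<noteq> M"
  obtain x where x: "x \<noteq> 0" "L = vec.span {x}" using LM(1) by (rule proj_spaceE)
  obtain y where y: "y \<noteq> 0" "M = vec.span {y}" using LM(2) by (rule proj_spaceE)
  obtain j where j: "y $ j \<noteq> 0" using y(1) by (auto simp: vec_eq_iff)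
  have "\<exists>i. x $ i * y $ j - x $ j * y $ i \<noteq> 0"
  proof (rule ccontr)
    assume "\<not> ?thesis"
    then have "x = (x $ j / y $ j) *s y" using j by (simp add: vec_eq_iff field_simps)
    then have "x \<in> vec.span {y}" unfolding in_line by blast
    with x y LM(3) show False using line_eqI by blast
  qed
  then obtain i where i: "x $ i * y $ j - x $ j * y $ i \<noteq> 0" by blast
  let ?F = "\<lambda>z. y $ j * z $ i - y $ i * z $ j"
  have F: "hom_poly 1 ?F" by (intro hom_poly_diff hom_poly_cmult hom_poly_coord)
  have "L \<in> nonvanishing_locus ?F" "M \<notin> nonvanishing_locus ?F"
    using i unfolding x(2) y(2) nonvanishing_line[OF F x(1)] nonvanishing_line[OF F y(1)]
    by (simp_all add: mult.commute)
  with openin_nonvanishing[OF F] show "\<exists>U. openin zariski U \<and> L \<in> U \<and> M \<notin> U" by blast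
qed

lemma openin_subvariety:
  "openin (subtopology zariski V) W \<longleftrightarrow> W \<subseteq> V \<and>
    (\<forall>L\<in>W. \<exists>d F. hom_poly d F \<and> L \<in> nonvanishing_locus F \<and> nonvanishing_locus F \<inter> V \<subseteq> W)"
  (is "_ \<longleftrightarrow> ?r")
proof
  assume "openin (subtopology zariski V) W"
  then obtain U where U: "openin zariski U" "W = U \<inter> V"
    unfolding openin_subtopology by blast
  then show ?r unfolding openin_zariski by blast
next
  assume r: ?r
  let ?U = "\<Union>{nonvanishing_locus F | F d. hom_poly d F \<and> nonvanishing_locus F \<inter> V \<subseteq> W}"
  have "openin zariski ?U" by (intro openin_Union) (auto intro: openin_nonvanishing)
  moreover have "W = ?U \<inter> V"
  proof
    show "W \<subseteq> ?U \<inter> V"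
    proof
      fix L assume "L \<in> W"
      with r obtain d F where "hom_poly d F" "L \<in> nonvanishing_locus F"
        "nonvanishing_locus F \<inter> V \<subseteq> W" "L \<in> V" by (meson subsetD)
      then show "L \<in> ?U \<inter> V" by blast
    qed
  qed auto
  ultimately show "openin (subtopology zariski V) W"
    unfolding openin_subtopology by blast
qed

lemma sp_reg_proj_variety:
  "sp_reg (proj_variety V) U f \<longleftrightarrow> (\<forall>p\<in>U. \<exists>W d F G. openin (subtopology zariski V) W \<and> p \<in> W \<and>
     W \<subseteq> U \<and> hom_poly d F \<and> hom_poly d G \<and> (\<forall>L\<in>W. \<forall>x\<in>L - {0}. G x \<noteq> 0 \<and> f L = F x / G x))"
  by (simp add: proj_variety_def)

lemma sp_reg_proj_varietyE:
  assumes "sp_reg (proj_variety V) U f" "p \<in> U"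
  obtains W d F G where "openin (subtopology zariski V) W" "p \<in> W" "W \<subseteq> U"
    "hom_poly d F" "hom_poly d G" "\<forall>L\<in>W. \<forall>x\<in>L - {0}. G x \<noteq> 0 \<and> f L = F x / G x"
proof -
  have "\<exists>W d F G. openin (subtopology zariski V) W \<and> p \<in> W \<and>
     W \<subseteq> U \<and> hom_poly d F \<and> hom_poly d G \<and> (\<forall>L\<in>W. \<forall>x\<in>L - {0}. G x \<noteq> 0 \<and> f L = F x / G x)"
    using assms unfolding sp_reg_proj_variety by (rule bspec)
  then show thesis by (elim exE conjE) (rule that)
qed

lemma sp_reg_proj_varietyI:
  assumes "\<And>p. p \<in> U \<Longrightarrow> \<exists>W d F G. openin (subtopology zariski V) W \<and> p \<in> W \<and>
     W \<subseteq> U \<and> hom_poly d F \<and> hom_poly d G \<and> (\<forall>L\<in>W. \<forall>x\<in>L - {0}. G x \<noteq> 0 \<and> f L = F x / G x)"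
  shows "sp_reg (proj_variety V) U f"
  unfolding sp_reg_proj_variety by (intro ballI assms)

lemma proj_variety_reg_cong:
  assumes "sp_reg (proj_variety V) U f" "\<And>p. p \<in> U \<Longrightarrow> g p = f p"
  shows "sp_reg (proj_variety V) U g"
proof (rule sp_reg_proj_varietyI)
  fix p assume "p \<in> U"
  with assms(1) obtain W d F G where W: "openin (subtopology zariski V) W" "p \<in> W" "W \<subseteq> U"
      "hom_poly d F" "hom_poly d G" "\<forall>L\<in>W. \<forall>x\<in>L - {0}. G x \<noteq> 0 \<and> f L = F x / G x"
    by (rule sp_reg_proj_varietyE)
  have g: "\<forall>L\<in>W. \<forall>x\<in>L - {0}. G x \<noteq> 0 \<and> g L = F x / G x"
  proof (intro ballI)
    fix L x assume "L \<in> W" "x \<in> L - {0}"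
    then show "G x \<noteq> 0 \<and> g L = F x / G x"
      unfolding assms(2)[OF subsetD[OF W(3) \<open>L \<in> W\<close>]] by (rule W(6)[rule_format])
  qed
  show "\<exists>W d F G. openin (subtopology zariski V) W \<and> p \<in> W \<and> W \<subseteq> U \<and>
      hom_poly d F \<and> hom_poly d G \<and> (\<forall>L\<in>W. \<forall>x\<in>L - {0}. G x \<noteq> 0 \<and> g L = F x / G x)"
    by (rule exI[of _ W], rule exI[of _ d], rule exI[of _ F], rule exI[of _ G])
      (intro conjI W(1-5) g)
qed

section \<open>Morphisms and quotients of spaces with functions\<close>

lemma sp_morphism_compose:
  assumes f: "sp_morphism X Y f" and g: "sp_morphism Y Z g"
  shows "sp_morphism X Z (g \<circ> f)"
  unfolding sp_morphism_def
proof (intro conjI allI impI)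
  show "continuous_map (sp_top X) (sp_top Z) (g \<circ> f)"
    using f g unfolding sp_morphism_def by (intro continuous_map_compose[of _ "sp_top Y"]) auto
  fix U h assume U: "openin (sp_top Z) U" "sp_reg Z U h"
  let ?U' = "{y \<in> topspace (sp_top Y). g y \<in> U}"
  have "openin (sp_top Y) ?U'" "sp_reg Y ?U' (h \<circ> g)"
    using g U unfolding sp_morphism_def continuous_map_def by auto
  then have "sp_reg X {x \<in> topspace (sp_top X). f x \<in> ?U'} ((h \<circ> g) \<circ> f)"
    using f unfolding sp_morphism_def by blast
  moreover have "{x \<in> topspace (sp_top X). f x \<in> ?U'} = {x \<in> topspace (sp_top X). (g \<circ> f) x \<in> U}"
    using f unfolding sp_morphism_def continuous_map_def by auto
  ultimately show "sp_reg X {x \<in> topspace (sp_top X). (g \<circ> f) x \<in> U} (h \<circ> (g \<circ> f))"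
    by (simp add: comp_assoc)
qed

lemma sp_isomorphic_sym: "X \<cong>\<^sub>v Y \<Longrightarrow> Y \<cong>\<^sub>v X"
  unfolding sp_isomorphic_def by blast

lemma sp_isomorphic_trans:
  assumes "X \<cong>\<^sub>v Y" "Y \<cong>\<^sub>v Z"
  shows "X \<cong>\<^sub>v Z"
proof -
  from assms(1) obtain f f' where f: "sp_morphism X Y f" "sp_morphism Y X f'"
    "\<forall>x \<in> topspace (sp_top X). f' (f x) = x" "\<forall>y \<in> topspace (sp_top Y). f (f' y) = y"
    unfolding sp_isomorphic_def by blast
  from assms(2) obtain g g' where g: "sp_morphism Y Z g" "sp_morphism Z Y g'"
    "\<forall>x \<in> topspace (sp_top Y). g' (g x) = x" "\<forall>y \<in> topspace (sp_top Z). g (g' y) = y"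
    unfolding sp_isomorphic_def by blast
  have "f x \<in> topspace (sp_top Y)" if "x \<in> topspace (sp_top X)" for x
    using f(1) that by (auto simp: sp_morphism_def continuous_map_def)
  moreover have "g' z \<in> topspace (sp_top Y)" if "z \<in> topspace (sp_top Z)" for z
    using g(2) that by (auto simp: sp_morphism_def continuous_map_def)
  ultimately show ?thesis unfolding sp_isomorphic_def
    using sp_morphism_compose[OF f(1) g(1)] sp_morphism_compose[OF g(2) f(2)] f(3,4) g(3,4)
    by (intro exI[of _ "g \<circ> f"] exI[of _ "f' \<circ> g'"]) auto
qed

lemma topspace_quotient_top: "topspace (quotient_top T q) = q ` topspace T"
proof -
  have "{x \<in> topspace T. q x \<in> q ` topspace T} = topspace T" by auto
  then have "openin (quotient_top T q) (q ` topspace T)"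
    by (simp add: openin_quotient_top)
  moreover have "topspace (quotient_top T q) \<subseteq> q ` topspace T"
    using openin_quotient_top[of T q "topspace (quotient_top T q)"] by simp
  ultimately show ?thesis using openin_subset by blast
qed

text \<open>
  The conditions on \<open>q\<close> are those of a quotient map, so \<open>q\<close> and the orbit map factor through each other.
  The congruence condition is needed because functions are total: the two maps agree only on
  the relevant open sets.
\<close>

lemma sp_quotient_isomorphicI:
  fixes X :: "'a fun_space" and Y :: "'b fun_space"
  defines "T \<equiv> topspace (sp_top X)"
  assumes onto: "q ` T = topspace (sp_top Y)"
    and fibres: "\<And>x x'. x \<in> T \<Longrightarrow> x' \<in> T \<Longrightarrow> q x = q x' \<longleftrightarrow> orbit_of H x = orbit_of H x'"
    and opens: "\<And>U. U \<subseteq> topspace (sp_top Y) \<Longrightarrow>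
      openin (sp_top Y) U \<longleftrightarrow> openin (sp_top X) {x \<in> T. q x \<in> U}"
    and reg: "\<And>U f. openin (sp_top Y) U \<Longrightarrow>
      sp_reg Y U f \<longleftrightarrow> sp_reg X {x \<in> T. q x \<in> U} (f \<circ> q)"
    and cong: "\<And>U f g. sp_reg X U f \<Longrightarrow> (\<And>x. x \<in> U \<Longrightarrow> g x = f x) \<Longrightarrow> sp_reg X U g"
  shows "sp_quotient X H \<cong>\<^sub>v Y"
proof -
  define \<pi> where "\<pi> = orbit_of H"
  define \<phi> where "\<phi> = (\<lambda>c. q (SOME x. x \<in> T \<and> \<pi> x = c))"
  define \<psi> where "\<psi> = (\<lambda>y. \<pi> (SOME x. x \<in> T \<and> q x = y))"
  have \<phi>: "\<phi> (\<pi> x) = q x" if "x \<in> T" for x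
  proof -
    have "(SOME x'. x' \<in> T \<and> \<pi> x' = \<pi> x) \<in> T \<and> \<pi> (SOME x'. x' \<in> T \<and> \<pi> x' = \<pi> x) = \<pi> x"
      using that by (intro someI[of "\<lambda>x'. x' \<in> T \<and> \<pi> x' = \<pi> x" x]) simp
    then show ?thesis using fibres that unfolding \<phi>_def \<pi>_def by blast
  qed
  have \<psi>: "\<psi> (q x) = \<pi> x" if "x \<in> T" for x
  proof -
    have "(SOME x'. x' \<in> T \<and> q x' = q x) \<in> T \<and> q (SOME x'. x' \<in> T \<and> q x' = q x) = q x"
      using that by (intro someI[of "\<lambda>x'. x' \<in> T \<and> q x' = q x" x]) simp
    then show ?thesis using fibres that unfolding \<psi>_def \<pi>_def by blast
  qed
  let ?Q = "sp_quotient X H"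
  have top: "topspace (sp_top ?Q) = \<pi> ` T"
    by (simp add: sp_quotient_def topspace_quotient_top \<pi>_def T_def)
  have opQ: "openin (sp_top ?Q) U \<longleftrightarrow> U \<subseteq> \<pi> ` T \<and> openin (sp_top X) {x \<in> T. \<pi> x \<in> U}" for U
    by (simp add: sp_quotient_def openin_quotient_top \<pi>_def T_def)
  have regQ: "sp_reg ?Q U f \<longleftrightarrow> sp_reg X {x \<in> T. \<pi> x \<in> U} (f \<circ> \<pi>)" for U f
    by (simp add: sp_quotient_def \<pi>_def T_def)
  have pre1: "{x \<in> T. \<pi> x \<in> {c \<in> \<pi> ` T. \<phi> c \<in> U}} = {x \<in> T. q x \<in> U}" for U
    using \<phi> by auto
  have pre2: "{x \<in> T. q x \<in> {y \<in> topspace (sp_top Y). \<psi> y \<in> U}} = {x \<in> T. \<pi> x \<in> U}" for U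
    using \<psi> onto by auto
  have mor1: "sp_morphism ?Q Y \<phi>"
    unfolding sp_morphism_def continuous_map_def top
  proof (intro conjI allI impI)
    show "\<phi> \<in> \<pi> ` T \<rightarrow> topspace (sp_top Y)" using \<phi> onto by auto
    show "openin (sp_top ?Q) {c \<in> \<pi> ` T. \<phi> c \<in> U}" if "openin (sp_top Y) U" for U
      unfolding opQ pre1 using that opens openin_subset by blast
    show "sp_reg ?Q {c \<in> \<pi> ` T. \<phi> c \<in> U} (f \<circ> \<phi>)"
      if "openin (sp_top Y) U" "sp_reg Y U f" for U f
      unfolding regQ pre1
      by (rule cong[of _ "f \<circ> q"]) (use reg that \<phi> in auto)
  qed
  have open2: "openin (sp_top Y) {y \<in> topspace (sp_top Y). \<psi> y \<in> U}" if "openin (sp_top ?Q) U" for U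
    using that opQ opens pre2 by simp
  have mor2: "sp_morphism Y ?Q \<psi>"
    unfolding sp_morphism_def continuous_map_def top
  proof (intro conjI allI impI)
    show "\<psi> \<in> topspace (sp_top Y) \<rightarrow> \<pi> ` T" unfolding onto[symmetric] using \<psi> by auto
    show "openin (sp_top Y) {y \<in> topspace (sp_top Y). \<psi> y \<in> U}" if "openin (sp_top ?Q) U" for U
      using that by (rule open2)
    show "sp_reg Y {y \<in> topspace (sp_top Y). \<psi> y \<in> U} (f \<circ> \<psi>)"
      if "openin (sp_top ?Q) U" "sp_reg ?Q U f" for U f
      unfolding reg[OF open2[OF that(1)]] pre2
      by (rule cong[of _ "f \<circ> \<pi>"]) (use regQ that \<psi> in auto)
  qed
  show ?thesis unfolding sp_isomorphic_def
    unfolding top onto[symmetric] using mor1 mor2 \<phi> \<psi>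
    by (intro exI[of _ \<phi>] exI[of _ \<psi>]) auto
qed

section \<open>Coordinate permutations\<close>

abbreviation Sym :: "('n \<Rightarrow> 'n) monoid" where "Sym \<equiv> BijGroup UNIV"

lemma Sym_carrier: "carrier Sym = {g. bij g}"
  by (simp add: BijGroup_def Bij_def)

lemma Sym_one: "\<one>\<^bsub>Sym\<^esub> = id"
  by (simp add: BijGroup_def restrict_def id_def)

lemma Sym_mult: "bij g \<Longrightarrow> bij h \<Longrightarrow> g \<otimes>\<^bsub>Sym\<^esub> h = g \<circ> h"
  by (auto simp: BijGroup_def Bij_def compose_def restrict_def)

lemma Sym_inv: "bij g \<Longrightarrow> inv\<^bsub>Sym\<^esub> g = inv_into UNIV g"
  by (subst inv_BijGroup) (auto simp: Bij_def restrict_def)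

lemma perm_coords_id: "perm_coords id x = x"
  by (simp add: perm_coords_def vec_eq_iff)

lemma perm_coords_comp:
  assumes "bij g" "bij h"
  shows "perm_coords (g \<circ> h) x = perm_coords g (perm_coords h x)"
  by (simp add: perm_coords_def vec_eq_iff o_inv_distrib[OF assms])

lemma perm_coords_inv:
  assumes "bij g"
  shows "perm_coords g (perm_coords (inv_into UNIV g) x) = x"
    and "perm_coords (inv_into UNIV g) (perm_coords g x) = x"
proof -
  have "g \<circ> inv_into UNIV g = id" "inv_into UNIV g \<circ> g = id"
    using assms surj_iff[of g] inj_iff[of g] by (auto simp: bij_def)
  then show "perm_coords g (perm_coords (inv_into UNIV g) x) = x"
    "perm_coords (inv_into UNIV g) (perm_coords g x) = x"
    using perm_coords_comp[OF assms bij_imp_bij_inv[OF assms], of x]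
      perm_coords_comp[OF bij_imp_bij_inv[OF assms] assms, of x] by (simp_all add: perm_coords_id)
qed

lemma perm_coords_scale: "perm_coords g (k *s x) = k *s perm_coords g x"
  by (simp add: perm_coords_def vec_eq_iff)

lemma perm_coords_eq_0:
  assumes "bij g"
  shows "perm_coords g x = 0 \<longleftrightarrow> x = 0"
proof
  assume "perm_coords g x = 0"
  then have "perm_coords (inv_into UNIV g) (0 :: complex ^ 'a) = x"
    using perm_coords_inv(2)[OF assms, of x] by simp
  then show "x = 0" by (simp add: perm_coords_def vec_eq_iff)
qed (simp add: perm_coords_def vec_eq_iff)

lemma perm_line_span: "perm_line g (vec.span {x}) = vec.span {perm_coords g x}"
  by (auto simp: perm_line_def vec.span_singleton image_iff perm_coords_scale)

lemma finite_Sym: "finite (carrier (Sym :: ('n::finite \<Rightarrow> 'n) monoid))"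
  by (rule finite_subset[OF subset_UNIV]) simp

text \<open>
  A permutation may fix a line without fixing its points. The scalar that occurs is killed by the
  order of the symmetric group, so it does not affect forms of degree divisible by that order.
\<close>

lemma perm_coords_eigenvalue:
  fixes g :: "'n::finite \<Rightarrow> 'n"
  assumes g: "bij g" and eig: "perm_coords g x = a *s x" and x: "x \<noteq> 0"
  shows "a ^ order (Sym :: ('n \<Rightarrow> 'n) monoid) = 1"
proof -
  have *: "bij (g [^]\<^bsub>Sym\<^esub> k) \<and> perm_coords (g [^]\<^bsub>Sym\<^esub> k) x = a ^ k *s x" for k :: nat
  proof (induction k)
    case 0
    show ?case using perm_coords_id[of x] bij_id by (simp add: Sym_one id_def)
  next
    case (Suc k)
    then have "bij (g [^]\<^bsub>Sym\<^esub> k)" by simp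
    note comp = Sym_mult[OF this g] perm_coords_comp[OF this g] bij_comp[OF g this]
    have "g [^]\<^bsub>Sym\<^esub> Suc k = (g [^]\<^bsub>Sym\<^esub> k) \<circ> g" unfolding nat_pow_Suc by (rule comp(1))
    then show ?case
      using Suc comp(2)[of x] comp(3) eig by (metis perm_coords_scale power_Suc vector_smult_assoc)
  qed
  have "g [^]\<^bsub>Sym\<^esub> order (Sym :: ('n \<Rightarrow> 'n) monoid) = id"
    using group.pow_order_eq_1[OF group_BijGroup, of g UNIV] g by (simp add: Sym_carrier Sym_one)
  with *[of "order (Sym :: ('n \<Rightarrow> 'n) monoid)"]
  have "a ^ order (Sym :: ('n \<Rightarrow> 'n) monoid) *s x = 1 *s x" by (simp add: perm_coords_id)
  moreover obtain i where "x $ i \<noteq> 0" using x by (auto simp: vec_eq_iff)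
  ultimately show ?thesis by (auto simp: vec_eq_iff)
qed

section \<open>Quotients of projective varieties by coordinate permutations\<close>

text \<open>
  \<open>K\<close> and \<open>C\<close> are the cones over the variety and over its prospective quotient by the group that \<open>S\<close>
  generates. The number \<open>M\<close> allows for \<open>\<Phi>\<close> being only semi-invariant: a form of odd degree in a \<open>\<Phi>\<close> that
  changes sign is not invariant, so descent can be expected only in suitable degrees.
\<close>

locale cone_quotient =
  fixes K :: "(complex ^ 'n) set" and C :: "(complex ^ 'm) set" and S :: "('n \<Rightarrow> 'n) set"
    and \<Phi> :: "complex ^ 'n \<Rightarrow> complex ^ 'm" and e M :: nat
  assumes K_scale: "\<And>a x. x \<in> K \<Longrightarrow> a *s x \<in> K"
    and C_scale: "\<And>a v. v \<in> C \<Longrightarrow> a *s v \<in> C"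
    and S_bij: "\<And>g. g \<in> S \<Longrightarrow> bij g"
    and K_perm: "\<And>g x. bij g \<Longrightarrow> x \<in> K \<Longrightarrow> perm_coords g x \<in> K"
    and \<Phi>_hom: "\<And>i. hom_poly e (\<lambda>x. \<Phi> x $ i)"
    and pos: "0 < e" "0 < M"
    and \<Phi>_maps: "\<And>x. x \<in> K \<Longrightarrow> \<Phi> x \<in> C"
    and \<Phi>_onto: "\<And>v. v \<in> C \<Longrightarrow> v \<noteq> 0 \<Longrightarrow> \<exists>x\<in>K. \<Phi> x = v"
    and \<Phi>_semi: "\<And>g. g \<in> S \<Longrightarrow> \<exists>a. a \<noteq> 0 \<and> (\<forall>x\<in>K. \<Phi> (perm_coords g x) = a *s \<Phi> x)"
    and \<Phi>_descends: "\<And>k F. hom_poly (e * k) F \<Longrightarrow> M dvd k \<Longrightarrow>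
      (\<And>g x. g \<in> S \<Longrightarrow> x \<in> K \<Longrightarrow> F (perm_coords g x) = F x) \<Longrightarrow> descends K \<Phi> k F"
begin

text \<open>
  \<open>V\<close> and \<open>E\<close> are the projective varieties with cones \<open>K\<close> and \<open>C\<close>, and \<open>q\<close> is the map between them that
  \<open>\<Phi>\<close> induces; the choice of a vector on the line is harmless because \<open>\<Phi>\<close> is homogeneous (\<open>q_line\<close>).
\<close>

definition "G = generate Sym S"
definition "V = {L \<in> proj_space. L \<subseteq> K}"
definition "E = {L \<in> proj_space. L \<subseteq> C}"
definition "q L = vec.span {\<Phi> (SOME x. x \<in> L \<and> x \<noteq> 0)}"

lemma subgroup_G: "subgroup G Sym"
  unfolding G_def using S_bij
  by (intro group.generate_is_subgroup group_BijGroup) (auto simp: Sym_carrier)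

lemma G_bij: "g \<in> G \<Longrightarrow> bij g"
  using subgroup.subset[OF subgroup_G] by (auto simp: Sym_carrier)

lemma id_G: "id \<in> G"
  using subgroup.one_closed[OF subgroup_G] by (simp add: Sym_one)

lemma comp_G: "g \<in> G \<Longrightarrow> h \<in> G \<Longrightarrow> g \<circ> h \<in> G"
  using subgroup.m_closed[OF subgroup_G, of g h] by (simp add: Sym_mult G_bij)

lemma inv_G: "g \<in> G \<Longrightarrow> inv_into UNIV g \<in> G"
  using subgroup.m_inv_closed[OF subgroup_G, of g] by (simp add: Sym_inv G_bij)

lemma finite_G: "finite G"
  using finite_subset[OF subgroup.subset[OF subgroup_G] finite_Sym] .

lemma S_G: "g \<in> S \<Longrightarrow> g \<in> G"
  unfolding G_def by (rule generate.incl)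

lemma K_G: "g \<in> G \<Longrightarrow> x \<in> K \<Longrightarrow> perm_coords g x \<in> K"
  using K_perm G_bij by blast

lemma \<Phi>_semi_G: "g \<in> G \<Longrightarrow> \<exists>a. a \<noteq> 0 \<and> (\<forall>x\<in>K. \<Phi> (perm_coords g x) = a *s \<Phi> x)"
  unfolding G_def
proof (induction rule: generate.induct)
  case one
  show ?case by (intro exI[of _ 1]) (simp add: Sym_one perm_coords_id[unfolded id_def])
next
  case (incl h)
  then show ?case by (rule \<Phi>_semi)
next
  case (inv h)
  note h = S_bij[OF inv]
  from \<Phi>_semi[OF inv] obtain a where a: "a \<noteq> 0" "\<forall>x\<in>K. \<Phi> (perm_coords h x) = a *s \<Phi> x" by blast
  have "\<Phi> (perm_coords (inv_into UNIV h) x) = (1 / a) *s \<Phi> x" if "x \<in> K" for x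
  proof -
    have "perm_coords (inv_into UNIV h) x \<in> K" using that h by (intro K_perm bij_imp_bij_inv)
    then have "\<Phi> x = a *s \<Phi> (perm_coords (inv_into UNIV h) x)"
      using a(2) perm_coords_inv(1)[OF h, of x] by fastforce
    with a(1) show ?thesis by simp
  qed
  then show ?case using a(1) by (intro exI[of _ "1 / a"]) (simp add: Sym_inv h)
next
  case (eng h1 h2)
  then obtain a b where ab: "a \<noteq> 0" "\<forall>x\<in>K. \<Phi> (perm_coords h1 x) = a *s \<Phi> x"
    "b \<noteq> 0" "\<forall>x\<in>K. \<Phi> (perm_coords h2 x) = b *s \<Phi> x" by blast
  have h: "bij h1" "bij h2" "h1 \<in> G" "h2 \<in> G" using eng.hyps G_bij by (auto simp: G_def)
  have "\<Phi> (perm_coords (h1 \<circ> h2) x) = (a * b) *s \<Phi> x" if "x \<in> K" for x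
    using ab(2,4) K_G[OF h(4) that] that by (simp add: perm_coords_comp h)
  then show ?case using ab(1,3) unfolding Sym_mult[OF h(1,2)]
    by (intro exI[of _ "a * b"]) (simp add: comp_def)
qed

lemma span_subset_iff:
  assumes "\<And>a y. y \<in> A \<Longrightarrow> a *s y \<in> A"
  shows "vec.span {x} \<subseteq> A \<longleftrightarrow> (x :: complex ^ 'b) \<in> A"
  using assms vec.span_base[of x "{x}"] by (auto simp: vec.span_singleton)

lemma line_V: "x \<noteq> 0 \<Longrightarrow> vec.span {x} \<in> V \<longleftrightarrow> x \<in> K"
  unfolding V_def using span_subset_iff[OF K_scale] by (simp add: line_in_proj_space)

lemma line_E: "v \<noteq> 0 \<Longrightarrow> vec.span {v} \<in> E \<longleftrightarrow> v \<in> C"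
  unfolding E_def using span_subset_iff[OF C_scale] by (simp add: line_in_proj_space)

lemma V_E:
  assumes "L \<in> V"
  obtains x where "x \<noteq> 0" "x \<in> K" "L = vec.span {x}"
proof -
  from assms obtain x where "x \<noteq> 0" "L = vec.span {x}"
    unfolding V_def by (blast elim: proj_spaceE)
  with assms line_V[of x] that show thesis by simp
qed

lemma closedin_orbit:
  assumes x: "x \<in> K" "x \<noteq> 0" and A: "A \<subseteq> (\<lambda>g. vec.span {perm_coords g x}) ` G"
  shows "closedin (subtopology zariski V) A"
proof -
  have "A \<subseteq> V"
  proof
    fix L assume "L \<in> A"
    then obtain g where g: "g \<in> G" "L = vec.span {perm_coords g x}" using A by blast
    then show "L \<in> V" using line_V[of "perm_coords g x"] K_G x perm_coords_eq_0[OF G_bij] by simp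
  qed
  then have "A \<subseteq> topspace (subtopology zariski V)" by (auto simp: topspace_zariski V_def)
  moreover have "finite A" using A finite_G finite_surj by blast
  moreover have "t1_space (subtopology (zariski :: (complex ^ 'n) set topology) V)"
    by (intro t1_space_subtopology t1_space_zariski)
  ultimately show ?thesis unfolding t1_space_closedin_finite by blast
qed

lemma \<Phi>_scale: "\<Phi> (a *s x) = a ^ e *s \<Phi> x"
  using hom_poly_scale[OF \<Phi>_hom, of a x] by (simp add: vec_eq_iff)

lemma q_line:
  assumes "x \<noteq> 0"
  shows "q (vec.span {x}) = vec.span {\<Phi> x}"
proof -
  let ?y = "SOME y. y \<in> vec.span {x} \<and> y \<noteq> 0"
  have "?y \<in> vec.span {x} \<and> ?y \<noteq> 0"
    using assms by (intro someI[of "\<lambda>y. y \<in> vec.span {x} \<and> y \<noteq> 0" x]) (simp add: vec.span_base)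
  then obtain k where "?y = k *s x" "k \<noteq> 0" by (auto simp: in_line)
  then show ?thesis unfolding q_def by (simp add: \<Phi>_scale line_scale)
qed

subsection \<open>Averaging over the group\<close>

lemma trace_descends:
  assumes F: "hom_poly (e * k) F" and k: "M dvd k"
  shows "descends K \<Phi> k (\<lambda>x. \<Sum>g\<in>G. F (perm_coords g x))"
proof (rule \<Phi>_descends[OF _ k])
  show "hom_poly (e * k) (\<lambda>x. \<Sum>g\<in>G. F (perm_coords g x))"
    by (intro hom_poly_sum hom_poly_perm F)
  fix h x assume "h \<in> S"
  then have h: "h \<in> G" by (rule S_G)
  show "(\<Sum>g\<in>G. F (perm_coords g (perm_coords h x))) = (\<Sum>g\<in>G. F (perm_coords g x))"
  proof (rule sum.reindex_bij_witness[of _ "\<lambda>g. g \<circ> inv_into UNIV h" "\<lambda>g. g \<circ> h"])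
    fix g assume g: "g \<in> G"
    show "(g \<circ> h) \<circ> inv_into UNIV h = g" "(g \<circ> inv_into UNIV h) \<circ> h = g"
      using G_bij[OF h] by (auto simp: fun_eq_iff bij_is_surj surj_f_inv_f bij_is_inj)
    show "g \<circ> h \<in> G" "g \<circ> inv_into UNIV h \<in> G" using g h by (auto intro: comp_G inv_G)
    show "F (perm_coords (g \<circ> h) x) = F (perm_coords g (perm_coords h x))"
      using g h by (simp add: perm_coords_comp G_bij)
  qed
qed

text \<open>
  Given a fraction \<open>F / H\<close> near the line of \<open>x\<close>, choose a form \<open>A\<close> that does not vanish at \<open>x\<close> but vanishes
  outside the neighbourhood \<open>W\<close> and at the other lines of the orbit. The averages of \<open>F A\<close> and \<open>H A\<close> are
  invariant and so descend. The average of \<open>H A\<close> at \<open>x\<close> is a sum over the stabiliser of \<open>x\<close> alone, all of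
  whose terms agree, so it is nonzero. If \<open>F / H\<close> represents an invariant function on \<open>W\<close>, the quotient
  of the averages represents it on all of its domain, because every term vanishes outside \<open>W\<close>.
\<close>

lemma local_invariant_fraction:
  assumes W: "openin (subtopology zariski V) W" "vec.span {x} \<in> W" and x: "x \<noteq> 0"
    and F: "hom_poly d F" and H: "hom_poly d H" "H x \<noteq> 0"
  obtains k A P Q where "0 < k" "hom_poly k P" "hom_poly k Q" "Q (\<Phi> x) \<noteq> 0"
    "\<forall>z\<in>K. z \<noteq> 0 \<longrightarrow> vec.span {z} \<notin> W \<longrightarrow> A z = 0"
    "\<forall>z\<in>K. P (\<Phi> z) = (\<Sum>g\<in>G. F (perm_coords g z) * A (perm_coords g z))"
    "\<forall>z\<in>K. Q (\<Phi> z) = (\<Sum>g\<in>G. H (perm_coords g z) * A (perm_coords g z))"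
proof -
  have WV: "W \<subseteq> V" using W(1) unfolding openin_subvariety by blast
  then have xK: "x \<in> K" using W(2) line_V[OF x] by blast
  define O' where "O' = (\<lambda>g. vec.span {perm_coords g x}) ` G - {vec.span {x}}"
  have "closedin (subtopology zariski V) O'"
    by (rule closedin_orbit[OF xK x]) (auto simp: O'_def)
  with W(1) have "openin (subtopology zariski V) (W - O')" by (rule openin_diff)
  moreover have "vec.span {x} \<in> W - O'" using W(2) by (simp add: O'_def)
  ultimately obtain deg_A A1 where A1: "hom_poly deg_A A1" "vec.span {x} \<in> nonvanishing_locus A1"
      "nonvanishing_locus A1 \<inter> V \<subseteq> W - O'"
    unfolding openin_subvariety by blast
  obtain i where i: "x $ i \<noteq> 0" using x by (auto simp: vec_eq_iff)
  \<comment> \<open>The degree is padded by a power of a coordinate: a multiple of \<open>e M\<close> for descent to apply, and of \<open>N\<close>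
      so that stabilisers, which act on \<open>x\<close> by \<open>N\<close>-th roots of unity, fix the value of the form at \<open>x\<close>.\<close>
  define N where "N = order (Sym :: ('n \<Rightarrow> 'n) monoid)"
  have N: "0 < N" unfolding N_def order_def using finite_Sym
    by (auto simp: card_gt_0_iff Sym_carrier intro: exI[of _ id])
  define k where "k = M * N * (d + deg_A + 1)"
  define j where "j = e * k - (d + deg_A)"
  have "d + deg_A \<le> 1 * (1 * (d + deg_A + 1))" by simp
  also have "\<dots> \<le> e * ((M * N) * (d + deg_A + 1))"
    using pos N by (intro mult_le_mono) auto
  finally have j: "e * k = d + (deg_A + j)" unfolding j_def k_def by simp
  define A where "A = (\<lambda>z. A1 z * (z $ i) ^ j)"
  have "hom_poly (deg_A + 1 * j) A"
    unfolding A_def by (intro hom_poly_mult A1(1) hom_poly_power hom_poly_coord)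
  then have FA: "hom_poly (e * k) (\<lambda>z. F z * A z)" and HA: "hom_poly (e * k) (\<lambda>z. H z * A z)"
    unfolding j using hom_poly_mult F H(1) by auto
  have Mk: "M dvd k" by (simp add: k_def)
  from trace_descends[OF FA Mk] obtain P where P: "hom_poly k P"
    "\<forall>z\<in>K. (\<Sum>g\<in>G. F (perm_coords g z) * A (perm_coords g z)) = P (\<Phi> z)"
    unfolding descends_def by blast
  from trace_descends[OF HA Mk] obtain Q where Q: "hom_poly k Q"
    "\<forall>z\<in>K. (\<Sum>g\<in>G. H (perm_coords g z) * A (perm_coords g z)) = Q (\<Phi> z)"
    unfolding descends_def by blast
  have A0: "A z = 0" if "z \<in> K" "z \<noteq> 0" "vec.span {z} \<notin> W - O'" for z
    using that A1(3) line_V nonvanishing_line[OF A1(1)] by (auto simp: A_def)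
  have Ax: "A x \<noteq> 0"
    using A1(2) i nonvanishing_line[OF A1(1) x] by (simp add: A_def)
  let ?St = "{g \<in> G. vec.span {perm_coords g x} = vec.span {x}}"
  have "Q (\<Phi> x) = (\<Sum>g\<in>G. H (perm_coords g x) * A (perm_coords g x))" using Q(2) xK by simp
  also have "\<dots> = (\<Sum>g\<in>?St. H (perm_coords g x) * A (perm_coords g x))"
  proof (rule sum.mono_neutral_right[OF finite_G])
    show "\<forall>g\<in>G - ?St. H (perm_coords g x) * A (perm_coords g x) = 0"
    proof
      fix g assume g: "g \<in> G - ?St"
      then have "vec.span {perm_coords g x} \<in> O'" unfolding O'_def by auto
      then show "H (perm_coords g x) * A (perm_coords g x) = 0"
        using A0[of "perm_coords g x"] g K_G xK perm_coords_eq_0[OF G_bij] x by simp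
    qed
  qed simp
  also have "\<dots> = (\<Sum>g\<in>?St. H x * A x)"
  proof (rule sum.cong)
    fix g assume g: "g \<in> ?St"
    then have "perm_coords g x \<in> vec.span {x}" using vec.span_base[of "perm_coords g x"] by auto
    then obtain a where a: "perm_coords g x = a *s x" using in_line by blast
    have "a ^ N = 1" unfolding N_def
      using g by (intro perm_coords_eigenvalue[OF _ a x]) (simp add: G_bij)
    moreover have "e * k = N * (e * M * (d + deg_A + 1))" unfolding k_def by (simp only: mult_ac)
    ultimately have "a ^ (e * k) = 1" by (simp add: power_mult)
    then show "H (perm_coords g x) * A (perm_coords g x) = H x * A x"
      unfolding a using hom_poly_scale[OF HA, of a x] by simp
  qed simp
  also have "\<dots> \<noteq> 0"
    using id_G finite_G H(2) Ax by (auto simp: card_gt_0_iff perm_coords_id)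
  finally have "Q (\<Phi> x) \<noteq> 0" .
  moreover have "0 < k" using pos N by (simp add: k_def)
  ultimately show thesis
    using that[of k P Q A] P Q A0 by simp
qed

lemma local_invariant_denominator:
  assumes W: "openin (subtopology zariski V) W" "vec.span {x} \<in> W" and x: "x \<noteq> 0"
  obtains k A Q where "0 < k" "hom_poly k Q" "Q (\<Phi> x) \<noteq> 0"
    "\<forall>z\<in>K. z \<noteq> 0 \<longrightarrow> vec.span {z} \<notin> W \<longrightarrow> A z = 0"
    "\<forall>z\<in>K. Q (\<Phi> z) = (\<Sum>g\<in>G. A (perm_coords g z))"
proof (rule local_invariant_fraction[OF W x hom_poly_const[of 1] hom_poly_const[of 1]])
  fix k A P Q
  assume "0 < k" "hom_poly k Q" "Q (\<Phi> x) \<noteq> 0"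
    "\<forall>z\<in>K. z \<noteq> 0 \<longrightarrow> vec.span {z} \<notin> W \<longrightarrow> A z = 0"
    "\<forall>z\<in>K. Q (\<Phi> z) = (\<Sum>g\<in>G. 1 * A (perm_coords g z))"
  then show thesis by (intro that[of k Q A]) simp_all
qed simp

lemma \<Phi>_0: "\<Phi> 0 = 0"
  using \<Phi>_scale[of 0 0] pos(1) by (simp add: zero_power)

lemma openin_V: "openin (subtopology zariski V) V"
proof -
  have "topspace (subtopology zariski V) = V" by (auto simp: topspace_zariski V_def)
  then show ?thesis by (metis openin_topspace)
qed

text \<open>
  A form of positive degree in \<open>\<Phi>\<close> is nonzero at \<open>x\<close>, so \<open>\<Phi>\<close> has no base points.
\<close>

lemma \<Phi>_nonzero:
  assumes "x \<in> K" "x \<noteq> 0"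
  shows "\<Phi> x \<noteq> 0"
proof
  assume 0: "\<Phi> x = 0"
  have "vec.span {x} \<in> V" using assms line_V by simp
  from openin_V this assms(2) obtain k A Q where "0 < k" "hom_poly k Q" "Q (\<Phi> x) \<noteq> 0"
    "\<forall>z\<in>K. z \<noteq> 0 \<longrightarrow> vec.span {z} \<notin> V \<longrightarrow> A z = 0"
    "\<forall>z\<in>K. Q (\<Phi> z) = (\<Sum>g\<in>G. A (perm_coords g z))"
    by (rule local_invariant_denominator)
  then show False using hom_poly_scale[of k Q 0 0] 0 by (simp add: zero_power)
qed

lemma E_E:
  assumes "L \<in> E"
  obtains x where "x \<noteq> 0" "x \<in> K" "L = vec.span {\<Phi> x}" "\<Phi> x \<noteq> 0" "q (vec.span {x}) = L"
proof -
  from assms obtain v where v: "v \<noteq> 0" "L = vec.span {v}"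
    unfolding E_def by (blast elim: proj_spaceE)
  with assms line_E[of v] have "v \<in> C" by simp
  with \<Phi>_onto v(1) obtain x where x: "x \<in> K" "\<Phi> x = v" by blast
  with v(1) \<Phi>_0 have "x \<noteq> 0" by auto
  with x v that[of x] q_line[of x] show thesis by simp
qed

lemma q_G: "g \<in> G \<Longrightarrow> x \<in> K \<Longrightarrow> x \<noteq> 0 \<Longrightarrow> q (vec.span {perm_coords g x}) = q (vec.span {x})"
  using \<Phi>_semi_G[of g] by (auto simp: q_line perm_coords_eq_0 G_bij line_scale)

lemma q_E: "x \<in> K \<Longrightarrow> x \<noteq> 0 \<Longrightarrow> q (vec.span {x}) \<in> E"
  by (simp add: q_line line_E \<Phi>_nonzero \<Phi>_maps)

lemma orbit_line:
  "orbit_of (perm_line ` G) (vec.span {x}) = (\<lambda>g. vec.span {perm_coords g x}) ` G"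
proof -
  have "orbit_of (perm_line ` G) (vec.span {x}) = (\<lambda>g. perm_line g (vec.span {x})) ` G"
    unfolding orbit_of_def by auto
  then show ?thesis by (simp add: perm_line_span)
qed

lemma orbit_line_G:
  assumes h: "h \<in> G"
  shows "orbit_of (perm_line ` G) (vec.span {perm_coords h x}) = orbit_of (perm_line ` G) (vec.span {x})"
proof -
  have "(\<lambda>g. vec.span {perm_coords (g \<circ> h) x}) ` G = (\<lambda>g. vec.span {perm_coords g x}) ` G"
  proof
    show "(\<lambda>g. vec.span {perm_coords (g \<circ> h) x}) ` G \<subseteq> (\<lambda>g. vec.span {perm_coords g x}) ` G"
      using comp_G[OF _ h] by auto
    show "(\<lambda>g. vec.span {perm_coords g x}) ` G \<subseteq> (\<lambda>g. vec.span {perm_coords (g \<circ> h) x}) ` G"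
    proof
      fix L assume "L \<in> (\<lambda>g. vec.span {perm_coords g x}) ` G"
      then obtain g where g: "g \<in> G" "L = vec.span {perm_coords g x}" by blast
      have "(g \<circ> inv_into UNIV h) \<circ> h = g"
        using G_bij[OF h] by (auto simp: fun_eq_iff bij_is_inj)
      with g comp_G[OF g(1) inv_G[OF h]]
      show "L \<in> (\<lambda>g. vec.span {perm_coords (g \<circ> h) x}) ` G"
        by (intro image_eqI[of _ _ "g \<circ> inv_into UNIV h"]) auto
    qed
  qed
  then show ?thesis using h by (simp add: orbit_line perm_coords_comp G_bij cong: image_cong)
qed

text \<open>
  If the orbits of \<open>x\<close> and \<open>y\<close> differ, then the invariant form built for the open complement of the orbit
  of \<open>y\<close> is nonzero at \<open>x\<close> and zero at \<open>y\<close>. As it is a form in \<open>\<Phi>\<close>, the lines of \<open>\<Phi> x\<close> and \<open>\<Phi> y\<close> differ.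
\<close>

lemma fibres:
  assumes "L \<in> V" "L' \<in> V"
  shows "q L = q L' \<longleftrightarrow> orbit_of (perm_line ` G) L = orbit_of (perm_line ` G) L'"
proof -
  obtain x where x: "x \<noteq> 0" "x \<in> K" "L = vec.span {x}" using assms(1) by (rule V_E)
  obtain y where y: "y \<noteq> 0" "y \<in> K" "L' = vec.span {y}" using assms(2) by (rule V_E)
  show ?thesis
  proof
    assume "orbit_of (perm_line ` G) L = orbit_of (perm_line ` G) L'"
    moreover have "L \<in> orbit_of (perm_line ` G) L"
      unfolding x(3) orbit_line using id_G perm_coords_id[of x] by (intro image_eqI[of _ _ id]) simp_all
    ultimately obtain g where "g \<in> G" "L = vec.span {perm_coords g y}"
      unfolding y(3) orbit_line by blast
    then show "q L = q L'" using q_G[OF _ y(2,1)] y(3) by simp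
  next
    assume qq: "q L = q L'"
    show "orbit_of (perm_line ` G) L = orbit_of (perm_line ` G) L'"
    proof (rule ccontr)
      assume ne: "\<not> ?thesis"
      define O' where "O' = (\<lambda>g. vec.span {perm_coords g y}) ` G"
      have "closedin (subtopology zariski V) O'"
        by (rule closedin_orbit[OF y(2,1)]) (simp add: O'_def)
      with openin_V have op: "openin (subtopology zariski V) (V - O')" by (rule openin_diff)
      have "L \<notin> O'"
      proof
        assume "L \<in> O'"
        then obtain g where "g \<in> G" "L = vec.span {perm_coords g y}" unfolding O'_def by blast
        with ne y(3) orbit_line_G show False by simp
      qed
      then have "vec.span {x} \<in> V - O'" using assms(1) x(3) by simp
      from op this x(1) obtain k A Q where Q: "0 < k" "hom_poly k Q" "Q (\<Phi> x) \<noteq> 0"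
        "\<forall>z\<in>K. z \<noteq> 0 \<longrightarrow> vec.span {z} \<notin> V - O' \<longrightarrow> A z = 0"
        "\<forall>z\<in>K. Q (\<Phi> z) = (\<Sum>g\<in>G. A (perm_coords g z))"
        by (rule local_invariant_denominator)
      have "A (perm_coords g y) = 0" if "g \<in> G" for g
        using Q(4) K_G[OF that y(2)] perm_coords_eq_0[OF G_bij[OF that]] y(1) that
        by (auto simp: O'_def)
      then have "Q (\<Phi> y) = 0" using Q(5) y(2) by simp
      moreover have "Q (\<Phi> y) \<noteq> 0"
      proof -
        have "\<Phi> y \<in> vec.span {\<Phi> x}"
          using qq x y q_line vec.span_base[of "\<Phi> y" "{\<Phi> y}"] by simp
        then obtain a where a: "\<Phi> y = a *s \<Phi> x" using in_line by blast
        with \<Phi>_nonzero[OF y(2,1)] have "a \<noteq> 0" by auto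
        with a Q(2,3) show ?thesis by (simp add: hom_poly_scale[OF Q(2)])
      qed
      ultimately show False by simp
    qed
  qed
qed

text \<open>
  For the direction from \<open>V\<close> to \<open>E\<close>, the invariant form that vanishes outside the preimage of \<open>U\<close>
  descends to a form that vanishes outside \<open>U\<close>.
\<close>

lemma opens:
  assumes "U \<subseteq> E"
  shows "openin (subtopology zariski E) U \<longleftrightarrow> openin (subtopology zariski V) {L \<in> V. q L \<in> U}"
proof
  assume U: "openin (subtopology zariski E) U"
  show "openin (subtopology zariski V) {L \<in> V. q L \<in> U}"
    unfolding openin_subvariety
  proof (intro conjI ballI)
    fix L assume L: "L \<in> {L \<in> V. q L \<in> U}"
    then have "L \<in> V" by simp
    then obtain x where x: "x \<noteq> 0" "x \<in> K" "L = vec.span {x}" by (rule V_E)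
    from U L obtain d P where P: "hom_poly d P" "q L \<in> nonvanishing_locus P"
        "nonvanishing_locus P \<inter> E \<subseteq> U"
      unfolding openin_subvariety by blast
    have P\<Phi>: "hom_poly (e * d) (\<lambda>x. P (\<Phi> x))" by (rule hom_poly_compose[OF P(1) \<Phi>_hom])
    have *: "vec.span {y} \<in> nonvanishing_locus (\<lambda>x. P (\<Phi> x)) \<longleftrightarrow> q (vec.span {y}) \<in> nonvanishing_locus P"
      if "y \<in> K" "y \<noteq> 0" for y
      using that by (simp add: nonvanishing_line[OF P\<Phi>] q_line nonvanishing_line[OF P(1)] \<Phi>_nonzero)
    have "nonvanishing_locus (\<lambda>x. P (\<Phi> x)) \<inter> V \<subseteq> {L \<in> V. q L \<in> U}"
    proof
      fix M assume M: "M \<in> nonvanishing_locus (\<lambda>x. P (\<Phi> x)) \<inter> V"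
      then have "M \<in> V" by simp
      then obtain y where y: "y \<noteq> 0" "y \<in> K" "M = vec.span {y}" by (rule V_E)
      with M * have "q M \<in> nonvanishing_locus P" by simp
      moreover have "q M \<in> E" using y q_E by simp
      ultimately show "M \<in> {L \<in> V. q L \<in> U}" using M P(3) by blast
    qed
    then show "\<exists>d F. hom_poly d F \<and> L \<in> nonvanishing_locus F \<and> nonvanishing_locus F \<inter> V \<subseteq> {L \<in> V. q L \<in> U}"
      using P\<Phi> P(2) *[OF x(2,1)] x(3) by (intro exI[of _ "e * d"] exI[of _ "\<lambda>x. P (\<Phi> x)"]) simp
  qed auto
next
  assume W: "openin (subtopology zariski V) {L \<in> V. q L \<in> U}"
  show "openin (subtopology zariski E) U"
    unfolding openin_subvariety
  proof (intro conjI ballI)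
    fix L assume L: "L \<in> U"
    with assms have "L \<in> E" by blast
    then obtain x where x: "x \<noteq> 0" "x \<in> K" "L = vec.span {\<Phi> x}" "\<Phi> x \<noteq> 0" "q (vec.span {x}) = L"
      by (rule E_E)
    then have "vec.span {x} \<in> {L \<in> V. q L \<in> U}" using L line_V by simp
    from W this x(1) obtain k A Q where Q: "0 < k" "hom_poly k Q" "Q (\<Phi> x) \<noteq> 0"
        "\<forall>z\<in>K. z \<noteq> 0 \<longrightarrow> vec.span {z} \<notin> {L \<in> V. q L \<in> U} \<longrightarrow> A z = 0"
        "\<forall>z\<in>K. Q (\<Phi> z) = (\<Sum>g\<in>G. A (perm_coords g z))"
      by (rule local_invariant_denominator)
    have "nonvanishing_locus Q \<inter> E \<subseteq> U"
    proof
      fix M assume M: "M \<in> nonvanishing_locus Q \<inter> E"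
      then have "M \<in> E" by simp
      then obtain y where y: "y \<noteq> 0" "y \<in> K" "M = vec.span {\<Phi> y}" "\<Phi> y \<noteq> 0" "q (vec.span {y}) = M"
        by (rule E_E)
      with M have "Q (\<Phi> y) \<noteq> 0" using nonvanishing_line[OF Q(2)] by simp
      then have "(\<Sum>g\<in>G. A (perm_coords g y)) \<noteq> 0" using Q(5) y(2) by simp
      then obtain g where g: "g \<in> G" "A (perm_coords g y) \<noteq> 0" by (rule sum.not_neutral_contains_not_neutral)
      then have "vec.span {perm_coords g y} \<in> {L \<in> V. q L \<in> U}"
        using Q(4) K_G[OF g(1) y(2)] perm_coords_eq_0[OF G_bij[OF g(1)]] y(1) by blast
      then show "M \<in> U" using q_G[OF g(1) y(2,1)] y(5) by simp
    qed
    moreover have "L \<in> nonvanishing_locus Q" using x nonvanishing_line[OF Q(2)] Q(3) by simp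
    ultimately show "\<exists>d F. hom_poly d F \<and> L \<in> nonvanishing_locus F \<and> nonvanishing_locus F \<inter> E \<subseteq> U"
      using Q(2) by blast
  qed (rule assms)
qed

lemma regular:
  assumes U: "openin (subtopology zariski E) U"
  shows "sp_reg (proj_variety E) U f \<longleftrightarrow> sp_reg (proj_variety V) {L \<in> V. q L \<in> U} (f \<circ> q)"
proof
  assume reg: "sp_reg (proj_variety E) U f"
  show "sp_reg (proj_variety V) {L \<in> V. q L \<in> U} (f \<circ> q)"
  proof (rule sp_reg_proj_varietyI)
    fix L assume L: "L \<in> {L \<in> V. q L \<in> U}"
    then have "q L \<in> U" by simp
    with reg obtain W d F H where W: "openin (subtopology zariski E) W" "q L \<in> W" "W \<subseteq> U"
      "hom_poly d F" "hom_poly d H" "\<forall>L\<in>W. \<forall>x\<in>L - {0}. H x \<noteq> 0 \<and> f L = F x / H x"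
      by (rule sp_reg_proj_varietyE)
    have "W \<subseteq> E" using W(1) unfolding openin_subvariety by blast
    then have op: "openin (subtopology zariski V) {L \<in> V. q L \<in> W}" using opens W(1) by blast
    have fr: "\<forall>L\<in>{L \<in> V. q L \<in> W}. \<forall>x\<in>L - {0}. H (\<Phi> x) \<noteq> 0 \<and> (f \<circ> q) L = F (\<Phi> x) / H (\<Phi> x)"
    proof (intro ballI)
      fix M x assume M: "M \<in> {L \<in> V. q L \<in> W}" and x: "x \<in> M - {0}"
      then have "M = vec.span {x}" "x \<noteq> 0" "x \<in> K"
        using proj_space_line[of M x] by (auto simp: V_def)
      then have "\<Phi> x \<in> q M - {0}" using \<Phi>_nonzero q_line vec.span_base[of "\<Phi> x" "{\<Phi> x}"] by simp
      with W(6) M have "H (\<Phi> x) \<noteq> 0 \<and> f (q M) = F (\<Phi> x) / H (\<Phi> x)" by blast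
      then show "H (\<Phi> x) \<noteq> 0 \<and> (f \<circ> q) M = F (\<Phi> x) / H (\<Phi> x)" by simp
    qed
    have "L \<in> {L \<in> V. q L \<in> W}" "{L \<in> V. q L \<in> W} \<subseteq> {L \<in> V. q L \<in> U}" using L W(2,3) by auto
    then show "\<exists>W d F G. openin (subtopology zariski V) W \<and> L \<in> W \<and> W \<subseteq> {L \<in> V. q L \<in> U} \<and>
        hom_poly d F \<and> hom_poly d G \<and> (\<forall>L\<in>W. \<forall>x\<in>L - {0}. G x \<noteq> 0 \<and> (f \<circ> q) L = F x / G x)"
      by (rule_tac exI[of _ "{L \<in> V. q L \<in> W}"], rule_tac exI[of _ "e * d"],
          rule_tac exI[of _ "\<lambda>x. F (\<Phi> x)"], rule_tac exI[of _ "\<lambda>x. H (\<Phi> x)"])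
        (intro conjI op fr hom_poly_compose[OF W(4) \<Phi>_hom] hom_poly_compose[OF W(5) \<Phi>_hom])
  qed
next
  have UE: "U \<subseteq> E" using U unfolding openin_subvariety by blast
  let ?U' = "{L \<in> V. q L \<in> U}"
  assume reg: "sp_reg (proj_variety V) ?U' (f \<circ> q)"
  show "sp_reg (proj_variety E) U f"
  proof (rule sp_reg_proj_varietyI)
    fix L assume L: "L \<in> U"
    with UE have "L \<in> E" by blast
    then obtain x where x: "x \<noteq> 0" "x \<in> K" "L = vec.span {\<Phi> x}" "\<Phi> x \<noteq> 0" "q (vec.span {x}) = L"
      by (rule E_E)
    then have "vec.span {x} \<in> ?U'" using L line_V by simp
    with reg obtain W d F H where W: "openin (subtopology zariski V) W" "vec.span {x} \<in> W" "W \<subseteq> ?U'"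
      "hom_poly d F" "hom_poly d H" "\<forall>L\<in>W. \<forall>x\<in>L - {0}. H x \<noteq> 0 \<and> (f \<circ> q) L = F x / H x"
      by (rule sp_reg_proj_varietyE)
    have Hx: "H x \<noteq> 0" using W(2,6) x(1) vec.span_base[of x "{x}"] by blast
    from W(1,2) x(1) W(4,5) Hx obtain k A P Q where Q: "hom_poly k P" "hom_poly k Q" "Q (\<Phi> x) \<noteq> 0"
      "\<forall>z\<in>K. z \<noteq> 0 \<longrightarrow> vec.span {z} \<notin> W \<longrightarrow> A z = 0"
      "\<forall>z\<in>K. P (\<Phi> z) = (\<Sum>g\<in>G. F (perm_coords g z) * A (perm_coords g z))"
      "\<forall>z\<in>K. Q (\<Phi> z) = (\<Sum>g\<in>G. H (perm_coords g z) * A (perm_coords g z))"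
      by (rule local_invariant_fraction)
    \<comment> \<open>Both sides vanish off \<open>W\<close> because \<open>A\<close> does, so the identity holds on all of \<open>U\<close>.\<close>
    have PQ: "P (\<Phi> z) = f (q (vec.span {z})) * Q (\<Phi> z)" if z: "z \<in> K" "z \<noteq> 0" for z
    proof -
      have "F (perm_coords g z) * A (perm_coords g z) =
          f (q (vec.span {z})) * (H (perm_coords g z) * A (perm_coords g z))" if g: "g \<in> G" for g
      proof (cases "vec.span {perm_coords g z} \<in> W")
        case True
        have g0: "perm_coords g z \<in> vec.span {perm_coords g z} - {0}"
          using vec.span_base[of "perm_coords g z" "{perm_coords g z}"] z(2)
            perm_coords_eq_0[OF G_bij[OF g]] by simp
        with W(6) True have "H (perm_coords g z) \<noteq> 0 \<and>
          (f \<circ> q) (vec.span {perm_coords g z}) = F (perm_coords g z) / H (perm_coords g z)" by blast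
        then show ?thesis using q_G[OF g z] by simp
      next
        case False
        then have "A (perm_coords g z) = 0"
          using Q(4) K_G[OF g z(1)] z(2) perm_coords_eq_0[OF G_bij[OF g]] by blast
        then show ?thesis by simp
      qed
      then show ?thesis unfolding Q(5)[rule_format, OF z(1)] Q(6)[rule_format, OF z(1)] sum_distrib_left
        by (intro sum.cong) simp_all
    qed
    let ?W = "U \<inter> nonvanishing_locus Q"
    have fr: "\<forall>M\<in>?W. \<forall>v\<in>M - {0}. Q v \<noteq> 0 \<and> f M = P v / Q v"
    proof (intro ballI)
      fix M v assume M: "M \<in> ?W" and v: "v \<in> M - {0}"
      have Qv: "Q v \<noteq> 0" using M v by (auto simp: nonvanishing_locus_def)
      have ME: "M \<in> E" using M UE by blast
      then have Mv: "M = vec.span {v}" "v \<in> C" "v \<noteq> 0"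
        using v proj_space_line[of M v] by (auto simp: E_def)
      with \<Phi>_onto obtain z where z: "z \<in> K" "\<Phi> z = v" by blast
      with Mv \<Phi>_0 have z0: "z \<noteq> 0" by auto
      have "q (vec.span {z}) = M" using q_line[OF z0] z(2) Mv(1) by simp
      with PQ[OF z(1) z0] z(2) Qv show "Q v \<noteq> 0 \<and> f M = P v / Q v" by simp
    qed
    have op: "openin (subtopology zariski E) ?W"
    proof -
      have "openin (subtopology zariski E) (E \<inter> nonvanishing_locus Q)"
        using openin_nonvanishing[OF Q(2)] unfolding openin_subtopology by blast
      with U have "openin (subtopology zariski E) (U \<inter> (E \<inter> nonvanishing_locus Q))" by (rule openin_Int)
      moreover have "U \<inter> (E \<inter> nonvanishing_locus Q) = ?W" using UE by blast
      ultimately show ?thesis by simp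
    qed
    have LW: "L \<in> ?W" using L x(3,4) nonvanishing_line[OF Q(2)] Q(3) by simp
    show "\<exists>W d F G. openin (subtopology zariski E) W \<and> L \<in> W \<and> W \<subseteq> U \<and>
        hom_poly d F \<and> hom_poly d G \<and> (\<forall>L\<in>W. \<forall>x\<in>L - {0}. G x \<noteq> 0 \<and> f L = F x / G x)"
      by (rule exI[of _ ?W], rule exI[of _ k], rule exI[of _ P], rule exI[of _ Q])
        (intro conjI op LW fr Q(1,2) Int_lower1)
  qed
qed

theorem quotient_isomorphic: "sp_quotient (proj_variety V) (perm_line ` G) \<cong>\<^sub>v proj_variety E"
proof -
  have top: "topspace (subtopology zariski V) = V" "topspace (subtopology zariski E) = E"
    by (auto simp: topspace_zariski V_def E_def)
  have sp: "sp_top (proj_variety V) = subtopology zariski V"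
    "sp_top (proj_variety E) = subtopology zariski E" by (simp_all add: proj_variety_def)
  show ?thesis
  proof (rule sp_quotient_isomorphicI[where q = q], unfold sp top)
    show "q ` V = E"
    proof
      show "q ` V \<subseteq> E"
      proof
        fix L assume "L \<in> q ` V"
        then obtain M where "M \<in> V" "L = q M" by blast
        moreover from this(1) obtain x where "x \<noteq> 0" "x \<in> K" "M = vec.span {x}" by (rule V_E)
        ultimately show "L \<in> E" using q_E by simp
      qed
      show "E \<subseteq> q ` V"
      proof
        fix L assume "L \<in> E"
        then obtain x where "x \<noteq> 0" "x \<in> K" "L = vec.span {\<Phi> x}" "\<Phi> x \<noteq> 0" "q (vec.span {x}) = L"
          by (rule E_E)
        then show "L \<in> q ` V" using line_V[of x] by blast
      qed
    qed
    show "\<And>x x'. x \<in> V \<Longrightarrow> x' \<in> V \<Longrightarrow>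
        q x = q x' \<longleftrightarrow> orbit_of (perm_line ` G) x = orbit_of (perm_line ` G) x'"
      by (rule fibres)
    show "\<And>U. U \<subseteq> E \<Longrightarrow> openin (subtopology zariski E) U \<longleftrightarrow>
        openin (subtopology zariski V) {x \<in> V. q x \<in> U}"
      by (rule opens)
    show "\<And>U f. openin (subtopology zariski E) U \<Longrightarrow> sp_reg (proj_variety E) U f \<longleftrightarrow>
        sp_reg (proj_variety V) {x \<in> V. q x \<in> U} (f \<circ> q)"
      by (rule regular)
    show "\<And>U f g. sp_reg (proj_variety V) U f \<Longrightarrow> (\<And>x. x \<in> U \<Longrightarrow> g x = f x) \<Longrightarrow>
        sp_reg (proj_variety V) U g"
      by (rule proj_variety_reg_cong)
  qed
qed

end

section \<open>Bring's curve in coordinates\<close>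

lemma exhaust_5: "i = 1 \<or> i = 2 \<or> i = 3 \<or> i = 4 \<or> i = 5" for i :: 5
proof (induct i)
  case (of_int z)
  then have "z = 0 \<or> z = 1 \<or> z = 2 \<or> z = 3 \<or> z = 4" by fastforce
  then show ?case by auto
qed

lemma forall_5: "(\<forall>i::5. P i) \<longleftrightarrow> P 1 \<and> P 2 \<and> P 3 \<and> P 4 \<and> P 5"
  by (metis exhaust_5)

lemma UNIV_5: "UNIV = {1, 2, 3, 4, 5::5}"
  using exhaust_5 by auto

lemma sum_5: "(\<Sum>i\<in>UNIV. f i) = f 1 + f 2 + f 3 + f 4 + f (5::5)"
  unfolding UNIV_5 by (simp add: ac_simps)

definition vec4 :: "complex \<Rightarrow> complex \<Rightarrow> complex \<Rightarrow> complex \<Rightarrow> complex ^ 4" where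
  "vec4 a b c d = (\<chi> i. if i = 1 then a else if i = 2 then b else if i = 3 then c else d)"

definition vec5 :: "complex \<Rightarrow> complex \<Rightarrow> complex \<Rightarrow> complex \<Rightarrow> complex \<Rightarrow> complex ^ 5" where
  "vec5 a b c d e =
     (\<chi> i. if i = 1 then a else if i = 2 then b else if i = 3 then c else if i = 4 then d else e)"

lemma vec4_nth [simp]:
  "vec4 a b c d $ 1 = a" "vec4 a b c d $ 2 = b" "vec4 a b c d $ 3 = c" "vec4 a b c d $ 4 = d"
  by (simp_all add: vec4_def)

lemma vec5_nth [simp]:
  "vec5 a b c d e $ 1 = a" "vec5 a b c d e $ 2 = b" "vec5 a b c d e $ 3 = c"
  "vec5 a b c d e $ 4 = d" "vec5 a b c d e $ 5 = e"
  by (simp_all add: vec5_def)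

lemma vec5_eqI: "a = x $ 1 \<Longrightarrow> b = x $ 2 \<Longrightarrow> c = x $ 3 \<Longrightarrow> d = x $ 4 \<Longrightarrow> e = x $ 5 \<Longrightarrow> vec5 a b c d e = x"
  by (simp add: vec_eq_iff forall_5)

lemma hom_poly_vec5:
  assumes "hom_poly k A" "hom_poly k B" "hom_poly k C" "hom_poly k D" "hom_poly k E"
  shows "hom_poly k (\<lambda>y. vec5 (A y) (B y) (C y) (D y) (E y) $ i)"
  using exhaust_5[of i] assms by auto

lemma perm_coords_eqI:
  assumes "bij g" "\<And>i. y $ g i = x $ i"
  shows "perm_coords g x = y"
  unfolding perm_coords_def vec_eq_iff
  using assms(2)[of "inv_into UNIV g i" for i] assms(1) by (auto simp: bij_is_surj surj_f_inv_f)

lemma bij_cycle: "bij (cycle_of_list xs)"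
  using cycle_permutes permutes_bij by blast

lemma perm_coords_cycles:
  fixes x :: "complex ^ 5"
  shows "perm_coords (cycle_of_list [1, 2]) x = vec5 (x $ 2) (x $ 1) (x $ 3) (x $ 4) (x $ 5)"
    and "perm_coords (cycle_of_list [1, 3, 2, 4]) x = vec5 (x $ 4) (x $ 3) (x $ 1) (x $ 2) (x $ 5)"
    and "perm_coords (cycle_of_list [3, 4, 5]) x = vec5 (x $ 1) (x $ 2) (x $ 5) (x $ 3) (x $ 4)"
    and "perm_coords (cycle_of_list [1, 2] \<circ> cycle_of_list [3, 4]) x =
      vec5 (x $ 2) (x $ 1) (x $ 4) (x $ 3) (x $ 5)"
    and "perm_coords (cycle_of_list [1, 3] \<circ> cycle_of_list [2, 4]) x =
      vec5 (x $ 3) (x $ 4) (x $ 1) (x $ 2) (x $ 5)"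
proof -
  show "perm_coords (cycle_of_list [1, 2]) x = vec5 (x $ 2) (x $ 1) (x $ 3) (x $ 4) (x $ 5)"
    by (rule perm_coords_eqI[OF bij_cycle], rule forall_5[THEN iffD2, rule_format]) (simp add: Transposition.transpose_def)
  show "perm_coords (cycle_of_list [1, 3, 2, 4]) x = vec5 (x $ 4) (x $ 3) (x $ 1) (x $ 2) (x $ 5)"
    by (rule perm_coords_eqI[OF bij_cycle], rule forall_5[THEN iffD2, rule_format]) (simp add: Transposition.transpose_def)
  show "perm_coords (cycle_of_list [3, 4, 5]) x = vec5 (x $ 1) (x $ 2) (x $ 5) (x $ 3) (x $ 4)"
    by (rule perm_coords_eqI[OF bij_cycle], rule forall_5[THEN iffD2, rule_format]) (simp add: Transposition.transpose_def)
  show "perm_coords (cycle_of_list [1, 2] \<circ> cycle_of_list [3, 4]) x =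
      vec5 (x $ 2) (x $ 1) (x $ 4) (x $ 3) (x $ 5)"
    by (rule perm_coords_eqI[OF bij_comp[OF bij_cycle bij_cycle]],
        rule forall_5[THEN iffD2, rule_format]) (simp add: Transposition.transpose_def)
  show "perm_coords (cycle_of_list [1, 3] \<circ> cycle_of_list [2, 4]) x =
      vec5 (x $ 3) (x $ 4) (x $ 1) (x $ 2) (x $ 5)"
    by (rule perm_coords_eqI[OF bij_comp[OF bij_cycle bij_cycle]],
        rule forall_5[THEN iffD2, rule_format]) (simp add: Transposition.transpose_def)
qed

lemma hom_poly_mult2: "hom_poly 1 F \<Longrightarrow> hom_poly 1 G \<Longrightarrow> hom_poly 2 (\<lambda>x. F x * G x)"
  by (rule hom_poly_mult_eq, assumption, assumption) arith

lemma hom_poly_mult3: "hom_poly 2 F \<Longrightarrow> hom_poly 1 G \<Longrightarrow> hom_poly 3 (\<lambda>x. F x * G x)"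
  by (rule hom_poly_mult_eq, assumption, assumption) arith

lemma hom_poly_power2: "hom_poly 1 F \<Longrightarrow> hom_poly 2 (\<lambda>x. (F x)^2)"
  using hom_poly_power[of 1 F 2] by simp

lemma hom_poly_power3: "hom_poly 1 F \<Longrightarrow> hom_poly 3 (\<lambda>x. (F x)^3)"
  using hom_poly_power[of 1 F 3] by simp

lemmas hom_poly_intros = hom_poly_coord hom_poly_add hom_poly_diff hom_poly_minus hom_poly_cmult
  hom_poly_mult2 hom_poly_mult3 hom_poly_power2 hom_poly_power3

section \<open>The cones over Bring's curve and over a Weierstrass cubic\<close>

definition bring_cone :: "(complex ^ 5) set" where
  "bring_cone = {x. (\<Sum>i\<in>UNIV. x $ i) = 0 \<and> (\<Sum>i\<in>UNIV. (x $ i)^2) = 0 \<and> (\<Sum>i\<in>UNIV. (x $ i)^3) = 0}"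

definition weierstrass_cone :: "complex \<Rightarrow> complex \<Rightarrow> (complex ^ 3) set" where
  "weierstrass_cone a b =
     {v. (v $ 2)^2 * v $ 3 = (v $ 1)^3 + a * v $ 1 * (v $ 3)^2 + b * (v $ 3)^3}"

lemma bring_cone_iff: "x \<in> bring_cone \<longleftrightarrow> x $ 1 + x $ 2 + x $ 3 + x $ 4 + x $ 5 = 0 \<and>
    (x $ 1)^2 + (x $ 2)^2 + (x $ 3)^2 + (x $ 4)^2 + (x $ 5)^2 = 0 \<and>
    (x $ 1)^3 + (x $ 2)^3 + (x $ 3)^3 + (x $ 4)^3 + (x $ 5)^3 = 0"
  by (simp add: bring_cone_def sum_5)

lemma bring_cone_scale: "x \<in> bring_cone \<Longrightarrow> a *s x \<in> bring_cone"
  by (simp add: bring_cone_def power_mult_distrib flip: sum_distrib_left)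

lemma bring_cone_perm:
  assumes "bij g" "x \<in> bring_cone"
  shows "perm_coords g x \<in> bring_cone"
proof -
  have "(\<Sum>i\<in>UNIV. h (perm_coords g x $ i)) = (\<Sum>i\<in>UNIV. h (x $ i))" for h :: "complex \<Rightarrow> complex"
    unfolding perm_coords_def
    using sum.reindex_bij_betw[OF bij_imp_bij_inv[OF assms(1)], of "\<lambda>i. h (x $ i)"] by simp
  from this[of "\<lambda>t. t"] this[of "\<lambda>t. t ^ 2"] this[of "\<lambda>t. t ^ 3"] assms(2)
  show ?thesis unfolding bring_cone_def by simp
qed

lemma weierstrass_cone_scale: "v \<in> weierstrass_cone a b \<Longrightarrow> c *s v \<in> weierstrass_cone a b"
proof -
  assume "v \<in> weierstrass_cone a b"
  then have "c^3 * ((v $ 2)^2 * v $ 3) = c^3 * ((v $ 1)^3 + a * v $ 1 * (v $ 3)^2 + b * (v $ 3)^3)"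
    by (simp add: weierstrass_cone_def)
  then show ?thesis
    by (simp add: weierstrass_cone_def power2_eq_square power3_eq_cube algebra_simps)
qed

lemma hom_poly_vector_3:
  fixes X Y Z :: "complex ^ 'n \<Rightarrow> complex"
  assumes "hom_poly e X" "hom_poly e Y" "hom_poly e Z"
  shows "hom_poly e (\<lambda>x. (vector [X x, Y x, Z x] :: complex ^ 3) $ i)"
  using exhaust_3[of i] assms by auto

text \<open>
  The interface of \<open>cone_quotient\<close> for Bring's curve and a plane cubic, in terms of the three
  components of \<open>\<Phi>\<close>.
\<close>

lemma bring_quotient_weierstrass:
  fixes X Y Z :: "complex ^ 5 \<Rightarrow> complex"
  assumes bij: "\<And>g. g \<in> S \<Longrightarrow> bij g" and pos: "0 < e" "0 < M"
    and hom: "hom_poly e X" "hom_poly e Y" "hom_poly e Z"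
    and maps: "\<And>x. x \<in> bring_cone \<Longrightarrow> (Y x)^2 * Z x = (X x)^3 + a * X x * (Z x)^2 + b * (Z x)^3"
    and onto: "\<And>u v w. v^2 * w = u^3 + a * u * w^2 + b * w^3 \<Longrightarrow>
      \<exists>x\<in>bring_cone. X x = u \<and> Y x = v \<and> Z x = w"
    and semi: "\<And>g. g \<in> S \<Longrightarrow> \<exists>c. c \<noteq> 0 \<and> (\<forall>x\<in>bring_cone. X (perm_coords g x) = c * X x \<and>
      Y (perm_coords g x) = c * Y x \<and> Z (perm_coords g x) = c * Z x)"
    and desc: "\<And>k F. hom_poly (e * k) F \<Longrightarrow> M dvd k \<Longrightarrow>
      (\<And>g x. g \<in> S \<Longrightarrow> x \<in> bring_cone \<Longrightarrow> F (perm_coords g x) = F x) \<Longrightarrow>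
      descends bring_cone (\<lambda>x. vector [X x, Y x, Z x] :: complex ^ 3) k F"
  shows "bring_quotient S \<cong>\<^sub>v weierstrass_curve a b"
proof -
  interpret cone_quotient bring_cone "weierstrass_cone a b" S
    "\<lambda>x. vector [X x, Y x, Z x] :: complex ^ 3" e M
  proof
    fix v :: "complex ^ 3" assume "v \<in> weierstrass_cone a b"
    then obtain x where "x \<in> bring_cone" "X x = v $ 1" "Y x = v $ 2" "Z x = v $ 3"
      using onto[of "v $ 2" "v $ 3" "v $ 1"] by (auto simp: weierstrass_cone_def)
    then show "\<exists>x\<in>bring_cone. vector [X x, Y x, Z x] = v"
      by (intro bexI[of _ x]) (simp_all add: vec_eq_iff forall_3)
  next
    fix g assume "g \<in> S"
    from semi[OF this] obtain c where "c \<noteq> 0" "\<forall>x\<in>bring_cone. X (perm_coords g x) = c * X x \<and>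
      Y (perm_coords g x) = c * Y x \<and> Z (perm_coords g x) = c * Z x" by blast
    then show "\<exists>c. c \<noteq> 0 \<and> (\<forall>x\<in>bring_cone. (vector [X (perm_coords g x), Y (perm_coords g x),
        Z (perm_coords g x)] :: complex ^ 3) = c *s vector [X x, Y x, Z x])"
      by (intro exI[of _ c]) (simp add: vec_eq_iff forall_3)
  next
    show "hom_poly e (\<lambda>x. (vector [X x, Y x, Z x] :: complex ^ 3) $ i)" for i
      by (intro hom_poly_vector_3 hom)
    show "vector [X x, Y x, Z x] \<in> weierstrass_cone a b" if "x \<in> bring_cone" for x
      using maps[OF that] by (simp add: weierstrass_cone_def)
  qed (use bring_cone_scale weierstrass_cone_scale bij bring_cone_perm pos desc in auto)
  have "V = {L \<in> proj_space. \<forall>x \<in> L. (\<Sum>i\<in>UNIV. x $ i) = 0 \<and>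
      (\<Sum>i\<in>UNIV. (x $ i)^2) = 0 \<and> (\<Sum>i\<in>UNIV. (x $ i)^3) = 0}"
    unfolding V_def subset_iff by (simp add: bring_cone_def Ball_def)
  then have "bring_curve = proj_variety V" by (simp add: bring_curve_def)
  moreover have "E = {L \<in> proj_space. \<forall>v \<in> L.
      (v $ 2)^2 * v $ 3 = (v $ 1)^3 + a * v $ 1 * (v $ 3)^2 + b * (v $ 3)^3}"
    unfolding E_def subset_iff by (simp add: weierstrass_cone_def Ball_def)
  then have "weierstrass_curve a b = proj_variety E" by (simp add: weierstrass_curve_def)
  ultimately show ?thesis
    using quotient_isomorphic by (simp add: bring_quotient_def G_def)
qed

section \<open>Invariant polynomials on the cone over Bring's curve\<close>

lemma descends_power1: "descends K \<Phi> 1 f \<Longrightarrow> descends K \<Phi> n (\<lambda>x. f x ^ n)"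
  by (erule descends_power) simp

lemmas descends_intros = descends_cmult descends_mult[OF _ _ refl] descends_power1

lemma bring_cone_cycle: "x \<in> bring_cone \<Longrightarrow> perm_coords (cycle_of_list xs) x \<in> bring_cone"
  by (intro bring_cone_perm bij_cycle)

lemma bring_cone_cycles:
  "x \<in> bring_cone \<Longrightarrow> perm_coords (cycle_of_list xs \<circ> cycle_of_list ys) x \<in> bring_cone"
  by (intro bring_cone_perm bij_comp bij_cycle)

lemma bring_coneD:
  assumes "x \<in> bring_cone"
  shows "x $ 1 + x $ 2 + x $ 3 + x $ 4 + x $ 5 = 0"
    and "(x $ 1)^2 + (x $ 2)^2 + (x $ 3)^2 + (x $ 4)^2 + (x $ 5)^2 = 0"
    and "(x $ 1)^3 + (x $ 2)^3 + (x $ 3)^3 + (x $ 4)^3 + (x $ 5)^3 = 0"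
  using assms unfolding bring_cone_iff by simp_all

text \<open>
  Eliminating \<open>x\<^sub>1, x\<^sub>2\<close>, whose first three power sums satisfy the identity below, leaves the
  vanishing of \<open>6 h\<^sub>3(x\<^sub>3, x\<^sub>4, x\<^sub>5)\<close>, with \<open>h\<^sub>3\<close> the complete homogeneous symmetric polynomial. The
  other two equations say that \<open>x\<^sub>1, x\<^sub>2\<close> are the roots of \<open>T\<^sup>2 + h\<^sub>1 T + h\<^sub>2\<close>.
\<close>

lemma bring_cone_h3:
  assumes "x \<in> bring_cone"
  shows "(x $ 3 + x $ 4 + x $ 5)^3
    + 3 * (x $ 3 + x $ 4 + x $ 5) * ((x $ 3)^2 + (x $ 4)^2 + (x $ 5)^2)
    + 2 * ((x $ 3)^3 + (x $ 4)^3 + (x $ 5)^3) = 0"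
proof -
  have "(x $ 1 + x $ 2)^3 - 3 * (x $ 1 + x $ 2) * ((x $ 1)^2 + (x $ 2)^2) + 2 * ((x $ 1)^3 + (x $ 2)^3) = 0"
    by Groebner_Basis.algebra
  moreover have "x $ 1 + x $ 2 = - (x $ 3 + x $ 4 + x $ 5)"
    "(x $ 1)^2 + (x $ 2)^2 = - ((x $ 3)^2 + (x $ 4)^2 + (x $ 5)^2)"
    "(x $ 1)^3 + (x $ 2)^3 = - ((x $ 3)^3 + (x $ 4)^3 + (x $ 5)^3)"
    using bring_coneD[OF assms] by Groebner_Basis.algebra+
  ultimately show ?thesis by Groebner_Basis.algebra
qed

subsection \<open>The transposition\<close>

text \<open>
  In the coordinates \<open>x\<^sub>1 - x\<^sub>2, x\<^sub>3, x\<^sub>4, x\<^sub>5\<close> only the first changes sign, and its square is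
  \<open>h\<^sub>1\<^sup>2 - 4 h\<^sub>2\<close>, a polynomial in the others.
\<close>

lemma descent_12:
  assumes gens: "descends bring_cone \<Phi> 1 (\<lambda>x. x $ 3)" "descends bring_cone \<Phi> 1 (\<lambda>x. x $ 4)"
      "descends bring_cone \<Phi> 1 (\<lambda>x. x $ 5)"
    and F: "hom_poly n F"
    and inv: "\<And>x. x \<in> bring_cone \<Longrightarrow> F (perm_coords (cycle_of_list [1, 2]) x) = F x"
  shows "descends bring_cone \<Phi> n F"
proof -
  define T :: "complex ^ 4 \<Rightarrow> complex ^ 5" where
    "T y = vec5 (1/2 * (y $ 1 - (y $ 2 + y $ 3 + y $ 4))) (1/2 * (- (y $ 1) - (y $ 2 + y $ 3 + y $ 4)))
      (y $ 2) (y $ 3) (y $ 4)" for y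
  define Y where "Y x = vec4 (x $ 1 - x $ 2) (x $ 3) (x $ 4) (x $ 5)" for x :: "complex ^ 5"
  define \<sigma> :: "5 \<Rightarrow> 5" where "\<sigma> = cycle_of_list [1, 2]"
  define act where "act j x = (if j = 0 then x else perm_coords \<sigma> x)"
    for j :: nat and x :: "complex ^ 5"
  have perm: "perm_coords \<sigma> x = vec5 (x $ 2) (x $ 1) (x $ 3) (x $ 4) (x $ 5)" for x
    unfolding \<sigma>_def by (rule perm_coords_cycles)
  have Y0: "Y (act 0 x) = vec4 (x $ 1 - x $ 2) (x $ 3) (x $ 4) (x $ 5)"
    and Y1: "Y (act 1 x) = vec4 (- (x $ 1 - x $ 2)) (x $ 3) (x $ 4) (x $ 5)" for x
    by (simp_all add: Y_def act_def perm)
  show ?thesis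
  proof (rule descends_by_averaging[OF F, where T = T and Y = Y and J = "{..<2}" and act = act])
    show "hom_poly 1 (\<lambda>y. T y $ i)" for i
      unfolding T_def by (intro hom_poly_vec5 hom_poly_intros)
    show "T (Y x) = x" if "x \<in> bring_cone" for x
    proof -
      have "x $ 3 + x $ 4 + x $ 5 = - (x $ 1 + x $ 2)"
        using bring_coneD(1)[OF that] by Groebner_Basis.algebra
      then show ?thesis unfolding T_def Y_def vec4_nth by (intro vec5_eqI) simp_all
    qed
    show "act j x \<in> bring_cone \<and> F (act j x) = F x" if "x \<in> bring_cone" for j x
      using that inv[folded \<sigma>_def] bring_cone_cycle[of x "[1, 2]", folded \<sigma>_def] by (simp add: act_def)
  next
    fix i j k l assume n: "i + j + k + l = n"
    have "(x $ 1 - x $ 2)^2 = (-1) * ((x $ 3 + x $ 4 + x $ 5)^2) - 2 * ((x $ 3)^2 + (x $ 4)^2 + (x $ 5)^2)"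
      if "x \<in> bring_cone" for x
      using bring_coneD(1,2)[OF that] by Groebner_Basis.algebra
    moreover have "descends bring_cone \<Phi> 2
        (\<lambda>x. (-1) * ((x $ 3 + x $ 4 + x $ 5)^2) - 2 * ((x $ 3)^2 + (x $ 4)^2 + (x $ 5)^2))"
      by (intro descends_diff descends_cmult descends_add descends_power1 gens)
    ultimately have d: "descends bring_cone \<Phi> 2 (\<lambda>x. (x $ 1 - x $ 2)^2)"
      by (elim descends_cong) simp
    have *: "descends bring_cone \<Phi> n
      (\<lambda>x. (1 + (-1)^i) * ((x $ 1 - x $ 2)^i * (x $ 3)^j * (x $ 4)^k * (x $ 5)^l))"
    proof (cases "even i")
      case True
      then obtain m where m: "i = 2 * m" by blast
      have "descends bring_cone \<Phi> (2 * m + j + k + l)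
          (\<lambda>x. 2 * (((x $ 1 - x $ 2)^2)^m * (x $ 3)^j * (x $ 4)^k * (x $ 5)^l))"
        by (intro descends_intros descends_power[OF d refl] gens)
      then show ?thesis using n by (simp add: m power_mult)
    qed (simp add: descends_zero)
    show "descends bring_cone \<Phi> n (\<lambda>x. \<Sum>g<2. (Y (act g x) $ 1) ^ i * (Y (act g x) $ 2) ^ j *
        (Y (act g x) $ 3) ^ k * (Y (act g x) $ 4) ^ l)"
    proof (rule descends_cong[OF *])
      fix x :: "complex ^ 5"
      define d where "d = x $ 1 - x $ 2"
      have "Y (act 0 x) = vec4 d (x $ 3) (x $ 4) (x $ 5)"
        "Y (act (Suc 0) x) = vec4 (- d) (x $ 3) (x $ 4) (x $ 5)"
        using Y0 Y1 by (simp_all add: d_def)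
      then show "(\<Sum>g<2. (Y (act g x) $ 1) ^ i * (Y (act g x) $ 2) ^ j *
          (Y (act g x) $ 3) ^ k * (Y (act g x) $ 4) ^ l) =
          (1 + (-1)^i) * ((x $ 1 - x $ 2)^i * (x $ 3)^j * (x $ 4)^k * (x $ 5)^l)"
        unfolding d_def[symmetric]
        by (simp add: numeral_2_eq_2 power_minus[of d i] ring_distribs mult.assoc)
    qed
  qed (simp_all add: lessThan_empty_iff)
qed

subsection \<open>The Klein four-group\<close>

text \<open>
  The Klein four-group acts on these by its three nontrivial characters, and trivially on \<open>x\<^sub>5\<close>.
\<close>

definition chi1 :: "complex ^ 5 \<Rightarrow> complex" where "chi1 x = x $ 1 + x $ 2 - x $ 3 - x $ 4"
definition chi2 :: "complex ^ 5 \<Rightarrow> complex" where "chi2 x = x $ 1 - x $ 2 + x $ 3 - x $ 4"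
definition chi3 :: "complex ^ 5 \<Rightarrow> complex" where "chi3 x = x $ 1 - x $ 2 - x $ 3 + x $ 4"

lemma bring_cone_chi:
  assumes "x \<in> bring_cone"
  shows "(chi1 x)^2 + (chi2 x)^2 + (chi3 x)^2 = - 5 * (x $ 5)^2"
    and "chi1 x * chi2 x * chi3 x = - 5 * (x $ 5)^3"
proof -
  let ?u = "x $ 1 + x $ 2 + x $ 3 + x $ 4"
  have u: "?u = - (x $ 5)"
    and p2: "(x $ 1)^2 + (x $ 2)^2 + (x $ 3)^2 + (x $ 4)^2 = - ((x $ 5)^2)"
    and p3: "(x $ 1)^3 + (x $ 2)^3 + (x $ 3)^3 + (x $ 4)^3 = - ((x $ 5)^3)"
    using bring_coneD[OF assms] by (Groebner_Basis.algebra, Groebner_Basis.algebra, Groebner_Basis.algebra)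
  have "(chi1 x)^2 + (chi2 x)^2 + (chi3 x)^2 =
      4 * ((x $ 1)^2 + (x $ 2)^2 + (x $ 3)^2 + (x $ 4)^2) - ?u^2"
    unfolding chi1_def chi2_def chi3_def by Groebner_Basis.algebra
  then show sq: "(chi1 x)^2 + (chi2 x)^2 + (chi3 x)^2 = - 5 * (x $ 5)^2"
    unfolding u p2 by simp
  have "?u^3 + 3 * ?u * ((chi1 x)^2 + (chi2 x)^2 + (chi3 x)^2) + 6 * (chi1 x * chi2 x * chi3 x) =
      16 * ((x $ 1)^3 + (x $ 2)^3 + (x $ 3)^3 + (x $ 4)^3)"
    unfolding chi1_def chi2_def chi3_def by Groebner_Basis.algebra
  then have "6 * (chi1 x * chi2 x * chi3 x) = 6 * (- 5 * (x $ 5)^3)"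
    unfolding u p3 sq by Groebner_Basis.algebra
  then show "chi1 x * chi2 x * chi3 x = - 5 * (x $ 5)^3" by (simp add: mult.assoc)
qed

text \<open>
  A monomial in \<open>x\<^sub>5\<close> and the three character forms is invariant exactly when the exponents of the
  latter have the same parity. If they are odd, one factor \<open>c d e\<close> is replaced by \<open>-5 x\<^sub>5\<^sup>3\<close>; the even
  total degree then makes the exponent of \<open>x\<^sub>5\<close> even as well.
\<close>

lemma descent_klein:
  assumes gens: "descends bring_cone \<Phi> 1 (\<lambda>x. (chi1 x)^2)" "descends bring_cone \<Phi> 1 (\<lambda>x. (chi2 x)^2)"
      "descends bring_cone \<Phi> 1 (\<lambda>x. (chi3 x)^2)"
    and F: "hom_poly (2 * n) F"
    and inv: "\<And>x. x \<in> bring_cone \<Longrightarrow>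
        F (perm_coords (cycle_of_list [1, 2] \<circ> cycle_of_list [3, 4]) x) = F x"
      "\<And>x. x \<in> bring_cone \<Longrightarrow>
        F (perm_coords (cycle_of_list [1, 3] \<circ> cycle_of_list [2, 4]) x) = F x"
  shows "descends bring_cone \<Phi> n F"
proof -
  define T :: "complex ^ 4 \<Rightarrow> complex ^ 5" where
    "T y = vec5 (1/4 * (y $ 2 + y $ 3 + y $ 4 - y $ 1)) (1/4 * (y $ 2 - y $ 3 - y $ 4 - y $ 1))
      (1/4 * (y $ 3 - y $ 2 - y $ 4 - y $ 1)) (1/4 * (y $ 4 - y $ 2 - y $ 3 - y $ 1)) (y $ 1)" for y
  define Y where "Y x = vec4 (x $ 5) (chi1 x) (chi2 x) (chi3 x)" for x :: "complex ^ 5"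
  define \<alpha> \<beta> :: "5 \<Rightarrow> 5" where "\<alpha> = cycle_of_list [1, 2] \<circ> cycle_of_list [3, 4]"
    and "\<beta> = cycle_of_list [1, 3] \<circ> cycle_of_list [2, 4]"
  define act where "act j x = (if j = 0 then x else if j = 1 then perm_coords \<alpha> x
      else if j = 2 then perm_coords \<beta> x else perm_coords \<alpha> (perm_coords \<beta> x))"
    for j :: nat and x :: "complex ^ 5"
  have perm: "perm_coords \<alpha> x = vec5 (x $ 2) (x $ 1) (x $ 4) (x $ 3) (x $ 5)"
      "perm_coords \<beta> x = vec5 (x $ 3) (x $ 4) (x $ 1) (x $ 2) (x $ 5)" for x
    unfolding \<alpha>_def \<beta>_def by (rule perm_coords_cycles)+
  have cone: "perm_coords \<alpha> x \<in> bring_cone" "perm_coords \<beta> x \<in> bring_cone" if "x \<in> bring_cone" for x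
    using that unfolding \<alpha>_def \<beta>_def by (simp_all only: bring_cone_cycles)
  have Y: "Y (act 0 x) = vec4 (x $ 5) (chi1 x) (chi2 x) (chi3 x)"
    "Y (act 1 x) = vec4 (x $ 5) (chi1 x) (- chi2 x) (- chi3 x)"
    "Y (act 2 x) = vec4 (x $ 5) (- chi1 x) (chi2 x) (- chi3 x)"
    "Y (act 3 x) = vec4 (x $ 5) (- chi1 x) (- chi2 x) (chi3 x)" for x
    by (simp_all add: Y_def act_def perm chi1_def chi2_def chi3_def algebra_simps)
  show ?thesis
  proof (rule descends_by_averaging[OF F, where T = T and Y = Y and J = "{0,1,2,3}" and act = act])
    show "hom_poly 1 (\<lambda>y. T y $ i)" for i
      unfolding T_def by (intro hom_poly_vec5 hom_poly_intros)
    show "T (Y x) = x" if "x \<in> bring_cone" for x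
    proof -
      have x5: "x $ 5 = - (x $ 1 + x $ 2 + x $ 3 + x $ 4)"
        using bring_coneD(1)[OF that] by Groebner_Basis.algebra
      show ?thesis unfolding T_def Y_def vec4_nth chi1_def chi2_def chi3_def
        by (intro vec5_eqI) (simp_all add: x5)
    qed
    show "act j x \<in> bring_cone \<and> F (act j x) = F x" if "x \<in> bring_cone" for j x
      using that inv[folded \<alpha>_def \<beta>_def] cone by (simp add: act_def)
  next
    fix i j k l assume n: "i + j + k + l = 2 * n"
    have sq: "descends bring_cone \<Phi> m
        (\<lambda>x. (x $ 5)^i * chi1 x ^ j * chi2 x ^ k * chi3 x ^ l)"
      if "even i" "even j" "even k" "even l" "i + j + k + l = 2 * m" for i j k l m
    proof -
      have "descends bring_cone \<Phi> 1 (\<lambda>x. (-1/5) * ((chi1 x)^2 + (chi2 x)^2 + (chi3 x)^2))"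
        by (intro descends_cmult descends_add gens)
      then have t: "descends bring_cone \<Phi> 1 (\<lambda>x. (x $ 5)^2)"
        by (rule descends_cong) (simp add: bring_cone_chi)
      from that obtain i' j' k' l' where m: "i = 2 * i'" "j = 2 * j'" "k = 2 * k'" "l = 2 * l'"
        by (elim evenE)
      have "descends bring_cone \<Phi> (i' + j' + k' + l')
          (\<lambda>x. ((x $ 5)^2)^i' * ((chi1 x)^2)^j' * ((chi2 x)^2)^k' * ((chi3 x)^2)^l')"
        by (intro descends_intros gens t)
      moreover have "i' + j' + k' + l' = m" using that(5) m by simp
      ultimately show ?thesis by (simp add: m power_mult)
    qed
    have *: "descends bring_cone \<Phi> n (\<lambda>x. (1 + (-1)^(k + l) + (-1)^(j + l) + (-1)^(j + k)) *
        ((x $ 5)^i * chi1 x ^ j * chi2 x ^ k * chi3 x ^ l))"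
    proof (cases "even (k + l) \<and> even (j + l)")
      case False
      then have "(1 + (-1)^(k + l) + (-1)^(j + l) + (-1)^(j + k) :: complex) = 0"
        by (cases "even j"; cases "even k"; cases "even l") simp_all
      then show ?thesis by (simp only: mult_zero_left descends_zero)
    next
      case True
      show ?thesis
      proof (cases "even j")
        case j: True
        with True have e: "even k" "even l" by auto
        have "even (i + j + k + l)" unfolding n by simp
        with e j have "even i" by simp
        with e j n sq show ?thesis by (intro descends_cmult) blast
      next
        case j: False
        with True have e: "odd k" "odd l" by auto
        have "even (i + j + k + l)" unfolding n by simp
        with e j have i: "odd i" by simp
        obtain j' k' l' where m: "j = Suc j'" "k = Suc k'" "l = Suc l'"
          using j e by (metis odd_pos gr0_implies_Suc)
        have "descends bring_cone \<Phi> n (\<lambda>x. (x $ 5)^(i + 3) * chi1 x ^ j' * chi2 x ^ k' * chi3 x ^ l')"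
          using j e i m n by (intro sq) auto
        then have "descends bring_cone \<Phi> n (\<lambda>x. (- 5) * ((x $ 5)^(i + 3) * chi1 x ^ j' * chi2 x ^ k' * chi3 x ^ l'))"
          by (rule descends_cmult)
        then show ?thesis
        proof (intro descends_cmult, elim descends_cong)
          fix x assume "x \<in> bring_cone"
          have "(x $ 5) ^ i * chi1 x ^ j * chi2 x ^ k * chi3 x ^ l =
            (chi1 x * chi2 x * chi3 x) * ((x $ 5)^i * chi1 x ^ j' * chi2 x ^ k' * chi3 x ^ l')"
            unfolding m by (simp add: mult_ac)
          also have "\<dots> = (- 5) * ((x $ 5)^(i + 3) * chi1 x ^ j' * chi2 x ^ k' * chi3 x ^ l')"
            unfolding bring_cone_chi(2)[OF \<open>x \<in> bring_cone\<close>] by (simp add: power_add mult_ac)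
          finally show "(x $ 5) ^ i * chi1 x ^ j * chi2 x ^ k * chi3 x ^ l =
            (- 5) * ((x $ 5)^(i + 3) * chi1 x ^ j' * chi2 x ^ k' * chi3 x ^ l')" .
        qed
      qed
    qed
    have signs: "(- y)^m = (-1)^m * y^m" for y :: complex and m by (rule power_minus)
    show "descends bring_cone \<Phi> n (\<lambda>x. \<Sum>g\<in>{0,1,2,3}. (Y (act g x) $ 1) ^ i * (Y (act g x) $ 2) ^ j *
        (Y (act g x) $ 3) ^ k * (Y (act g x) $ 4) ^ l)"
    proof (rule descends_cong[OF *])
      fix x
      show "(\<Sum>g\<in>{0,1,2,3}. (Y (act g x) $ 1) ^ i * (Y (act g x) $ 2) ^ j *
        (Y (act g x) $ 3) ^ k * (Y (act g x) $ 4) ^ l) =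
        (1 + (-1)^(k + l) + (-1)^(j + l) + (-1)^(j + k)) *
        ((x $ 5)^i * chi1 x ^ j * chi2 x ^ k * chi3 x ^ l)"
        using Y[of x] by (simp add: signs[of "chi1 x"] signs[of "chi2 x"] signs[of "chi3 x"]
            power_add ring_distribs mult_ac)
    qed
  qed (simp_all add: lessThan_empty_iff)
qed

subsection \<open>The cyclic group of order four\<close>

lemma i_power_eq_1: "\<i> ^ n = 1 \<longleftrightarrow> 4 dvd n"
proof -
  have 4: "\<i> ^ 4 = 1" by (simp add: power4_eq_xxxx)
  have "\<i> ^ n = \<i> ^ (4 * (n div 4) + n mod 4)" by simp
  also have "\<dots> = \<i> ^ (n mod 4)" unfolding power_add power_mult 4 by simp
  finally have n: "\<i> ^ n = \<i> ^ (n mod 4)" .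
  have "n mod 4 < 4" by simp
  then consider "n mod 4 = 0" | "n mod 4 = 1" | "n mod 4 = 2" | "n mod 4 = 3" by linarith
  then show ?thesis
    by cases (simp_all add: n dvd_eq_mod_eq_0 power3_eq_cube complex_eq_iff)
qed

lemma four_dvd_int_diff:
  assumes "i + j + 2 * w = 2 * n" "4 dvd 2 * j + 2 * w" "even (n :: nat)"
  shows "4 dvd int i - int j"
proof -
  obtain m v where "n = 2 * m" "2 * j + 2 * w = 4 * v" using assms(2,3) by (elim dvdE) simp
  with assms(1) have "int i - int j = 4 * (int m - int v)" by simp
  then show ?thesis by simp
qed

text \<open>
  Write \<open>a = x\<^sub>1 - x\<^sub>2\<close>, \<open>b = x\<^sub>3 - x\<^sub>4\<close>, \<open>D = a\<^sup>2 - b\<^sup>2\<close> and \<open>t = x\<^sub>5\<close>. The generator acts diagonally on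
  \<open>t, c, p = a + i b, r = a - i b\<close>, with eigenvalues \<open>1, -1, i, -i\<close>, and the equations of the curve are
  \<open>c D = -5 t\<^sup>3\<close> and \<open>p r = -(5 t\<^sup>2 + c\<^sup>2) / 2\<close>. The second one removes \<open>p\<close> or \<open>r\<close> from a monomial. Then the
  remaining one of \<open>p\<^sup>2, r\<^sup>2 = D \<plusminus> 2 i a b\<close> descends, and so do \<open>t c\<close>, \<open>t\<^sup>4 = -D (t c) / 5\<close> and
  \<open>c\<^sup>4 = 4 D\<^sup>2 + 16 (a b)\<^sup>2 - 25 t\<^sup>4 - 10 (t c)\<^sup>2\<close>.
\<close>

lemma descent_1324:
  assumes gens: "descends bring_cone \<Phi> 1 (\<lambda>x. (x $ 1 - x $ 2)^2 - (x $ 3 - x $ 4)^2)"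
      "descends bring_cone \<Phi> 1 (\<lambda>x. x $ 5 * chi1 x)"
      "descends bring_cone \<Phi> 1 (\<lambda>x. (x $ 1 - x $ 2) * (x $ 3 - x $ 4))"
    and F: "hom_poly (2 * n) F" and n: "even n"
    and inv: "\<And>x. x \<in> bring_cone \<Longrightarrow> F (perm_coords (cycle_of_list [1, 3, 2, 4]) x) = F x"
  shows "descends bring_cone \<Phi> n F"
proof -
  define t a b :: "complex ^ 5 \<Rightarrow> complex"
    where "t x = x $ 5" and "a x = x $ 1 - x $ 2" and "b x = x $ 3 - x $ 4" for x
  define p r where "p x = a x + \<i> * b x" and "r x = a x - \<i> * b x" for x
  have chi: "chi2 x = a x + b x" "chi3 x = a x - b x" for x
    by (simp_all add: chi2_def chi3_def a_def b_def)
  note D = gens(1)[folded a_def b_def] and Q = gens(2)[folded t_def] and R = gens(3)[folded a_def b_def]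
  have rel1: "(chi1 x)^2 + 5 * (t x)^2 + 2 * ((a x)^2 + (b x)^2) = 0" 
    and rel2: "chi1 x * ((a x)^2 - (b x)^2) = - 5 * (t x)^3" if "x \<in> bring_cone" for x
    using bring_cone_chi[OF that] unfolding chi t_def[symmetric] by Groebner_Basis.algebra+
  have t4: "descends bring_cone \<Phi> 2 (\<lambda>x. (t x)^4)"
  proof (rule descends_cong)
    show "descends bring_cone \<Phi> 2 (\<lambda>x. (-1/5) * (((a x)^2 - (b x)^2) * (t x * chi1 x)))"
      by (intro descends_cmult descends_mult[OF D Q]) simp
    fix x assume "x \<in> bring_cone"
    from rel2[OF this] have "((a x)^2 - (b x)^2) * (t x * chi1 x) = - 5 * (t x)^4" by Groebner_Basis.algebra
    then show "(t x)^4 = (-1/5) * (((a x)^2 - (b x)^2) * (t x * chi1 x))" by simp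
  qed
  have c4: "descends bring_cone \<Phi> 2 (\<lambda>x. (chi1 x)^4)"
  proof (rule descends_cong)
    show "descends bring_cone \<Phi> 2 (\<lambda>x. 4 * ((a x)^2 - (b x)^2)^2 + 16 * (a x * b x)^2
        - 25 * (t x)^4 - 10 * (t x * chi1 x)^2)"
      by (intro descends_diff descends_add descends_cmult descends_power1 D Q R t4)
    fix x assume "x \<in> bring_cone"
    from rel1[OF this] show "(chi1 x)^4 = 4 * ((a x)^2 - (b x)^2)^2 + 16 * (a x * b x)^2
        - 25 * (t x)^4 - 10 * (t x * chi1 x)^2" by Groebner_Basis.algebra
  qed
  have tc: "descends bring_cone \<Phi> m (\<lambda>x. t x ^ i * chi1 x ^ j)"
    if ij: "i + j = 2 * m" "4 dvd int i - int j" for i j m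
  proof (cases "j \<le> i")
    case True
    with ij(2) obtain w where w: "i = j + 4 * w"
      by (metis dvd_def int_dvd_int_iff le_add_diff_inverse of_nat_diff of_nat_numeral)
    have "descends bring_cone \<Phi> (j + 2 * w) (\<lambda>x. (t x * chi1 x) ^ j * ((t x)^4)^w)"
      by (intro descends_intros Q descends_power[OF t4 refl])
    moreover have "j + 2 * w = m" using ij(1) w by simp
    ultimately show ?thesis by (simp add: w power_add power_mult_distrib mult_ac flip: power_mult)
  next
    case False
    have "4 dvd int j - int i" using ij(2) by (simp add: dvd_diff_commute)
    with False obtain w where w: "j = i + 4 * w"
      by (metis dvd_def int_dvd_int_iff le_add_diff_inverse nat_le_linear of_nat_diff of_nat_numeral)
    have "descends bring_cone \<Phi> (i + 2 * w) (\<lambda>x. (t x * chi1 x) ^ i * ((chi1 x)^4)^w)"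
      by (intro descends_intros Q descends_power[OF c4 refl])
    moreover have "i + 2 * w = m" using ij(1) w by simp
    ultimately show ?thesis by (simp add: w power_add power_mult_distrib mult_ac flip: power_mult)
  qed
  have p2: "descends bring_cone \<Phi> 1 (\<lambda>x. (p x)^2)"
  proof (rule descends_cong)
    show "descends bring_cone \<Phi> 1 (\<lambda>x. ((a x)^2 - (b x)^2) + (2 * \<i>) * (a x * b x))"
      by (intro descends_add descends_cmult D R)
  qed (simp add: p_def power2_eq_square algebra_simps)
  have r2: "descends bring_cone \<Phi> 1 (\<lambda>x. (r x)^2)"
  proof (rule descends_cong)
    show "descends bring_cone \<Phi> 1 (\<lambda>x. ((a x)^2 - (b x)^2) - (2 * \<i>) * (a x * b x))"
      by (intro descends_diff descends_cmult D R)
  qed (simp add: r_def power2_eq_square algebra_simps)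
  have pr: "p x * r x = (-5/2) * (t x)^2 + (-1/2) * (chi1 x)^2" if "x \<in> bring_cone" for x
  proof -
    have "p x * r x = (a x)^2 + (b x)^2"
      by (simp add: p_def r_def power2_eq_square algebra_simps)
    moreover have "2 * ((a x)^2 + (b x)^2) = 2 * ((-5/2) * (t x)^2 + (-1/2) * (chi1 x)^2)"
      using rel1[OF that] by (simp add: algebra_simps eq_neg_iff_add_eq_0)
    then have "(a x)^2 + (b x)^2 = (-5/2) * (t x)^2 + (-1/2) * (chi1 x)^2"
      by (metis mult_left_cancel zero_neq_numeral)
    ultimately show ?thesis by (rule trans)
  qed
  have mono: "descends bring_cone \<Phi> n (\<lambda>x. t x ^ i * chi1 x ^ j * p x ^ k * r x ^ l)"
    if "i + j + k + l = 2 * n" "4 dvd 2 * j + k + 3 * l" for i j k l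
    using that
  proof (induction k arbitrary: i j l)
    case 0
    from 0(2) have "even l" by presburger
    then obtain w where w: "l = 2 * w" by blast
    from 0 n w have m: "i + j = 2 * (n - w)" "w \<le> n" by auto
    have "4 dvd (2 * j + 2 * w) + 4 * w" using 0(2) by (simp add: w add.commute)
    then have "4 dvd 2 * j + 2 * w" by (metis dvd_add_left_iff dvd_triv_left)
    with 0(1) n have "4 dvd int i - int j" by (intro four_dvd_int_diff) (simp_all add: w)
    with m(1) have "descends bring_cone \<Phi> ((n - w) + w) (\<lambda>x. (t x ^ i * chi1 x ^ j) * ((r x)^2)^w)"
      by (intro descends_mult[OF _ _ refl] tc descends_power1 r2)
    then show ?case using m(2) by (simp add: w power_mult)
  next
    case (Suc k)
    show ?case
    proof (cases l)
      case 0
      from Suc.prems(2) 0 have "even (Suc k)" by presburger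
      then obtain w where w: "Suc k = 2 * w" by blast
      from Suc.prems 0 n w have m: "i + j = 2 * (n - w)" "w \<le> n" by auto
      have "4 dvd int i - int j"
        by (rule four_dvd_int_diff[OF _ _ n, of _ _ w]) (use Suc.prems 0 w in simp_all)
      with m(1) have "descends bring_cone \<Phi> ((n - w) + w) (\<lambda>x. (t x ^ i * chi1 x ^ j) * ((p x)^2)^w)"
        by (intro descends_mult[OF _ _ refl] tc descends_power1 p2)
      then show ?thesis using m(2) by (simp only: w 0 power_mult) simp
    next
      case l: (Suc l')
      have "2 * j + Suc k + 3 * l = 2 * j + k + 3 * l' + 4" unfolding l by simp
      with Suc.prems(2) have "4 dvd 2 * j + k + 3 * l'" by (simp only: dvd_add_left_iff) simp
      moreover have "2 * (j + 2) + k + 3 * l' = 2 * j + k + 3 * l' + 4" by simp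
      ultimately have d4: "4 dvd 2 * j + k + 3 * l'" "4 dvd 2 * (j + 2) + k + 3 * l'"
        by (simp_all only: dvd_add_left_iff dvd_refl)
      have "descends bring_cone \<Phi> n (\<lambda>x. (-5/2) * (t x ^ (i + 2) * chi1 x ^ j * p x ^ k * r x ^ l')
          + (-1/2) * (t x ^ i * chi1 x ^ (j + 2) * p x ^ k * r x ^ l'))"
        using Suc.prems(1) d4 unfolding l by (intro descends_add descends_cmult Suc.IH) simp_all
      then show ?thesis
      proof (rule descends_cong)
        fix x assume "x \<in> bring_cone"
        have "t x ^ i * chi1 x ^ j * p x ^ Suc k * r x ^ l =
            (t x ^ i * chi1 x ^ j * p x ^ k * r x ^ l') * (p x * r x)"
          unfolding l by (simp add: mult_ac)
        then show "t x ^ i * chi1 x ^ j * p x ^ Suc k * r x ^ l =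
          (-5/2) * (t x ^ (i + 2) * chi1 x ^ j * p x ^ k * r x ^ l')
          + (-1/2) * (t x ^ i * chi1 x ^ (j + 2) * p x ^ k * r x ^ l')"
          unfolding pr[OF \<open>x \<in> bring_cone\<close>]
          by (simp add: power_add power2_eq_square ring_distribs mult_ac)
      qed
    qed
  qed
  define T :: "complex ^ 4 \<Rightarrow> complex ^ 5" where
    "T y = vec5 (1/4 * (y $ 2 - y $ 1 + (y $ 3 + y $ 4))) (1/4 * (y $ 2 - y $ 1 - (y $ 3 + y $ 4)))
      (1/4 * (- (y $ 2) - y $ 1 - \<i> * (y $ 3 - y $ 4))) (1/4 * (- (y $ 2) - y $ 1 + \<i> * (y $ 3 - y $ 4)))
      (y $ 1)" for y
  define Y where "Y x = vec4 (t x) (chi1 x) (p x) (r x)" for x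
  define \<sigma> :: "5 \<Rightarrow> 5" where "\<sigma> = cycle_of_list [1, 3, 2, 4]"
  define act where "act j = (perm_coords \<sigma> ^^ j)" for j
  have perm: "perm_coords \<sigma> x = vec5 (x $ 4) (x $ 3) (x $ 1) (x $ 2) (x $ 5)" for x
    unfolding \<sigma>_def by (rule perm_coords_cycles)
  have \<sigma>: "t (perm_coords \<sigma> x) = t x" "chi1 (perm_coords \<sigma> x) = - chi1 x"
    "p (perm_coords \<sigma> x) = \<i> * p x" "r (perm_coords \<sigma> x) = - \<i> * r x" for x
    by (simp_all add: perm t_def chi1_def p_def r_def a_def b_def algebra_simps)
  have Y: "Y (act m x) = vec4 (t x) ((-1)^m * chi1 x) (\<i>^m * p x) ((-\<i>)^m * r x)" for m x
  proof -
    have "t (act m x) = t x \<and> chi1 (act m x) = (-1)^m * chi1 x \<and>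
        p (act m x) = \<i>^m * p x \<and> r (act m x) = (-\<i>)^m * r x"
      by (induction m) (simp_all add: act_def \<sigma>)
    then show ?thesis unfolding Y_def by simp
  qed
  show ?thesis
  proof (rule descends_by_averaging[OF F, where T = T and Y = Y and J = "{..<4}" and act = act])
    show "hom_poly 1 (\<lambda>y. T y $ i)" for i
      unfolding T_def by (intro hom_poly_vec5 hom_poly_intros)
    show "T (Y x) = x" if "x \<in> bring_cone" for x
    proof -
      have x5: "x $ 5 = - (x $ 1 + x $ 2 + x $ 3 + x $ 4)"
        using bring_coneD(1)[OF that] by Groebner_Basis.algebra
      have "\<i> * (p x - r x) = 2 * (x $ 4 - x $ 3)" "p x + r x = 2 * (x $ 1 - x $ 2)"
        by (simp_all add: p_def r_def a_def b_def algebra_simps)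
      then show ?thesis unfolding T_def Y_def vec4_nth chi1_def t_def
        by (intro vec5_eqI) (simp_all add: x5)
    qed
    show "act j x \<in> bring_cone \<and> F (act j x) = F x" if "x \<in> bring_cone" for j x
      using that
    proof (induction j)
      case (Suc j)
      then show ?case using inv[of "act j x"] bring_cone_cycle[of "act j x" "[1,3,2,4]"]
        by (simp add: act_def \<sigma>_def)
    qed (simp add: act_def)
  next
    fix i j k l assume ijkl: "i + j + k + l = 2 * n"
    define z where "z = \<i> ^ (2 * j + k + 3 * l)"
    have z: "((-1)^m)^j * (\<i>^m)^k * ((-\<i>)^m)^l = z ^ m" for m
    proof -
      have i3: "- \<i> = \<i> ^ 3" by (simp add: power3_eq_cube)
      have "((-1)^m)^j * (\<i>^m)^k * ((-\<i>)^m)^l = ((\<i>^2)^m)^j * (\<i>^m)^k * ((\<i>^3)^m)^l"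
        unfolding i3 by simp
      also have "\<dots> = z ^ m"
        unfolding z_def power_mult[symmetric] power_add[symmetric] by (simp add: algebra_simps)
      finally show ?thesis .
    qed
    have sum: "(\<Sum>g<4. (Y (act g x) $ 1) ^ i * (Y (act g x) $ 2) ^ j *
        (Y (act g x) $ 3) ^ k * (Y (act g x) $ 4) ^ l) =
        (\<Sum>g<4. z ^ g) * (t x ^ i * chi1 x ^ j * p x ^ k * r x ^ l)" for x
      unfolding sum_distrib_right
      by (intro sum.cong) (simp_all add: Y power_mult_distrib flip: z)
    show "descends bring_cone \<Phi> n (\<lambda>x. \<Sum>g<4. (Y (act g x) $ 1) ^ i * (Y (act g x) $ 2) ^ j *
        (Y (act g x) $ 3) ^ k * (Y (act g x) $ 4) ^ l)"
    proof (cases "z = 1")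
      case True
      then have "4 dvd 2 * j + k + 3 * l" unfolding z_def by (simp only: i_power_eq_1)
      then show ?thesis unfolding sum by (intro descends_cmult mono ijkl)
    next
      case False
      have "z ^ 4 = (\<i> ^ 4) ^ (2 * j + k + 3 * l)"
        unfolding z_def power_mult[symmetric] by (simp add: mult.commute)
      then have "z ^ 4 = 1" by (simp add: power4_eq_xxxx)
      with False have "(\<Sum>g<4. z ^ g) = 0" using geometric_sum[OF False, of 4] by simp
      then show ?thesis unfolding sum by (simp add: descends_zero)
    qed
  qed (simp_all add: lessThan_empty_iff)
qed

subsection \<open>The twisted symmetric group on three letters\<close>

lemma omega_exists: "\<exists>\<omega>::complex. \<omega>^2 + \<omega> + 1 = 0"
proof
  have "(csqrt (-3))^2 = -3" by (rule power2_csqrt)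
  then show "((-1 + csqrt (-3)) / 2)^2 + (-1 + csqrt (-3)) / 2 + 1 = 0"
    by (simp add: field_simps power2_eq_square)
qed

lemma omega_power_eq_1:
  fixes \<omega> :: complex
  assumes \<omega>: "\<omega>^2 + \<omega> + 1 = 0"
  shows "\<omega> ^ n = 1 \<longleftrightarrow> 3 dvd n"
proof -
  have 3: "\<omega> ^ 3 = 1" using \<omega> by Groebner_Basis.algebra
  have "\<omega> ^ n = \<omega> ^ (3 * (n div 3) + n mod 3)" by simp
  also have "\<dots> = \<omega> ^ (n mod 3)" unfolding power_add power_mult 3 by simp
  finally have n: "\<omega> ^ n = \<omega> ^ (n mod 3)" .
  have w1: "\<omega> \<noteq> 1" using \<omega> by auto
  have w2: "\<omega>^2 \<noteq> 1"
  proof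
    assume "\<omega>^2 = 1"
    with \<omega> have "\<omega> = -2" by Groebner_Basis.algebra
    with \<open>\<omega>^2 = 1\<close> show False by simp
  qed
  have "n mod 3 < 3" by simp
  then consider "n mod 3 = 0" | "n mod 3 = 1" | "n mod 3 = 2" by linarith
  then show ?thesis
    by cases (simp_all add: n dvd_eq_mod_eq_0 w1 w2)
qed

text \<open>
  The group is generated by \<open>(12)(34)\<close> and \<open>(345)\<close>: it permutes \<open>x\<^sub>3, x\<^sub>4, x\<^sub>5\<close> as the symmetric group
  and swaps \<open>x\<^sub>1, x\<^sub>2\<close> by the sign. The Lagrange resolvents diagonalise the action of \<open>(345)\<close>.
\<close>

definition sum345 :: "complex ^ 5 \<Rightarrow> complex" where "sum345 x = x $ 3 + x $ 4 + x $ 5"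
definition diff12 :: "complex ^ 5 \<Rightarrow> complex" where "diff12 x = x $ 1 - x $ 2"
definition vandermonde345 :: "complex ^ 5 \<Rightarrow> complex" where
  "vandermonde345 x = (x $ 3 - x $ 4) * (x $ 4 - x $ 5) * (x $ 3 - x $ 5)"
definition resolvent :: "complex \<Rightarrow> complex ^ 5 \<Rightarrow> complex" where
  "resolvent w x = x $ 3 + w * x $ 4 + w^2 * x $ 5"

lemma resolvent_cubes_diff:
  assumes "\<omega>^2 + \<omega> + 1 = 0"
  shows "(resolvent \<omega> x)^3 - (resolvent (\<omega>^2) x)^3 = 3 * (2 * \<omega> + 1) * vandermonde345 x"
  using assms unfolding resolvent_def vandermonde345_def by Groebner_Basis.algebra

text \<open>
  The symmetric functions of \<open>x\<^sub>3, x\<^sub>4, x\<^sub>5\<close> are polynomials in their sum and in \<open>(x\<^sub>1 - x\<^sub>2)\<^sup>2\<close>: the first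
  power sum is the former, the second is given by the quadric, and the third by \<open>bring_cone_h3\<close>.
\<close>

lemma
  assumes \<omega>: "\<omega>^2 + \<omega> + 1 = 0" and x: "x \<in> bring_cone"
  shows resolvent_mult:
      "resolvent \<omega> x * resolvent (\<omega>^2) x = (-5/4) * (sum345 x)^2 + (-3/4) * (diff12 x)^2"
    and resolvent_cubes_add: "(resolvent \<omega> x)^3 + (resolvent (\<omega>^2) x)^3 =
      (35/4) * (sum345 x)^3 + (45/4) * (sum345 x * (diff12 x)^2)"
proof -
  let ?p2 = "(x $ 3)^2 + (x $ 4)^2 + (x $ 5)^2" and ?p3 = "(x $ 3)^3 + (x $ 4)^3 + (x $ 5)^3"
  have \<delta>: "(diff12 x)^2 = (-1) * (sum345 x)^2 - 2 * ?p2"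
    using bring_coneD(1,2)[OF x] unfolding diff12_def sum345_def by Groebner_Basis.algebra
  have h3: "(sum345 x)^3 + 3 * sum345 x * ?p2 + 2 * ?p3 = 0"
    unfolding sum345_def by (rule bring_cone_h3[OF x])
  have "2 * (resolvent \<omega> x * resolvent (\<omega>^2) x) = 3 * ?p2 - (sum345 x)^2"
    using \<omega> unfolding resolvent_def sum345_def by Groebner_Basis.algebra
  then have "4 * (resolvent \<omega> x * resolvent (\<omega>^2) x) = - 5 * (sum345 x)^2 - 3 * (diff12 x)^2"
    using \<delta> by Groebner_Basis.algebra
  then have "4 * (resolvent \<omega> x * resolvent (\<omega>^2) x) = 4 * ((-5/4) * (sum345 x)^2 + (-3/4) * (diff12 x)^2)"
    by simp
  then show "resolvent \<omega> x * resolvent (\<omega>^2) x = (-5/4) * (sum345 x)^2 + (-3/4) * (diff12 x)^2"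
    by (metis mult_left_cancel zero_neq_numeral)
  have "(resolvent \<omega> x)^3 + (resolvent (\<omega>^2) x)^3 =
      2 * (sum345 x)^3 - 9 * sum345 x * ?p2 + 9 * ?p3"
    using \<omega> unfolding resolvent_def sum345_def by Groebner_Basis.algebra
  then have "4 * ((resolvent \<omega> x)^3 + (resolvent (\<omega>^2) x)^3) =
      35 * (sum345 x)^3 + 45 * (sum345 x * (diff12 x)^2)"
    using h3 \<delta> by Groebner_Basis.algebra
  then have "4 * ((resolvent \<omega> x)^3 + (resolvent (\<omega>^2) x)^3) =
      4 * ((35/4) * (sum345 x)^3 + (45/4) * (sum345 x * (diff12 x)^2))"
    by (simp add: algebra_simps)
  then show "(resolvent \<omega> x)^3 + (resolvent (\<omega>^2) x)^3 =
      (35/4) * (sum345 x)^3 + (45/4) * (sum345 x * (diff12 x)^2)"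
    by (metis mult_left_cancel zero_neq_numeral)
qed

text \<open>
  The discriminant of the cubic with roots \<open>x\<^sub>3, x\<^sub>4, x\<^sub>5\<close> is, up to the factor \<open>-27\<close>, equal to
  \<open>(u - v)\<^sup>2 = (u + v)\<^sup>2 - 4 u v\<close> for the cubes \<open>u, v\<close> of the two resolvents.
\<close>

lemma vandermonde345_square:
  assumes x: "x \<in> bring_cone"
  shows "- 16 * (vandermonde345 x)^2 = (diff12 x)^6 + 80 * (sum345 x)^2 * (diff12 x)^4
    + 125 * (sum345 x)^4 * (diff12 x)^2 + 50 * (sum345 x)^6"
proof -
  obtain \<omega> :: complex where \<omega>: "\<omega>^2 + \<omega> + 1 = 0" using omega_exists by blast
  let ?p = "resolvent \<omega> x" and ?r = "resolvent (\<omega>^2) x" and ?s = "sum345 x" and ?d = "diff12 x"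
  have "(?p^3 - ?r^3)^2 = -27 * (vandermonde345 x)^2"
    unfolding resolvent_cubes_diff[OF \<omega>] using \<omega> by Groebner_Basis.algebra
  moreover have "(?p^3 - ?r^3)^2 = (?p^3 + ?r^3)^2 - 4 * (?p * ?r)^3" by Groebner_Basis.algebra
  moreover have "4 * (?p^3 + ?r^3) = 35 * ?s^3 + 45 * ?s * ?d^2"
    unfolding resolvent_cubes_add[OF \<omega> x] by (simp add: algebra_simps)
  moreover have "4 * (?p * ?r) = - 5 * ?s^2 - 3 * ?d^2"
    unfolding resolvent_mult[OF \<omega> x] by (simp add: algebra_simps)
  ultimately have "27 * (- 16 * (vandermonde345 x)^2) = 27 * (?d^6 + 80 * ?s^2 * ?d^4 + 125 * ?s^4 * ?d^2 + 50 * ?s^6)"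
    by Groebner_Basis.algebra
  then show ?thesis by (metis mult_left_cancel zero_neq_numeral)
qed

lemma sum_times_bool: "(\<Sum>g\<in>A \<times> (UNIV :: bool set). h g) = (\<Sum>m\<in>A. h (m, False) + h (m, True))"
proof -
  have "(\<Sum>g\<in>A \<times> (UNIV :: bool set). h g) = (\<Sum>m\<in>A. \<Sum>b\<in>UNIV. h (m, b))"
    by (simp add: sum.cartesian_product)
  then show ?thesis by (simp add: UNIV_bool)
qed

text \<open>
  Averaging over \<open>(345)\<close> leaves the monomials \<open>s\<^sup>i p\<^sup>j r\<^sup>k \<delta>\<^sup>l\<close> with \<open>j - k\<close> divisible by three, where \<open>p, r\<close> are
  the resolvents; averaging over \<open>(12)(34)\<close>, which exchanges \<open>p\<close> and \<open>r\<close> up to roots of unity and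
  changes the sign of \<open>\<delta>\<close>, symmetrises them. Replacing \<open>p r\<close> by a polynomial in \<open>s, \<delta>\<^sup>2\<close> leaves
  \<open>s\<^sup>i \<delta>\<^sup>l (u\<^sup>m \<plusminus> v\<^sup>m)\<close> with \<open>u = p\<^sup>3\<close>, \<open>v = r\<^sup>3\<close>, which are reduced by the linear recurrence of second order
  in \<open>m\<close> with coefficients \<open>u + v\<close> and \<open>u v\<close>. There remain \<open>s\<^sup>i \<delta>\<^sup>l\<close> with \<open>i\<close> even, possibly times \<open>\<Delta>\<close>; they
  are products of \<open>s\<^sup>2 \<delta>\<close> and \<open>\<delta>\<^sup>3\<close> or of \<open>s\<^sup>2 \<delta>\<close> and \<open>s\<^sup>6\<close>, and the formula for \<open>\<Delta>\<^sup>2\<close> expresses \<open>s\<^sup>6\<close>.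
\<close>

lemma descent_S3:
  assumes gens: "descends bring_cone \<Phi> 1 (\<lambda>x. (sum345 x)^2 * diff12 x)"
      "descends bring_cone \<Phi> 1 vandermonde345" "descends bring_cone \<Phi> 1 (\<lambda>x. (diff12 x)^3)"
    and F: "hom_poly (3 * n) F" and n: "even n"
    and inv: "\<And>x. x \<in> bring_cone \<Longrightarrow>
        F (perm_coords (cycle_of_list [1, 2] \<circ> cycle_of_list [3, 4]) x) = F x"
      "\<And>x. x \<in> bring_cone \<Longrightarrow> F (perm_coords (cycle_of_list [3, 4, 5]) x) = F x"
  shows "descends bring_cone \<Phi> n F"
proof -
  obtain \<omega> :: complex where \<omega>: "\<omega>^2 + \<omega> + 1 = 0" using omega_exists by blast
  define s \<delta> where "s = sum345" and "\<delta> = diff12"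
  define p r where "p = resolvent \<omega>" and "r = resolvent (\<omega>^2)"
  note X = gens(1)[folded s_def \<delta>_def] and V = gens(2) and Z = gens(3)[folded \<delta>_def]
  note pr = resolvent_mult[OF \<omega>, folded s_def \<delta>_def p_def r_def]
    and pr3 = resolvent_cubes_add[OF \<omega>, folded s_def \<delta>_def p_def r_def]
    and pr3' = resolvent_cubes_diff[OF \<omega>, folded p_def r_def]
  have s6: "descends bring_cone \<Phi> 2 (\<lambda>x. (s x)^6)"
  proof (rule descends_cong)
    show "descends bring_cone \<Phi> 2 (\<lambda>x. (-1/50) * (16 * (vandermonde345 x)^2 + ((\<delta> x)^3)^2
        + 80 * (((s x)^2 * \<delta> x) * (\<delta> x)^3) + 125 * ((s x)^2 * \<delta> x)^2))"
      by (intro descends_add descends_cmult descends_power1 descends_mult[OF X Z] X V Z) simp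
    fix x assume "x \<in> bring_cone"
    from vandermonde345_square[OF this, folded s_def \<delta>_def]
    have "16 * (vandermonde345 x)^2 + ((\<delta> x)^3)^2
        + 80 * (((s x)^2 * \<delta> x) * (\<delta> x)^3) + 125 * ((s x)^2 * \<delta> x)^2 = - 50 * (s x)^6"
      by Groebner_Basis.algebra
    then show "(s x)^6 = (-1/50) * (16 * (vandermonde345 x)^2 + ((\<delta> x)^3)^2
        + 80 * (((s x)^2 * \<delta> x) * (\<delta> x)^3) + 125 * ((s x)^2 * \<delta> x)^2)"
      by simp
  qed
  have sd: "descends bring_cone \<Phi> m (\<lambda>x. s x ^ i * \<delta> x ^ l)" if "even i" "i + l = 3 * m" for i l m
  proof -
    from that(1) obtain i' where i: "i = 2 * i'" by blast
    show ?thesis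
    proof (cases "i' \<le> l")
      case True
      then have w: "l = i' + 3 * (m - i')" "i' + (m - i') = m" using that(2) i by auto
      have "descends bring_cone \<Phi> (i' + (m - i')) (\<lambda>x. ((s x)^2 * \<delta> x) ^ i' * ((\<delta> x)^3)^(m - i'))"
        by (intro descends_intros X Z)
      moreover have "(s x)^i * (\<delta> x)^l = ((s x)^2 * \<delta> x) ^ i' * ((\<delta> x)^3)^(m - i')" for x
        by (subst w(1)) (simp add: i power_add power_mult_distrib mult_ac flip: power_mult)
      ultimately show ?thesis by (simp only: w(2))
    next
      case False
      have "2 * (i' - l) = 3 * (m - l)" using that(2) i False by simp
      then have "even (m - l)" by presburger
      then obtain w where "m - l = 2 * w" by blast
      with False that(2) i have w: "i' = l + 3 * w" "l + 2 * w = m" by auto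
      have "descends bring_cone \<Phi> (l + 2 * w) (\<lambda>x. ((s x)^2 * \<delta> x) ^ l * ((s x)^6)^w)"
        by (intro descends_intros X descends_power[OF s6 refl])
      then show ?thesis
        unfolding w(2) by (simp add: i w(1) power_add power_mult_distrib mult_ac flip: power_mult)
    qed
  qed
  have uv: "descends bring_cone \<Phi> n (\<lambda>x. s x ^ i * \<delta> x ^ l * (((p x)^3)^m + (-1)^l * ((r x)^3)^m))"
    if "i + l + 3 * m = 3 * n" for i l m
    using that
  proof (induction m arbitrary: i l rule: induct_nat_012)
    case 0
    show ?case
    proof (cases "even l")
      case True
      have "even (i + l)" using 0 n by simp
      with True have "even i" by simp
      with 0 have "descends bring_cone \<Phi> n (\<lambda>x. 2 * (s x ^ i * \<delta> x ^ l))"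
        by (intro descends_cmult sd) simp_all
      then show ?thesis using True by (simp add: mult_ac)
    qed (simp add: descends_zero)
  next
    case 1
    have il: "i + l + 3 = 3 * n" using 1 by simp
    have "even (i + l + 3)" unfolding il using n by simp
    show ?case
    proof (cases "even l")
      case True
      then have "even (i + 3)" "even (i + 1)" using \<open>even (i + l + 3)\<close> by simp_all
      with il have "descends bring_cone \<Phi> n (\<lambda>x. (35/4) * (s x ^ (i + 3) * \<delta> x ^ l)
          + (45/4) * (s x ^ (i + 1) * \<delta> x ^ (l + 2)))"
        by (intro descends_add descends_cmult sd) simp_all
      then show ?thesis
      proof (rule descends_cong)
        fix x assume x: "x \<in> bring_cone"
        have "s x ^ i * \<delta> x ^ l * (((p x)^3)^1 + (-1)^l * ((r x)^3)^1) =
            s x ^ i * \<delta> x ^ l * ((p x)^3 + (r x)^3)" using True by simp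
        also have "\<dots> = (35/4) * (s x ^ (i + 3) * \<delta> x ^ l) + (45/4) * (s x ^ (i + 1) * \<delta> x ^ (l + 2))"
          unfolding pr3[OF x] by (simp add: power_add power2_eq_square algebra_simps)
        finally show "s x ^ i * \<delta> x ^ l * (((p x)^3)^Suc 0 + (-1)^l * ((r x)^3)^Suc 0) =
            (35/4) * (s x ^ (i + 3) * \<delta> x ^ l) + (45/4) * (s x ^ (i + 1) * \<delta> x ^ (l + 2))"
          by simp
      qed
    next
      case False
      then have "even i" using \<open>even (i + l + 3)\<close> by simp
      with il have "descends bring_cone \<Phi> ((n - 1) + 1)
          (\<lambda>x. (3 * (2 * \<omega> + 1)) * ((s x ^ i * \<delta> x ^ l) * vandermonde345 x))"
        by (intro descends_cmult descends_mult[OF _ V refl] sd) simp_all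
      moreover have "n - 1 + 1 = n" using il by simp
      ultimately have "descends bring_cone \<Phi> n
          (\<lambda>x. (3 * (2 * \<omega> + 1)) * ((s x ^ i * \<delta> x ^ l) * vandermonde345 x))" by simp
      then show ?thesis
      proof (rule descends_cong)
        fix x
        have "s x ^ i * \<delta> x ^ l * (((p x)^3)^Suc 0 + (-1)^l * ((r x)^3)^Suc 0) =
            s x ^ i * \<delta> x ^ l * ((p x)^3 - (r x)^3)" using False by simp
        then show "s x ^ i * \<delta> x ^ l * (((p x)^3)^Suc 0 + (-1)^l * ((r x)^3)^Suc 0) =
            (3 * (2 * \<omega> + 1)) * ((s x ^ i * \<delta> x ^ l) * vandermonde345 x)"
          unfolding pr3' by (simp add: mult_ac)
      qed
    qed
  next
    case (ge2 m)
    let ?f = "\<lambda>i l m x. s x ^ i * \<delta> x ^ l * (((p x)^3)^m + (-1)^l * ((r x)^3)^m)"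
    have "descends bring_cone \<Phi> n (\<lambda>x. (35/4) * ?f (i + 3) l (Suc m) x + (45/4) * ?f (i + 1) (l + 2) (Suc m) x
      + (125/64) * ?f (i + 6) l m x + (225/64) * ?f (i + 4) (l + 2) m x
      + (135/64) * ?f (i + 2) (l + 4) m x + (27/64) * ?f i (l + 6) m x)"
      using ge2.prems by (intro descends_add descends_cmult ge2.IH) simp_all
    then show ?case
    proof (rule descends_cong)
      fix x assume x: "x \<in> bring_cone"
      define u v e where "u = (p x)^3" and "v = (r x)^3" and "e = ((-1)^l :: complex)"
      have uv1: "u + v = (35/4) * (s x)^3 + (45/4) * (s x * (\<delta> x)^2)"
        unfolding u_def v_def by (rule pr3[OF x])
      have "u * v = (p x * r x)^3" by (simp add: u_def v_def power_mult_distrib)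
      also have "\<dots> = - (125/64) * (s x)^6 - (225/64) * ((s x)^4 * (\<delta> x)^2)
          - (135/64) * ((s x)^2 * (\<delta> x)^4) - (27/64) * (\<delta> x)^6"
        unfolding pr[OF x] by Groebner_Basis.algebra
      finally have uv2: "u * v = - (125/64) * (s x)^6 - (225/64) * ((s x)^4 * (\<delta> x)^2)
          - (135/64) * ((s x)^2 * (\<delta> x)^4) - (27/64) * (\<delta> x)^6" .
      have rec: "u ^ Suc (Suc m) + e * v ^ Suc (Suc m) =
          (u + v) * (u ^ Suc m + e * v ^ Suc m) - (u * v) * (u ^ m + e * v ^ m)"
        by (simp add: algebra_simps)
      define A B C where "A = u ^ Suc m + e * v ^ Suc m" and "B = u ^ m + e * v ^ m"
        and "C = s x ^ i * \<delta> x ^ l"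
      have "?f i l (Suc (Suc m)) x = C * ((u + v) * A - (u * v) * B)"
        unfolding A_def B_def C_def rec[symmetric] by (simp add: u_def v_def e_def)
      also have "\<dots> = (35/4) * ((C * (s x)^3) * A) + (45/4) * ((C * s x * (\<delta> x)^2) * A)
        + (125/64) * ((C * (s x)^6) * B) + (225/64) * ((C * (s x)^4 * (\<delta> x)^2) * B)
        + (135/64) * ((C * (s x)^2 * (\<delta> x)^4) * B) + (27/64) * ((C * (\<delta> x)^6) * B)"
        unfolding uv1 uv2 by (simp add: algebra_simps)
      also have "\<dots> = (35/4) * ?f (i + 3) l (Suc m) x + (45/4) * ?f (i + 1) (l + 2) (Suc m) x
        + (125/64) * ?f (i + 6) l m x + (225/64) * ?f (i + 4) (l + 2) m x
        + (135/64) * ?f (i + 2) (l + 4) m x + (27/64) * ?f i (l + 6) m x"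
        by (simp add: A_def B_def C_def u_def v_def e_def power_add power2_eq_square mult_ac)
      finally show "?f i l (Suc (Suc m)) x = \<dots>" .
    qed
  qed
  have mono: "descends bring_cone \<Phi> n
      (\<lambda>x. s x ^ i * \<delta> x ^ l * (p x ^ j * r x ^ k + (-1)^l * (r x ^ j * p x ^ k)))"
    if "i + j + k + l = 3 * n" "3 dvd j + 2 * k" for i j k l
    using that
  proof (induction k arbitrary: i j l)
    case 0
    then obtain m where m: "j = 3 * m" by auto
    with 0 uv[of i l m] show ?case by (simp add: power_mult)
  next
    case (Suc k)
    show ?case
    proof (cases j)
      case 0
      with Suc.prems(2) have "3 dvd 2 * Suc k" by simp
      then have "3 dvd Suc k" by presburger
      then obtain m where m: "Suc k = 3 * m" by blast
      have "descends bring_cone \<Phi> n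
          (\<lambda>x. (-1)^l * (s x ^ i * \<delta> x ^ l * (((p x)^3)^m + (-1)^l * ((r x)^3)^m)))"
        using Suc.prems(1) 0 m by (intro descends_cmult uv) simp
      then show ?thesis
      proof (rule descends_cong)
        fix x
        show "s x ^ i * \<delta> x ^ l * (p x ^ j * r x ^ Suc k + (-1)^l * (r x ^ j * p x ^ Suc k)) =
            (-1)^l * (s x ^ i * \<delta> x ^ l * (((p x)^3)^m + (-1)^l * ((r x)^3)^m))"
          unfolding m 0 power_mult by (cases "even l") (simp_all add: algebra_simps)
      qed
    next
      case j: (Suc j')
      have "j + 2 * Suc k = j' + 2 * k + 3" unfolding j by simp
      with Suc.prems(2) have d: "3 dvd j' + 2 * k" by (simp only: dvd_add_left_iff) simp
      let ?f = "\<lambda>i l x. s x ^ i * \<delta> x ^ l * (p x ^ j' * r x ^ k + (-1)^l * (r x ^ j' * p x ^ k))"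
      have "descends bring_cone \<Phi> n (\<lambda>x. (-5/4) * ?f (i + 2) l x + (-3/4) * ?f i (l + 2) x)"
        using Suc.prems(1) d unfolding j by (intro descends_add descends_cmult Suc.IH) simp_all
      then show ?thesis
      proof (rule descends_cong)
        fix x assume x: "x \<in> bring_cone"
        define A where "A = p x ^ j' * r x ^ k + (-1)^l * (r x ^ j' * p x ^ k)"
        have "s x ^ i * \<delta> x ^ l * (p x ^ j * r x ^ Suc k + (-1)^l * (r x ^ j * p x ^ Suc k)) =
            (p x * r x) * (s x ^ i * \<delta> x ^ l * A)"
          unfolding j A_def by (simp add: algebra_simps)
        also have "\<dots> = (-5/4) * (s x ^ (i + 2) * \<delta> x ^ l * A) + (-3/4) * (s x ^ i * \<delta> x ^ (l + 2) * A)"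
          unfolding pr[OF x] by (simp add: power_add algebra_simps power2_eq_square)
        finally show "s x ^ i * \<delta> x ^ l * (p x ^ j * r x ^ Suc k + (-1)^l * (r x ^ j * p x ^ Suc k)) =
            (-5/4) * ?f (i + 2) l x + (-3/4) * ?f i (l + 2) x"
          by (simp add: A_def)
      qed
    qed
  qed
  have \<omega>3: "\<omega>^3 = 1" using \<omega> by Groebner_Basis.algebra
  define T :: "complex ^ 4 \<Rightarrow> complex ^ 5" where
    "T y = vec5 (1/2 * (y $ 4 - y $ 1)) (1/2 * (- (y $ 4) - y $ 1)) (1/3 * (y $ 1 + y $ 2 + y $ 3))
      (1/3 * (y $ 1 + \<omega>^2 * y $ 2 + \<omega> * y $ 3)) (1/3 * (y $ 1 + \<omega> * y $ 2 + \<omega>^2 * y $ 3))" for y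
  define Y where "Y x = vec4 (s x) (p x) (r x) (\<delta> x)" for x
  define \<rho> \<tau> :: "5 \<Rightarrow> 5" where "\<rho> = cycle_of_list [3, 4, 5]"
    and "\<tau> = cycle_of_list [1, 2] \<circ> cycle_of_list [3, 4]"
  define act where "act g x = (perm_coords \<rho> ^^ fst g) (if snd g then perm_coords \<tau> x else x)"
    for g :: "nat \<times> bool" and x :: "complex ^ 5"
  have perm: "perm_coords \<rho> x = vec5 (x $ 1) (x $ 2) (x $ 5) (x $ 3) (x $ 4)"
      "perm_coords \<tau> x = vec5 (x $ 2) (x $ 1) (x $ 4) (x $ 3) (x $ 5)" for x
    unfolding \<rho>_def \<tau>_def by (rule perm_coords_cycles)+
  have \<rho>sd: "s (perm_coords \<rho> x) = s x" "\<delta> (perm_coords \<rho> x) = \<delta> x" for x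
    by (simp_all add: perm s_def \<delta>_def sum345_def diff12_def)
  have \<rho>pr: "p (perm_coords \<rho> x) = \<omega> * p x" "r (perm_coords \<rho> x) = \<omega>^2 * r x" for x
    unfolding perm p_def r_def resolvent_def vec5_nth
    using \<omega>3 by Groebner_Basis.algebra+
  note \<rho> = \<rho>sd \<rho>pr
  have \<tau>sd: "s (perm_coords \<tau> x) = s x" "\<delta> (perm_coords \<tau> x) = - \<delta> x" for x
    by (simp_all add: perm s_def \<delta>_def sum345_def diff12_def)
  have \<tau>pr: "p (perm_coords \<tau> x) = \<omega> * r x" "r (perm_coords \<tau> x) = \<omega>^2 * p x" for x
    unfolding perm p_def r_def resolvent_def vec5_nth
    using \<omega>3 by Groebner_Basis.algebra+
  note \<tau> = \<tau>sd \<tau>pr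
  have \<rho>m: "s ((perm_coords \<rho> ^^ m) x) = s x" "\<delta> ((perm_coords \<rho> ^^ m) x) = \<delta> x"
      "p ((perm_coords \<rho> ^^ m) x) = \<omega>^m * p x" "r ((perm_coords \<rho> ^^ m) x) = (\<omega>^2)^m * r x" for m x
    by (induction m) (simp_all add: \<rho>)
  have YF: "Y (act (m, False) x) = vec4 (s x) (\<omega>^m * p x) ((\<omega>^2)^m * r x) (\<delta> x)"
    and YT: "Y (act (m, True) x) = vec4 (s x) (\<omega>^m * (\<omega> * r x)) ((\<omega>^2)^m * (\<omega>^2 * p x)) (- \<delta> x)" for m x
    by (simp_all add: Y_def act_def \<rho>m \<tau>)
  show ?thesis
  proof (rule descends_by_averaging[OF F, where T = T and Y = Y and J = "{..<3} \<times> UNIV" and act = act])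
    show "hom_poly 1 (\<lambda>y. T y $ i)" for i
      unfolding T_def by (intro hom_poly_vec5 hom_poly_intros)
    show "T (Y x) = x" if "x \<in> bring_cone" for x
    proof -
      have "x $ 1 + x $ 2 + x $ 3 + x $ 4 + x $ 5 = 0" using bring_coneD(1)[OF that] .
      then have "\<delta> x - s x = 2 * x $ 1" "- \<delta> x - s x = 2 * x $ 2"
        "s x + p x + r x = 3 * x $ 3" "s x + \<omega>^2 * p x + \<omega> * r x = 3 * x $ 4"
        "s x + \<omega> * p x + \<omega>^2 * r x = 3 * x $ 5"
        using \<omega> unfolding s_def \<delta>_def p_def r_def sum345_def diff12_def resolvent_def
        by Groebner_Basis.algebra+
      then show ?thesis unfolding T_def Y_def vec4_nth by (intro vec5_eqI) simp_all
    qed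
    show "act g x \<in> bring_cone \<and> F (act g x) = F x" if x: "x \<in> bring_cone" for g x
    proof -
      have "(perm_coords \<rho> ^^ m) y \<in> bring_cone \<and> F ((perm_coords \<rho> ^^ m) y) = F y"
        if "y \<in> bring_cone" for m y
        using that
      proof (induction m)
        case (Suc m)
        then show ?case using inv(2)[folded \<rho>_def, of "(perm_coords \<rho> ^^ m) y"]
            bring_cone_cycle[of "(perm_coords \<rho> ^^ m) y" "[3,4,5]", folded \<rho>_def] by simp
      qed simp
      moreover have "perm_coords \<tau> x \<in> bring_cone" "F (perm_coords \<tau> x) = F x"
        unfolding \<tau>_def using x by (simp_all only: bring_cone_cycles inv(1))
      ultimately show ?thesis using x by (simp add: act_def)
    qed
  next
    fix i j k l assume ijkl: "i + j + k + l = 3 * n"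
    define z where "z = \<omega> ^ (j + 2 * k)"
    have z: "(\<omega>^m)^j * ((\<omega>^2)^m)^k = z ^ m" for m
      unfolding z_def power_mult[symmetric] power_add[symmetric] by (simp add: algebra_simps)
    have sum: "(\<Sum>g\<in>{..<3} \<times> UNIV. (Y (act g x) $ 1) ^ i * (Y (act g x) $ 2) ^ j *
        (Y (act g x) $ 3) ^ k * (Y (act g x) $ 4) ^ l) =
        (\<Sum>m<3. z ^ m) * (s x ^ i * \<delta> x ^ l * (p x ^ j * r x ^ k + (-1)^l * (z * (r x ^ j * p x ^ k))))" for x
    proof -
      have z1: "\<omega> ^ j * (\<omega>^2)^k = z" using z[of 1] by simp
      have "(s x) ^ i * (\<omega>^m * p x) ^ j * ((\<omega>^2)^m * r x) ^ k * (\<delta> x) ^ l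
          + (s x) ^ i * (\<omega>^m * (\<omega> * r x)) ^ j * ((\<omega>^2)^m * (\<omega>^2 * p x)) ^ k * (- \<delta> x) ^ l =
          ((\<omega>^m)^j * ((\<omega>^2)^m)^k) * (s x ^ i * \<delta> x ^ l *
            (p x ^ j * r x ^ k + (-1)^l * ((\<omega> ^ j * (\<omega>^2)^k) * (r x ^ j * p x ^ k))))" for m
        by (simp only: power_mult_distrib power_minus[of "\<delta> x" l]) (simp only: algebra_simps)
      then show ?thesis
        unfolding sum_times_bool YF YT vec4_nth z z1 sum_distrib_right by simp
    qed
    show "descends bring_cone \<Phi> n (\<lambda>x. \<Sum>g\<in>{..<3} \<times> UNIV. (Y (act g x) $ 1) ^ i * (Y (act g x) $ 2) ^ j *
        (Y (act g x) $ 3) ^ k * (Y (act g x) $ 4) ^ l)"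
    proof (cases "z = 1")
      case True
      then have "3 dvd j + 2 * k" unfolding z_def by (simp only: omega_power_eq_1[OF \<omega>])
      then show ?thesis unfolding sum True mult_1 by (intro descends_cmult mono ijkl)
    next
      case False
      have "z ^ 3 = (\<omega> ^ 3) ^ (j + 2 * k)"
        unfolding z_def power_mult[symmetric] by (simp add: mult.commute)
      then have "z ^ 3 = 1" by (simp add: \<omega>3)
      with False have "(\<Sum>m<3. z ^ m) = 0" using geometric_sum[OF False, of 3] by simp
      then show ?thesis unfolding sum by (simp add: descends_zero)
    qed
  qed (simp_all add: lessThan_empty_iff)
qed

section \<open>The quotients as Weierstrass cubics\<close>

lemma complex_rootE:
  fixes w :: complex
  assumes "0 < n"
  obtains z where "z ^ n = w"
proof (cases "w = 0")
  case True
  then show thesis using that[of 0] assms by simp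
next
  case False
  have "exp (Ln w / of_nat n) ^ n = exp (of_nat n * (Ln w / of_nat n))"
    by (simp only: exp_of_nat_mult)
  then show thesis using that[of "exp (Ln w / of_nat n)"] assms False by simp
qed

lemma descends_components:
  fixes X Y Z :: "complex ^ 'n \<Rightarrow> complex"
  shows "descends K (\<lambda>x. vector [X x, Y x, Z x] :: complex ^ 3) 1 X"
    "descends K (\<lambda>x. vector [X x, Y x, Z x] :: complex ^ 3) 1 Y"
    "descends K (\<lambda>x. vector [X x, Y x, Z x] :: complex ^ 3) 1 Z"
  using descends_coord[of K "\<lambda>x. vector [X x, Y x, Z x] :: complex ^ 3" 1]
    descends_coord[of K "\<lambda>x. vector [X x, Y x, Z x] :: complex ^ 3" 2]
    descends_coord[of K "\<lambda>x. vector [X x, Y x, Z x] :: complex ^ 3" 3] by simp_all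

text \<open>
  The cubic \<open>h\<^sub>3(x, y, z) = 0\<close> has a flex at \<open>(1, -1, 0)\<close> with tangent \<open>l = 0\<close>. Sending the flex to infinity
  and depressing the cubic gives the coordinates \<open>20 (x + y) - 35 l / 3\<close>, \<open>20 (x - y)\<close> and \<open>l\<close>. The last
  factor on the right is \<open>6 h\<^sub>3\<close>.
\<close>

lemma weierstrass_identity_12:
  fixes x y z :: complex
  defines "l \<equiv> 2 * (x + y) + z"
  shows "(20 * (x - y))^2 * l - ((20 * (x + y) - (35/3) * l)^3 + (-25/3) * (20 * (x + y) - (35/3) * l) * l^2
      + (-2950/27) * l^3) =
    (800/3) * ((x + y + z)^3 + 3 * (x + y + z) * (x^2 + y^2 + z^2) + 2 * (x^3 + y^3 + z^3))"
  unfolding l_def by Groebner_Basis.algebra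

lemma bring_quotient_12:
  "bring_quotient {cycle_of_list [1, 2]} \<cong>\<^sub>v weierstrass_curve (-25/3) (-2950/27)"
proof -
  define X Y Z :: "complex ^ 5 \<Rightarrow> complex"
    where "X x = 20 * (x $ 3 + x $ 4) - (35/3) * (2 * (x $ 3 + x $ 4) + x $ 5)"
      and "Y x = 20 * (x $ 3 - x $ 4)" and "Z x = 2 * (x $ 3 + x $ 4) + x $ 5" for x
  let ?\<Phi> = "\<lambda>x. vector [X x, Y x, Z x] :: complex ^ 3"
  note XYZ = descends_components[of bring_cone X Y Z]
  show ?thesis
  proof (rule bring_quotient_weierstrass[where e = 1 and M = 1 and X = X and Y = Y and Z = Z])
    show "hom_poly 1 X" "hom_poly 1 Y" "hom_poly 1 Z"
      unfolding X_def Y_def Z_def by (intro hom_poly_intros)+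
    show "bij g" if "g \<in> {cycle_of_list [1, 2] :: 5 \<Rightarrow> 5}" for g
      using that bij_cycle by auto
    show "\<exists>c. c \<noteq> 0 \<and> (\<forall>x\<in>bring_cone. X (perm_coords g x) = c * X x \<and>
        Y (perm_coords g x) = c * Y x \<and> Z (perm_coords g x) = c * Z x)"
      if "g \<in> {cycle_of_list [1, 2]}" for g
    proof -
      have "perm_coords g x = vec5 (x $ 2) (x $ 1) (x $ 3) (x $ 4) (x $ 5)" for x
        using that perm_coords_cycles(1) by (simp del: cycle_of_list.simps)
      then show ?thesis by (intro exI[of _ 1]) (simp add: X_def Y_def Z_def)
    qed
    show "descends bring_cone ?\<Phi> k F"
      if F: "hom_poly (1 * k) F" and inv: "\<And>g x. g \<in> {cycle_of_list [1, 2]} \<Longrightarrow> x \<in> bring_cone \<Longrightarrow>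
        F (perm_coords g x) = F x" for k F
    proof (rule descent_12)
      have "descends bring_cone ?\<Phi> 1 (\<lambda>x. (1/40) * X x + (7/24) * Z x + (1/40) * Y x)"
        by (intro descends_add descends_cmult XYZ)
      then show "descends bring_cone ?\<Phi> 1 (\<lambda>x. x $ 3)"
        by (rule descends_cong) (simp add: X_def Y_def Z_def field_simps)
      have "descends bring_cone ?\<Phi> 1 (\<lambda>x. (1/40) * X x + (7/24) * Z x - (1/40) * Y x)"
        by (intro descends_add descends_diff descends_cmult XYZ)
      then show "descends bring_cone ?\<Phi> 1 (\<lambda>x. x $ 4)"
        by (rule descends_cong) (simp add: X_def Y_def Z_def field_simps)
      have "descends bring_cone ?\<Phi> 1 (\<lambda>x. (-1/6) * Z x - (1/10) * X x)"
        by (intro descends_diff descends_cmult XYZ)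
      then show "descends bring_cone ?\<Phi> 1 (\<lambda>x. x $ 5)"
        by (rule descends_cong) (simp add: X_def Y_def Z_def field_simps)
      show "hom_poly k F" using F by simp
      show "F (perm_coords (cycle_of_list [1, 2]) x) = F x" if "x \<in> bring_cone" for x
        using inv that by blast
    qed
  next
    fix x assume x: "x \<in> bring_cone"
    show "(Y x)^2 * Z x = (X x)^3 + (-25/3) * X x * (Z x)^2 + (-2950/27) * (Z x)^3"
      using weierstrass_identity_12[of "x $ 3" "x $ 4" "x $ 5"]
      unfolding bring_cone_h3[OF x] X_def Y_def Z_def
      by (simp only: mult_zero_right right_minus_eq)
  next
    fix u v w :: complex
    assume uvw: "v^2 * w = u^3 + (-25/3) * u * w^2 + (-2950/27) * w^3"
    define s where "s = (1/20) * (u + (35/3) * w)"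
    define x y z where "x = (1/2) * (s + (1/20) * v)" and "y = (1/2) * (s - (1/20) * v)" and "z = w - 2 * s"
    have xyz: "x + y = s" "20 * (x - y) = v" "2 * (x + y) + z = w" "20 * (x + y) - (35/3) * w = u"
      by (simp_all add: x_def y_def z_def s_def field_simps)
    define h where "h = x + y + z"
    define p2 p3 where "p2 = x^2 + y^2 + z^2" and "p3 = x^3 + y^3 + z^3"
    have "(800/3) * (h^3 + 3 * h * p2 + 2 * p3) = v^2 * w - (u^3 + (-25/3) * u * w^2 + (-2950/27) * w^3)"
      using weierstrass_identity_12[of x y z, unfolded xyz(2-4)] unfolding h_def p2_def p3_def by (rule sym)
    then have h3: "h^3 + 3 * h * p2 + 2 * p3 = 0" unfolding uvw by (simp only: diff_self mult_eq_0_iff) simp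
    define d where "d = csqrt (- (h^2) - 2 * p2)"
    have d: "d^2 = - (h^2) - 2 * p2" unfolding d_def by (rule power2_csqrt)
    define x1 x2 where "x1 = (1/2) * (d - h)" and "x2 = (1/2) * (- d - h)"
    have "2 * x1 = d - h" "2 * x2 = - d - h" by (simp_all add: x1_def x2_def)
    then have "x1 + x2 + h = 0" "2 * (x1^2 + x2^2 + p2) = 0" "4 * (x1^3 + x2^3 + p3) = 0"
      using d h3 by Groebner_Basis.algebra+
    then have "x1 + x2 + h = 0" "x1^2 + x2^2 + p2 = 0" "x1^3 + x2^3 + p3 = 0"
      by (simp_all only: mult_eq_0_iff) simp_all
    then have "vec5 x1 x2 x y z \<in> bring_cone"
      by (simp add: bring_cone_iff h_def p2_def p3_def add.assoc)
    then show "\<exists>x\<in>bring_cone. X x = u \<and> Y x = v \<and> Z x = w"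
      by (rule bexI[rotated]) (unfold X_def Y_def Z_def vec5_nth xyz(2-4), simp)
  qed simp_all
qed

lemma bring_cone_of_chi:
  assumes "c^2 + d^2 + e^2 = - 5 * t^2" "c * d * e = - 5 * t^3"
  obtains x where "x \<in> bring_cone" "chi1 x = c" "chi2 x = d" "chi3 x = e" "x $ 5 = t"
proof
  let ?x = "vec5 (1/4 * (c + d + e - t)) (1/4 * (c - d - e - t)) (1/4 * (d - c - e - t)) (1/4 * (e - c - d - t)) t"
  show "chi1 ?x = c" "chi2 ?x = d" "chi3 ?x = e" "?x $ 5 = t"
    by (simp_all add: chi1_def chi2_def chi3_def field_simps)
  define x1 x2 x3 x4 where "x1 = 1/4 * (c + d + e - t)" and "x2 = 1/4 * (c - d - e - t)"
    and "x3 = 1/4 * (d - c - e - t)" and "x4 = 1/4 * (e - c - d - t)"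
  have "4 * x1 = c + d + e - t" "4 * x2 = c - d - e - t" "4 * x3 = d - c - e - t" "4 * x4 = e - c - d - t"
    by (simp_all add: x1_def x2_def x3_def x4_def)
  then have "4 * (x1 + x2 + x3 + x4 + t) = 0" "16 * (x1^2 + x2^2 + x3^2 + x4^2 + t^2) = 0"
    "64 * (x1^3 + x2^3 + x3^3 + x4^3 + t^3) = 0"
    using assms by Groebner_Basis.algebra+
  then show "?x \<in> bring_cone"
    unfolding x1_def[symmetric] x2_def[symmetric] x3_def[symmetric] x4_def[symmetric]
    by (simp only: mult_eq_0_iff bring_cone_iff vec5_nth) simp
qed

text \<open>
  The line \<open>C = 0\<close> meets \<open>5 C D E + (C + D + E)\<^sup>3 = 0\<close> in a triple point, so it is a flex tangent and
  becomes the line at infinity.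
\<close>

lemma weierstrass_identity_klein:
  fixes C D E :: complex
  defines "s \<equiv> C + D + E"
  shows "(100 * (D - E))^2 * C - ((20 * s + (25/3) * C)^3 + (-3625/3) * (20 * s + (25/3) * C) * C^2
      + (526250/27) * C^3) = - 8000 * (5 * C * D * E + s^3)"
  unfolding s_def by Groebner_Basis.algebra

lemma bring_quotient_klein:
  "bring_quotient {cycle_of_list [1, 2] \<circ> cycle_of_list [3, 4], cycle_of_list [1, 3] \<circ> cycle_of_list [2, 4]}
    \<cong>\<^sub>v weierstrass_curve (-3625/3) (526250/27)"
proof -
  define X Y Z :: "complex ^ 5 \<Rightarrow> complex"
    where "X x = 20 * ((chi1 x)^2 + (chi2 x)^2 + (chi3 x)^2) + (25/3) * (chi1 x)^2"
      and "Y x = 100 * ((chi2 x)^2 - (chi3 x)^2)" and "Z x = (chi1 x)^2" for x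
  let ?S = "{cycle_of_list [1, 2] \<circ> cycle_of_list [3, 4], cycle_of_list [1, 3] \<circ> cycle_of_list [2, 4]} :: (5 \<Rightarrow> 5) set"
  let ?\<Phi> = "\<lambda>x. vector [X x, Y x, Z x] :: complex ^ 3"
  note XYZ = descends_components[of bring_cone X Y Z]
  show ?thesis
  proof (rule bring_quotient_weierstrass[where e = 2 and M = 1 and X = X and Y = Y and Z = Z])
    show "hom_poly 2 X" "hom_poly 2 Y" "hom_poly 2 Z"
      unfolding X_def Y_def Z_def chi1_def chi2_def chi3_def by (intro hom_poly_intros)+
    show "bij g" if "g \<in> ?S" for g
      using that bij_comp[OF bij_cycle bij_cycle] by blast
    show "\<exists>c. c \<noteq> 0 \<and> (\<forall>x\<in>bring_cone. X (perm_coords g x) = c * X x \<and>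
        Y (perm_coords g x) = c * Y x \<and> Z (perm_coords g x) = c * Z x)"
      if "g \<in> ?S" for g
    proof -
      have "(chi1 (perm_coords g x))^2 = (chi1 x)^2 \<and> (chi2 (perm_coords g x))^2 = (chi2 x)^2 \<and>
          (chi3 (perm_coords g x))^2 = (chi3 x)^2" for x
        using that
      proof (elim insertE emptyE)
        assume g: "g = cycle_of_list [1, 2] \<circ> cycle_of_list [3, 4]"
        show ?thesis
          unfolding g perm_coords_cycles chi1_def chi2_def chi3_def vec5_nth
          by (intro conjI) Groebner_Basis.algebra+
      next
        assume g: "g = cycle_of_list [1, 3] \<circ> cycle_of_list [2, 4]"
        show ?thesis
          unfolding g perm_coords_cycles chi1_def chi2_def chi3_def vec5_nth
          by (intro conjI) Groebner_Basis.algebra+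
      qed
      then show ?thesis by (intro exI[of _ 1]) (simp add: X_def Y_def Z_def)
    qed
    show "descends bring_cone ?\<Phi> k F"
      if F: "hom_poly (2 * k) F" and inv: "\<And>g x. g \<in> ?S \<Longrightarrow> x \<in> bring_cone \<Longrightarrow>
        F (perm_coords g x) = F x" for k F
    proof (rule descent_klein[OF _ _ _ F])
      show "descends bring_cone ?\<Phi> 1 (\<lambda>x. (chi1 x)^2)"
        using XYZ(3) by (rule descends_cong) (simp add: Z_def)
      have "descends bring_cone ?\<Phi> 1 (\<lambda>x. (1/40) * X x - (17/24) * Z x + (1/200) * Y x)"
        by (intro descends_add descends_diff descends_cmult XYZ)
      then show "descends bring_cone ?\<Phi> 1 (\<lambda>x. (chi2 x)^2)"
        by (rule descends_cong) (simp add: X_def Y_def Z_def field_simps)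
      have "descends bring_cone ?\<Phi> 1 (\<lambda>x. (1/40) * X x - (17/24) * Z x - (1/200) * Y x)"
        by (intro descends_add descends_diff descends_cmult XYZ)
      then show "descends bring_cone ?\<Phi> 1 (\<lambda>x. (chi3 x)^2)"
        by (rule descends_cong) (simp add: X_def Y_def Z_def field_simps)
    qed (use inv in blast)+
  next
    fix x assume x: "x \<in> bring_cone"
    have "5 * (chi1 x)^2 * (chi2 x)^2 * (chi3 x)^2 + ((chi1 x)^2 + (chi2 x)^2 + (chi3 x)^2)^3 = 0"
      using bring_cone_chi[OF x] by Groebner_Basis.algebra
    then show "(Y x)^2 * Z x = (X x)^3 + (-3625/3) * X x * (Z x)^2 + (526250/27) * (Z x)^3"
      using weierstrass_identity_klein[of "(chi2 x)^2" "(chi3 x)^2" "(chi1 x)^2"]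
      unfolding X_def Y_def Z_def by simp
  next
    fix u v w :: complex
    assume uvw: "v^2 * w = u^3 + (-3625/3) * u * w^2 + (526250/27) * w^3"
    define s where "s = (1/20) * (u - (25/3) * w)"
    define D E where "D = (1/2) * (s - w + (1/100) * v)" and "E = (1/2) * (s - w - (1/100) * v)"
    have DE: "w + D + E = s" "100 * (D - E) = v" "20 * s + (25/3) * w = u"
      by (simp_all add: D_def E_def s_def field_simps)
    have "- 8000 * (5 * w * D * E + s^3) = v^2 * w - (u^3 + (-3625/3) * u * w^2 + (526250/27) * w^3)"
      using weierstrass_identity_klein[of D E w] unfolding DE by (rule sym)
    then have rel: "5 * w * D * E + s^3 = 0" unfolding uvw by (simp only: diff_self mult_eq_0_iff) simp
    define c d e t where "c = csqrt w" and "d = csqrt D" and "e = csqrt E" and "t = csqrt ((-1/5) * s)"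
    have sq: "c^2 = w" "d^2 = D" "e^2 = E" "t^2 = (-1/5) * s"
      by (simp_all only: c_def d_def e_def t_def power2_csqrt)
    have s: "s = - 5 * t^2" using sq(4) by simp
    have "25 * ((c * d * e)^2 - (5 * t^3)^2) = 0"
      using rel sq(1-3) s by Groebner_Basis.algebra
    then have "(c * d * e)^2 = (5 * t^3)^2" by simp
    then have "c * d * e = 5 * t^3 \<or> c * d * e = - (5 * t^3)" by (simp only: power2_eq_iff)
    then obtain c' where c': "c'^2 = w" "c' * d * e = - 5 * t^3"
    proof
      assume "c * d * e = 5 * t^3"
      then show thesis using that[of "- c"] sq(1) by simp
    next
      assume "c * d * e = - (5 * t^3)"
      then show thesis using that[of c] sq(1) by simp
    qed
    have "c'^2 + d^2 + e^2 = - 5 * t^2" using c' sq DE(1) s by simp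
    then obtain x where x: "x \<in> bring_cone" "chi1 x = c'" "chi2 x = d" "chi3 x = e"
      using c'(2) by (rule bring_cone_of_chi)
    have "X x = u \<and> Y x = v \<and> Z x = w"
      unfolding X_def Y_def Z_def x c' sq DE by simp
    then show "\<exists>x\<in>bring_cone. X x = u \<and> Y x = v \<and> Z x = w" using x(1) by blast
  qed simp_all
qed

text \<open>
  With \<open>Q = t c\<close> and \<open>R = a b\<close> the image of \<open>(D, Q, R)\<close> is the cubic
  \<open>16 R\<^sup>2 D = -5 Q\<^sup>3 + 10 Q\<^sup>2 D - 5 Q D\<^sup>2 - 4 D\<^sup>3\<close>, which is in Weierstrass form up to the shift and the
  scaling that enter \<open>X, Y, Z\<close>. To lift a point one solves for \<open>t\<close> by a fourth root, for \<open>c\<close> from \<open>t c = Q\<close>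
  unless \<open>t = 0\<close>, and for \<open>a \<plusminus> i b\<close> by square roots.
\<close>

lemma bring_quotient_1324:
  "bring_quotient {cycle_of_list [1, 3, 2, 4]} \<cong>\<^sub>v weierstrass_curve (-25/3) (-2950/27)"
proof -
  define X Y Z :: "complex ^ 5 \<Rightarrow> complex"
    where "X x = (-5) * (x $ 5 * chi1 x) + (10/3) * (chi2 x * chi3 x)"
      and "Y x = (-20) * ((x $ 1 - x $ 2) * (x $ 3 - x $ 4))" and "Z x = chi2 x * chi3 x" for x
  let ?\<Phi> = "\<lambda>x. vector [X x, Y x, Z x] :: complex ^ 3"
  note XYZ = descends_components[of bring_cone X Y Z]
  show ?thesis
  proof (rule bring_quotient_weierstrass[where e = 2 and M = 2 and X = X and Y = Y and Z = Z])
    show "hom_poly 2 X" "hom_poly 2 Y" "hom_poly 2 Z"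
      unfolding X_def Y_def Z_def chi1_def chi2_def chi3_def by (intro hom_poly_intros)+
    show "bij g" if "g \<in> {cycle_of_list [1, 3, 2, 4] :: 5 \<Rightarrow> 5}" for g
      using that bij_cycle by blast
    show "\<exists>c. c \<noteq> 0 \<and> (\<forall>x\<in>bring_cone. X (perm_coords g x) = c * X x \<and>
        Y (perm_coords g x) = c * Y x \<and> Z (perm_coords g x) = c * Z x)"
      if "g \<in> {cycle_of_list [1, 3, 2, 4]}" for g
    proof -
      have g: "g = cycle_of_list [1, 3, 2, 4]" using that by blast
      have "X (perm_coords g x) = (-1) * X x \<and> Y (perm_coords g x) = (-1) * Y x \<and>
          Z (perm_coords g x) = (-1) * Z x" for x
        unfolding g perm_coords_cycles X_def Y_def Z_def chi1_def chi2_def chi3_def vec5_nth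
        by (intro conjI) Groebner_Basis.algebra+
      then show ?thesis by (intro exI[of _ "-1"]) simp
    qed
    show "descends bring_cone ?\<Phi> k F"
      if F: "hom_poly (2 * k) F" and k: "2 dvd k"
        and inv: "\<And>g x. g \<in> {cycle_of_list [1, 3, 2, 4]} \<Longrightarrow> x \<in> bring_cone \<Longrightarrow>
        F (perm_coords g x) = F x" for k F
    proof (rule descent_1324[OF _ _ _ F k])
      show "descends bring_cone ?\<Phi> 1 (\<lambda>x. (x $ 1 - x $ 2)^2 - (x $ 3 - x $ 4)^2)"
        using XYZ(3) by (rule descends_cong) (simp add: Z_def chi2_def chi3_def power2_eq_square algebra_simps)
      have "descends bring_cone ?\<Phi> 1 (\<lambda>x. (2/3) * Z x - (1/5) * X x)"
        by (intro descends_diff descends_cmult XYZ)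
      then show "descends bring_cone ?\<Phi> 1 (\<lambda>x. x $ 5 * chi1 x)"
        by (rule descends_cong) (simp add: X_def Z_def field_simps)
      have "descends bring_cone ?\<Phi> 1 (\<lambda>x. (-1/20) * Y x)"
        by (intro descends_cmult XYZ)
      then show "descends bring_cone ?\<Phi> 1 (\<lambda>x. (x $ 1 - x $ 2) * (x $ 3 - x $ 4))"
        by (rule descends_cong) (simp add: Y_def)
    qed (use inv in blast)
  next
    fix x assume x: "x \<in> bring_cone"
    define a b c t D where "a = x $ 1 - x $ 2" and "b = x $ 3 - x $ 4" and "c = chi1 x"
      and "t = x $ 5" and "D = chi2 x * chi3 x"
    have chi: "chi2 x = a + b" "chi3 x = a - b" by (simp_all add: a_def b_def chi2_def chi3_def)
    have D: "D = a^2 - b^2" unfolding D_def chi by Groebner_Basis.algebra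
    have rel1: "c^2 + 5 * t^2 + 2 * (a^2 + b^2) = 0"
      using bring_cone_chi(1)[OF x] unfolding chi c_def[symmetric] t_def[symmetric]
      by Groebner_Basis.algebra
    have rel2: "c * D = - 5 * t^3"
      using bring_cone_chi(2)[OF x] unfolding D_def c_def t_def by (simp add: mult.assoc)
    have "27 * ((-20 * (a * b))^2 * D) = 27 * ((-5 * (t * c) + (10/3) * D)^3 +
        (-25/3) * (-5 * (t * c) + (10/3) * D) * D^2 + (-2950/27) * D^3)"
    proof -
      have "4 * ((a^2 + b^2)^2) = (c^2 + 5 * t^2)^2" using rel1 by Groebner_Basis.algebra
      moreover have "(a^2 + b^2)^2 = D^2 + 4 * (a * b)^2" unfolding D by Groebner_Basis.algebra
      ultimately have S: "16 * (a * b)^2 = (c^2 + 5 * t^2)^2 - 4 * D^2" by Groebner_Basis.algebra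
      have "400 * (a * b)^2 * D = 25 * D * ((c^2 + 5 * t^2)^2 - 4 * D^2)"
        using S by Groebner_Basis.algebra
      also have "\<dots> = - 125 * (t * c)^3 + 250 * (t * c)^2 * D - 125 * (t * c) * D^2 - 100 * D^3"
        using rel2 by Groebner_Basis.algebra
      finally show ?thesis by Groebner_Basis.algebra
    qed
    then have "(-20 * (a * b))^2 * D = (-5 * (t * c) + (10/3) * D)^3 +
        (-25/3) * (-5 * (t * c) + (10/3) * D) * D^2 + (-2950/27) * D^3"
      by (metis mult_left_cancel zero_neq_numeral)
    then show "(Y x)^2 * Z x = (X x)^3 + (-25/3) * X x * (Z x)^2 + (-2950/27) * (Z x)^3"
      unfolding X_def Y_def Z_def a_def b_def c_def t_def D_def .
  next
    fix u v D :: complex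
    assume uvD: "v^2 * D = u^3 + (-25/3) * u * D^2 + (-2950/27) * D^3"
    define Q R where "Q = (-1/5) * (u - (10/3) * D)" and "R = (-1/20) * v"
    have uv: "u = (-5) * Q + (10/3) * D" "v = (-20) * R" by (simp_all add: Q_def R_def field_simps)
    have rel: "16 * R^2 * D + 4 * D^3 = - 5 * Q^3 + 10 * Q^2 * D - 5 * Q * D^2"
      using uvD unfolding uv by Groebner_Basis.algebra
    obtain t where "t^4 = (-1/5) * (D * Q)" by (rule complex_rootE[of 4], simp, erule that)
    then have t: "D * Q = - 5 * t^4" by simp
    \<comment> \<open>The last condition makes \<open>-(c\<^sup>2 + 5 t\<^sup>2) / 2\<close> a possible value of \<open>p r\<close>, given \<open>p\<^sup>2\<close> and \<open>r\<^sup>2\<close>.\<close>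
    have "\<exists>c. t * c = Q \<and> c * D = - 5 * t^3 \<and> (c^2 + 5 * t^2)^2 = 4 * D^2 + 16 * R^2"
    proof (cases "t = 0")
      case True
      then have DQ: "D = 0 \<or> Q = 0" using t by simp
      obtain c where c: "c^4 = 4 * D^2 + 16 * R^2" by (rule complex_rootE[of 4], simp, erule that)
      show ?thesis
      proof (cases "D = 0")
        case D: True
        with rel have "Q = 0" by simp
        with D c True show ?thesis by (intro exI[of _ c]) (simp flip: power_mult)
      next
        case D: False
        with DQ have Q: "Q = 0" by simp
        with rel have "4 * D * (4 * R^2 + D^2) = 0" by Groebner_Basis.algebra
        with D have "4 * R^2 + D^2 = 0" by simp
        then have "4 * D^2 + 16 * R^2 = 0" by Groebner_Basis.algebra
        with Q True show ?thesis by (intro exI[of _ 0]) simp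
      qed
    next
      case False
      with t have D: "D \<noteq> 0" by auto
      define c where "c = Q / t"
      have tc: "t * c = Q" using False by (simp add: c_def)
      have "t * (c * D) = t * (- 5 * t^3)" using t tc by Groebner_Basis.algebra
      then have cD: "c * D = - 5 * t^3" by (metis mult_left_cancel False)
      have "D * (c^2 + 5 * t^2)^2 = D * (4 * D^2 + 16 * R^2)"
        using rel tc cD by Groebner_Basis.algebra
      then have "(c^2 + 5 * t^2)^2 = 4 * D^2 + 16 * R^2" by (metis mult_left_cancel D)
      with tc cD show ?thesis by blast
    qed
    then obtain c where c: "t * c = Q" "c * D = - 5 * t^3" "(c^2 + 5 * t^2)^2 = 4 * D^2 + 16 * R^2"
      by blast
    define S where "S = (-1/2) * (c^2 + 5 * t^2)"
    have S: "c^2 + 5 * t^2 = - 2 * S" by (simp add: S_def field_simps)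
    have S2: "S^2 = D^2 + 4 * R^2"
    proof -
      have "4 * S^2 = 4 * (D^2 + 4 * R^2)" using c(3) unfolding S by Groebner_Basis.algebra
      then show ?thesis by (metis mult_left_cancel zero_neq_numeral)
    qed
    have ii: "\<i>^2 = -1" by simp
    define p where "p = csqrt (D + 2 * \<i> * R)"
    have p: "p^2 = D + 2 * \<i> * R" unfolding p_def by (rule power2_csqrt)
    have "\<exists>r. r^2 = D - 2 * \<i> * R \<and> p * r = S"
    proof (cases "p = 0")
      case True
      then have "S^2 = 0" using p S2 ii by Groebner_Basis.algebra
      with True show ?thesis by (intro exI[of _ "csqrt (D - 2 * \<i> * R)"]) simp
    next
      case False
      define r where "r = S / p"
      have pr: "p * r = S" using False by (simp add: r_def)
      have "p^2 * r^2 = S^2" by (simp add: pr[symmetric] power_mult_distrib)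
      also have "\<dots> = (D + 2 * \<i> * R) * (D - 2 * \<i> * R)"
        unfolding S2 by (simp add: algebra_simps power2_eq_square)
      finally have "p^2 * r^2 = p^2 * (D - 2 * \<i> * R)" unfolding p .
      then have "r^2 = D - 2 * \<i> * R" using False by (metis mult_left_cancel power_not_zero)
      with pr show ?thesis by blast
    qed
    then obtain r where r: "r^2 = D - 2 * \<i> * R" "p * r = S" by blast
    define a b where "a = (1/2) * (p + r)" and "b = (-1/2) * (\<i> * (p - r))"
    have ab: "2 * a = p + r" "2 * b = - \<i> * (p - r)" by (simp_all add: a_def b_def)
    have "4 * (a^2 - b^2) = 4 * D" "4 * (a^2 + b^2) = 4 * S" "4 * (a * b) = 4 * R"
      using ab p r ii by Groebner_Basis.algebra+
    then have ab2: "a^2 - b^2 = D" "a^2 + b^2 = S" "a * b = R"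
      by (metis mult_left_cancel zero_neq_numeral)+
    have D: "(a + b) * (a - b) = D"
      unfolding ab2(1)[symmetric] by (simp add: power2_eq_square algebra_simps)
    have "c^2 + (a + b)^2 + (a - b)^2 = (c^2 + 5 * t^2) + 2 * (a^2 + b^2) - 5 * t^2"
      by Groebner_Basis.algebra
    also have "\<dots> = - 5 * t^2" unfolding S ab2(2) by simp
    finally have "c^2 + (a + b)^2 + (a - b)^2 = - 5 * t^2" .
    moreover have "c * (a + b) * (a - b) = - 5 * t^3" unfolding mult.assoc D c(2) ..
    ultimately obtain x where x: "x \<in> bring_cone" "chi1 x = c" "chi2 x = a + b" "chi3 x = a - b" "x $ 5 = t"
      by (rule bring_cone_of_chi)
    have "2 * (x $ 1 - x $ 2) = 2 * a" "2 * (x $ 3 - x $ 4) = 2 * b"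
      using x(3,4) unfolding chi2_def chi3_def by Groebner_Basis.algebra+
    then have xab: "x $ 1 - x $ 2 = a" "x $ 3 - x $ 4 = b"
      by (metis mult_left_cancel zero_neq_numeral)+
    have "X x = u \<and> Y x = v \<and> Z x = D"
      unfolding X_def Y_def Z_def xab x D uv by (simp add: c(1) ab2(3))
    then show "\<exists>x\<in>bring_cone. X x = u \<and> Y x = v \<and> Z x = D" using x(1) by blast
  qed simp_all
qed

text \<open>
  In terms of \<open>s\<^sup>2 \<delta>, \<Delta>, \<delta>\<^sup>3\<close> the formula for \<open>\<Delta>\<^sup>2\<close>, multiplied by \<open>\<delta>\<^sup>3\<close>, is a cubic in Weierstrass form up to
  shift and scaling; the scaling is chosen so that it is the cubic of the Klein quotient. To lift a
  point one finds \<open>\<delta>\<close> and \<open>s\<close> by roots and then \<open>x\<^sub>3, x\<^sub>4, x\<^sub>5\<close> by Cardano's formula, in which the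
  prescribed value of \<open>\<Delta>\<close> decides between the two resolvents.
\<close>

lemma bring_quotient_S3:
  "bring_quotient {cycle_of_list [1, 2] \<circ> cycle_of_list [3, 4], cycle_of_list [3, 4, 5]}
    \<cong>\<^sub>v weierstrass_curve (-3625/3) (526250/27)"
proof -
  define X Y Z :: "complex ^ 5 \<Rightarrow> complex"
    where "X x = (-50) * ((sum345 x)^2 * diff12 x) + (-125/3) * (diff12 x)^3"
      and "Y x = 200 * vandermonde345 x" and "Z x = (diff12 x)^3" for x
  let ?S = "{cycle_of_list [1, 2] \<circ> cycle_of_list [3, 4], cycle_of_list [3, 4, 5]} :: (5 \<Rightarrow> 5) set"
  let ?\<Phi> = "\<lambda>x. vector [X x, Y x, Z x] :: complex ^ 3"
  note XYZ = descends_components[of bring_cone X Y Z]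
  have cubic: "v^2 * d^3 - (u^3 + (-3625/3) * u * (d^3)^2 + (526250/27) * (d^3)^3) =
      (-2500) * d^3 * (- 16 * V^2 - (d^6 + 80 * s^2 * d^4 + 125 * s^4 * d^2 + 50 * s^6))"
    if "u = (-50) * (s^2 * d) + (-125/3) * d^3" "v = 200 * V" for u v s d V :: complex
    unfolding that by Groebner_Basis.algebra
  show ?thesis
  proof (rule bring_quotient_weierstrass[where e = 3 and M = 2 and X = X and Y = Y and Z = Z])
    show "hom_poly 3 X" "hom_poly 3 Y" "hom_poly 3 Z"
      unfolding X_def Y_def Z_def sum345_def diff12_def vandermonde345_def by (intro hom_poly_intros)+
    show "bij g" if "g \<in> ?S" for g
      using that bij_comp[OF bij_cycle bij_cycle] bij_cycle by blast
    show "\<exists>c. c \<noteq> 0 \<and> (\<forall>x\<in>bring_cone. X (perm_coords g x) = c * X x \<and>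
        Y (perm_coords g x) = c * Y x \<and> Z (perm_coords g x) = c * Z x)"
      if "g \<in> ?S" for g
      using that
    proof (elim insertE emptyE)
      assume g: "g = cycle_of_list [1, 2] \<circ> cycle_of_list [3, 4]"
      have "X (perm_coords g x) = (-1) * X x \<and> Y (perm_coords g x) = (-1) * Y x \<and>
          Z (perm_coords g x) = (-1) * Z x" for x
        unfolding g perm_coords_cycles X_def Y_def Z_def sum345_def diff12_def vandermonde345_def vec5_nth
        by (intro conjI) Groebner_Basis.algebra+
      then show ?thesis by (intro exI[of _ "-1"]) simp
    next
      assume g: "g = cycle_of_list [3, 4, 5]"
      have "sum345 (perm_coords g x) = sum345 x \<and> diff12 (perm_coords g x) = diff12 x \<and>
          vandermonde345 (perm_coords g x) = vandermonde345 x" for x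
        unfolding g perm_coords_cycles sum345_def diff12_def vandermonde345_def vec5_nth
        by (simp add: algebra_simps)
      then show ?thesis by (intro exI[of _ 1]) (simp add: X_def Y_def Z_def)
    qed
    show "descends bring_cone ?\<Phi> k F"
      if F: "hom_poly (3 * k) F" and k: "2 dvd k" and inv: "\<And>g x. g \<in> ?S \<Longrightarrow> x \<in> bring_cone \<Longrightarrow>
        F (perm_coords g x) = F x" for k F
    proof (rule descent_S3[OF _ _ _ F k])
      have "descends bring_cone ?\<Phi> 1 (\<lambda>x. (-1/50) * X x - (5/6) * Z x)"
        by (intro descends_diff descends_cmult XYZ)
      then show "descends bring_cone ?\<Phi> 1 (\<lambda>x. (sum345 x)^2 * diff12 x)"
        by (rule descends_cong) (simp add: X_def Z_def field_simps)
      have "descends bring_cone ?\<Phi> 1 (\<lambda>x. (1/200) * Y x)"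
        by (intro descends_cmult XYZ)
      then show "descends bring_cone ?\<Phi> 1 vandermonde345"
        by (rule descends_cong) (simp add: Y_def)
      show "descends bring_cone ?\<Phi> 1 (\<lambda>x. (diff12 x)^3)"
        using XYZ(3) by (rule descends_cong) (simp add: Z_def)
    qed (use inv in blast)+
  next
    fix x assume x: "x \<in> bring_cone"
    have "- 16 * (vandermonde345 x)^2 - ((diff12 x)^6 + 80 * (sum345 x)^2 * (diff12 x)^4
        + 125 * (sum345 x)^4 * (diff12 x)^2 + 50 * (sum345 x)^6) = 0"
      using vandermonde345_square[OF x] by simp
    then show "(Y x)^2 * Z x = (X x)^3 + (-3625/3) * X x * (Z x)^2 + (526250/27) * (Z x)^3"
      using cubic[OF X_def Y_def, of x x] unfolding Z_def by simp
  next
    fix u v w :: complex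
    assume uvw: "v^2 * w = u^3 + (-3625/3) * u * w^2 + (526250/27) * w^3"
    define V where "V = (1/200) * v"
    have v: "v = 200 * V" by (simp add: V_def)
    obtain d where d: "d^3 = w" by (rule complex_rootE[of 3], simp, erule that)
    obtain s where s: "u = (-50) * (s^2 * d) + (-125/3) * d^3"
      "- 16 * V^2 = d^6 + 80 * s^2 * d^4 + 125 * s^4 * d^2 + 50 * s^6"
    proof (cases "d = 0")
      \<comment> \<open>At infinity \<open>u = 0\<close> for every \<open>s\<close>, which is then determined by the formula for \<open>\<Delta>\<^sup>2\<close>.\<close>
      case True
      then have "u = 0" using uvw d by simp
      moreover obtain s where "s^6 = (-16/50) * V^2" by (rule complex_rootE[of 6], simp, erule that)
      ultimately show thesis using that[of s] True by simp
    next
      case False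
      define s where "s = csqrt ((-1/50) * (u + (125/3) * w) / d)"
      have "s^2 = (-1/50) * (u + (125/3) * w) / d" unfolding s_def by (rule power2_csqrt)
      then have "s^2 * d = (-1/50) * (u + (125/3) * w)" using False by simp
      then have "(-50) * (s^2 * d) = u + (125/3) * w" by Groebner_Basis.algebra
      then have u: "u = (-50) * (s^2 * d) + (-125/3) * d^3" unfolding d by simp
      have "(-2500) * d^3 * (- 16 * V^2 - (d^6 + 80 * s^2 * d^4 + 125 * s^4 * d^2 + 50 * s^6)) =
          v^2 * d^3 - (u^3 + (-3625/3) * u * (d^3)^2 + (526250/27) * (d^3)^3)"
        by (rule cubic[OF u v, symmetric])
      also have "\<dots> = 0" unfolding d uvw by simp
      finally have "- 16 * V^2 - (d^6 + 80 * s^2 * d^4 + 125 * s^4 * d^2 + 50 * s^6) = 0"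
        by (simp only: mult_eq_0_iff) (simp add: False)
      then show thesis using that[of s] u by simp
    qed
    obtain \<omega> :: complex where \<omega>: "\<omega>^2 + \<omega> + 1 = 0" using omega_exists by blast
    define B C L where "B = (35/4) * s^3 + (45/4) * (s * d^2)" and "C = (-5/4) * s^2 + (-3/4) * d^2"
      and "L = 3 * (2 * \<omega> + 1) * V"
    have BC: "4 * B = 35 * s^3 + 45 * (s * d^2)" "4 * C = - 5 * s^2 - 3 * d^2"
      by (simp_all add: B_def C_def algebra_simps)
    have L2: "L^2 = - 27 * V^2" unfolding L_def using \<omega> by Groebner_Basis.algebra
    have "16 * (L^2 + 4 * C^3) = 16 * B^2"
      using s(2) BC unfolding L2 by Groebner_Basis.algebra
    then have disc: "L^2 + 4 * C^3 = B^2" by (metis mult_left_cancel zero_neq_numeral)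
    obtain p where "p^3 = (1/2) * (B + L)" by (rule complex_rootE[of 3], simp, erule that)
    then have p: "2 * p^3 = B + L" by (simp add: mult.commute)
    have "\<exists>r. p * r = C \<and> 2 * r^3 = B - L"
    proof (cases "p = 0")
      case True
      then have "B + L = 0" using p by simp
      with disc have "4 * C^3 = 0" by Groebner_Basis.algebra
      moreover obtain r where "r^3 = (1/2) * (B - L)" by (rule complex_rootE[of 3], simp, erule that)
      ultimately show ?thesis using True by (intro exI[of _ r]) (simp add: mult.commute)
    next
      case False
      define r where "r = C / p"
      have pr: "p * r = C" using False by (simp add: r_def)
      have "2 * p^3 * (2 * r^3) = 4 * (p * r)^3" by (simp add: power_mult_distrib)
      also have "\<dots> = B^2 - L^2" unfolding pr disc[symmetric] by simp
      also have "\<dots> = (B + L) * (B - L)" by (simp add: power2_eq_square algebra_simps)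
      finally have "2 * p^3 * (2 * r^3) = 2 * p^3 * (B - L)" unfolding p .
      moreover have "2 * p^3 \<noteq> 0" using False by simp
      ultimately have "2 * r^3 = B - L" by (metis mult_left_cancel)
      with pr show ?thesis by blast
    qed
    then obtain r where r: "p * r = C" "2 * r^3 = B - L" by blast
    define x1 x2 x3 x4 x5 where "x1 = (1/2) * (d - s)" and "x2 = (1/2) * (- d - s)"
      and "x3 = (1/3) * (s + p + r)" and "x4 = (1/3) * (s + \<omega>^2 * p + \<omega> * r)"
      and "x5 = (1/3) * (s + \<omega> * p + \<omega>^2 * r)"
    have x: "2 * x1 = d - s" "2 * x2 = - d - s" "3 * x3 = s + p + r"
      "3 * x4 = s + \<omega>^2 * p + \<omega> * r" "3 * x5 = s + \<omega> * p + \<omega>^2 * r"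
      by (simp_all add: x1_def x2_def x3_def x4_def x5_def)
    define x where "x = vec5 x1 x2 x3 x4 x5"
    have s12: "x1 + x2 = - s" "2 * (x1^2 + x2^2) = s^2 + d^2" "4 * (x1^3 + x2^3) = - (s^3) - 3 * (s * d^2)"
    proof -
      have "2 * (x1 + x2) = 2 * (- s)" using x(1,2) by Groebner_Basis.algebra
      then show "x1 + x2 = - s" by (metis mult_left_cancel zero_neq_numeral)
      have "2 * (2 * (x1^2 + x2^2)) = 2 * (s^2 + d^2)" using x(1,2) by Groebner_Basis.algebra
      then show "2 * (x1^2 + x2^2) = s^2 + d^2" by (metis mult_left_cancel zero_neq_numeral)
      have "2 * (4 * (x1^3 + x2^3)) = 2 * (- (s^3) - 3 * (s * d^2))" using x(1,2) by Groebner_Basis.algebra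
      then show "4 * (x1^3 + x2^3) = - (s^3) - 3 * (s * d^2)" by (metis mult_left_cancel zero_neq_numeral)
    qed
    have s345: "x3 + x4 + x5 = s" "3 * (x3^2 + x4^2 + x5^2) = s^2 + 2 * C"
      "9 * (x3^3 + x4^3 + x5^3) = s^3 + B + 6 * (s * C)"
    proof -
      have "3 * (x3 + x4 + x5) = 3 * s" using x(3-5) \<omega> by Groebner_Basis.algebra
      then show "x3 + x4 + x5 = s" by (metis mult_left_cancel zero_neq_numeral)
      have "3 * (3 * (x3^2 + x4^2 + x5^2)) = (3 * x3)^2 + (3 * x4)^2 + (3 * x5)^2"
        by Groebner_Basis.algebra
      also have "\<dots> = 3 * (s^2 + 2 * (p * r))"
        unfolding x using \<omega> by Groebner_Basis.algebra
      finally show "3 * (x3^2 + x4^2 + x5^2) = s^2 + 2 * C"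
        unfolding r(1) by (metis mult_left_cancel zero_neq_numeral)
      have "2 * (p^3 + r^3) = 2 * B" using p r(2) by Groebner_Basis.algebra
      then have B: "p^3 + r^3 = B" by (metis mult_left_cancel zero_neq_numeral)
      have "3 * (9 * (x3^3 + x4^3 + x5^3)) = (3 * x3)^3 + (3 * x4)^3 + (3 * x5)^3"
        by Groebner_Basis.algebra
      also have "\<dots> = 3 * (s^3 + (p^3 + r^3) + 6 * (s * (p * r)))"
        unfolding x using \<omega> by Groebner_Basis.algebra
      finally show "9 * (x3^3 + x4^3 + x5^3) = s^3 + B + 6 * (s * C)"
        unfolding r(1) B by (metis mult_left_cancel zero_neq_numeral)
    qed
    have "x1 + x2 + x3 + x4 + x5 = 0" using s12(1) s345(1) by Groebner_Basis.algebra
    moreover have "6 * (x1^2 + x2^2 + x3^2 + x4^2 + x5^2) = 0"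
      using s12(2) s345(2) BC by Groebner_Basis.algebra
    moreover have "36 * (x1^3 + x2^3 + x3^3 + x4^3 + x5^3) = 0"
      using s12(3) s345(3) BC by Groebner_Basis.algebra
    ultimately have cone: "x \<in> bring_cone"
      by (simp only: mult_eq_0_iff bring_cone_iff x_def vec5_nth) simp
    have "resolvent \<omega> x = p" "resolvent (\<omega>^2) x = r"
    proof -
      have "3 * resolvent \<omega> x = 3 * x3 + \<omega> * (3 * x4) + \<omega>^2 * (3 * x5)"
        "3 * resolvent (\<omega>^2) x = 3 * x3 + \<omega>^2 * (3 * x4) + \<omega>^4 * (3 * x5)"
        unfolding resolvent_def x_def vec5_nth by Groebner_Basis.algebra+
      then have "3 * resolvent \<omega> x = 3 * p" "3 * resolvent (\<omega>^2) x = 3 * r"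
        unfolding x using \<omega> by Groebner_Basis.algebra+
      then show "resolvent \<omega> x = p" "resolvent (\<omega>^2) x = r" by simp_all
    qed
    with resolvent_cubes_diff[OF \<omega>, of x]
    have "3 * (2 * \<omega> + 1) * vandermonde345 x = p^3 - r^3" by simp
    moreover have "2 * (p^3 - r^3) = 2 * L" using p r(2) by Groebner_Basis.algebra
    then have "p^3 - r^3 = L" by (metis mult_left_cancel zero_neq_numeral)
    ultimately have "3 * (2 * \<omega> + 1) * vandermonde345 x = 3 * (2 * \<omega> + 1) * V" by (simp only: L_def)
    moreover have "3 * (2 * \<omega> + 1) \<noteq> 0"
    proof
      assume "3 * (2 * \<omega> + 1) = 0"
      with \<omega> have "(27::complex) = 0" by Groebner_Basis.algebra
      then show False by simp
    qed
    ultimately have "vandermonde345 x = V" by (metis mult_left_cancel)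
    moreover have "sum345 x = s" using s345(1) by (simp add: sum345_def x_def)
    moreover have "diff12 x = d" by (simp add: diff12_def x_def x1_def x2_def field_simps)
    ultimately have "X x = u \<and> Y x = v \<and> Z x = w"
      unfolding X_def Y_def Z_def using s(1) v d by simp
    then show "\<exists>x\<in>bring_cone. X x = u \<and> Y x = v \<and> Z x = w" using cone by blast
  qed simp_all
qed

theorem mainTheorem9:
  shows "bring_quotient {cycle_of_list [1, 2] \<circ> cycle_of_list [3, 4], cycle_of_list [3, 4, 5]}
           \<cong>\<^sub>v bring_quotient {cycle_of_list [1, 2] \<circ> cycle_of_list [3, 4],
                            cycle_of_list [1, 3] \<circ> cycle_of_list [2, 4]}
       \<and> elliptic_with_j
           (bring_quotient {cycle_of_list [1, 2] \<circ> cycle_of_list [3, 4], cycle_of_list [3, 4, 5]})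
           (- (5 * 29 ^ 3 / 2 ^ 5))
       \<and> elliptic_with_j
           (bring_quotient {cycle_of_list [1, 2] \<circ> cycle_of_list [3, 4],
                            cycle_of_list [1, 3] \<circ> cycle_of_list [2, 4]})
           (- (5 * 29 ^ 3 / 2 ^ 5))
       \<and> bring_quotient {cycle_of_list [1, 2]} \<cong>\<^sub>v bring_quotient {cycle_of_list [1, 3, 2, 4]}
       \<and> elliptic_with_j (bring_quotient {cycle_of_list [1, 2]}) (- (25 / 2))
       \<and> elliptic_with_j (bring_quotient {cycle_of_list [1, 3, 2, 4]}) (- (25 / 2))"
proof -
  have j1: "elliptic_with_j Q (- (25 / 2))" if "Q \<cong>\<^sub>v weierstrass_curve (-25/3) (-2950/27)"
    for Q :: "(complex ^ 5) set set fun_space"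
    unfolding elliptic_with_j_def using that
    by (intro exI[of _ "-25/3"] exI[of _ "-2950/27"])
      (simp add: weierstrass_j_def power2_eq_square power3_eq_cube)
  have j2: "elliptic_with_j Q (- (5 * 29 ^ 3 / 2 ^ 5))"
    if "Q \<cong>\<^sub>v weierstrass_curve (-3625/3) (526250/27)" for Q :: "(complex ^ 5) set set fun_space"
    unfolding elliptic_with_j_def using that
    by (intro exI[of _ "-3625/3"] exI[of _ "526250/27"])
      (simp add: weierstrass_j_def power2_eq_square power3_eq_cube)
  show ?thesis
    by (intro conjI j1 j2 bring_quotient_12 bring_quotient_1324 bring_quotient_klein bring_quotient_S3
        sp_isomorphic_trans[OF bring_quotient_S3 sp_isomorphic_sym[OF bring_quotient_klein]]
        sp_isomorphic_trans[OF bring_quotient_12 sp_isomorphic_sym[OF bring_quotient_1324]])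
qed

end
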